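(* Let $G$ be a finite group of order $L\ge2$ and let $\Psi_{\mathrm{all}}$ be the list of all frequencies, i.e. all irreducible complex representations of $G$ up to isomorphism, excluding the trivial one and taking only one from each conjugate pair $\{\rho,\bar\rho\}$ of complex-type representations. Let $\lambda_\rho\ge0$ for $\rho\in\Psi_{\mathrm{all}}$. If for all $\rho\in\Psi_{\mathrm{all}}$, $$\lambda_\rho<\lambda^*_L:=\sqrt{\frac{2(L-1)\log(L-1)}{L(L-2)}}$$ (where for $L=2$ we set $\lambda^*_2=1$, the limit value of the $0/0$ expression), then $\mathrm{GSynch}_n(\{\lambda_\rho\},G,\Psi_{\mathrm{all}})$ is contiguous to $\mathrm{GSynch}_n(0,G,\Psi_{\mathrm{all}})$.
   Context: Representations. Every irreducible complex representation $\rho$ of a finite group $G$ may be taken unitary and has real, complex, or quaternionic type. Real-type representations are taken to be defined by unitary matrices over $\mathbb{R}$, complex-type over $\mathbb{C}$, and quaternionic-type over the quaternions $\mathbb{H}$ (via the standard embedding of $\mathbb{H}$ into $2\times2$ complex matrices). $d_\rho$ is the dimension of $\rho$ over $\mathbb{R},\mathbb{C},\mathbb{H}$ respectively (so for quaternionic type $d_\rho$ is half the complex dimension), and $\beta_\rho=1,2,4$ respectively. Noise. A standard Gaussian of real, complex, quaternionic type is $\mathcal{N}(0,1)$; $\mathcal{N}(0,\frac12)+\mathcal{N}(0,\frac12)i$; $\mathcal{N}(0,\frac14)+\mathcal{N}(0,\frac14)i+\mathcal{N}(0,\frac14)j+\mathcal{N}(0,\frac14)k$, respectively, with independent components. A GOE,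 GUE, GSE matrix is a random Hermitian matrix over $\mathbb{R},\mathbb{C},\mathbb{H}$ respectively, with off-diagonal entries standard Gaussians of the corresponding type and diagonal entries real $\mathcal{N}(0,2/\beta)$, $\beta=1,2,4$ respectively, independent except for the Hermitian constraint. Model. $\mathrm{GSynch}_n(\{\lambda_\rho\},G,\Psi)$, with $\lambda_\rho\ge0$ for $\rho\in\Psi$: draw $g\in G^n$ with independent uniformly distributed coordinates. Let $X_\rho$ be the $nd_\rho\times d_\rho$ matrix obtained by stacking the matrices $\rho(g_u)$, $u=1,\dots,n$. For each $\rho\in\Psi$ reveal the $nd_\rho\times nd_\rho$ matrix $Y_\rho=\frac{\lambda_\rho}nX_\rho X_\rho^*+\frac1{\sqrt{nd_\rho}}W_\rho$, where $W_\rho$ is a GOE, GUE or GSE matrix according to the type of $\rho$; the $W_\rho$ are independent across $\rho$ and independent of $g$. The model is the joint law of $\{Y_\rho\}_{\rho\in\Psi}$. Writing $0$ in place of $\{\lambda_\rho\}$ means $\lambda_\rho=0$ for all $\rho$. Contiguity: for sequences of probability measures $P_n,Q_n$ on measurable spaces $(\Omega_n,\mathcal{F}_n)$, $P_n$ is contiguous to $Q_n$ if for every sequence of events $A_n\in\mathcal{F}_n$, $Q_n(A_n)\to0$ implies $P_n(A_n)\to0$ as $n\to\infty$. *)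

theory Defs
  imports
    "HOL-Probability.Probability"
    "HOL-Algebra.Algebra"
    "Jordan_Normal_Form.Schur_Decomposition"
    "Jordan_Normal_Form.VS_Connect"
begin

section \<open>Representations of a finite group and their types\<close>

definition is_rep :: "('g, 'b) monoid_scheme \<Rightarrow> nat \<Rightarrow> ('g \<Rightarrow> complex mat) \<Rightarrow> bool" where
  "is_rep G D \<rho> \<longleftrightarrow>
     (\<forall>x\<in>carrier G. \<rho> x \<in> carrier_mat D D) \<and>
     \<rho> \<one>\<^bsub>G\<^esub> = 1\<^sub>m D \<and>
     (\<forall>x\<in>carrier G. \<forall>y\<in>carrier G. \<rho> (x \<otimes>\<^bsub>G\<^esub> y) = \<rho> x * \<rho> y)"

text \<open>The dimension of a representation over the complex numbers, whatever its type.\<close>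

definition rep_degree :: "('g, 'b) monoid_scheme \<Rightarrow> ('g \<Rightarrow> complex mat) \<Rightarrow> nat" where
  "rep_degree G \<rho> = dim_row (\<rho> \<one>\<^bsub>G\<^esub>)"

definition irreducible_rep :: "('g, 'b) monoid_scheme \<Rightarrow> ('g \<Rightarrow> complex mat) \<Rightarrow> bool" where
  "irreducible_rep G \<rho> \<longleftrightarrow>
     (let D = rep_degree G \<rho> in
       is_rep G D \<rho> \<and> D > 0 \<and>
       (\<forall>W. VectorSpace.subspace class_ring W (module_vec TYPE(complex) D) \<longrightarrow>
            (\<forall>x\<in>carrier G. \<forall>w\<in>W. \<rho> x *\<^sub>v w \<in> W) \<longrightarrow>
            W = {0\<^sub>v D} \<or> W = carrier_vec D))"

definition unitary_rep :: "('g, 'b) monoid_scheme \<Rightarrow> ('g \<Rightarrow> complex mat) \<Rightarrow> bool" where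
  "unitary_rep G \<rho> \<longleftrightarrow>
     (\<forall>x\<in>carrier G. \<rho> x * mat_adjoint (\<rho> x) = 1\<^sub>m (rep_degree G \<rho>))"

definition rep_iso ::
  "('g, 'b) monoid_scheme \<Rightarrow> ('g \<Rightarrow> complex mat) \<Rightarrow> ('g \<Rightarrow> complex mat) \<Rightarrow> bool" where
  "rep_iso G \<rho> \<sigma> \<longleftrightarrow>
     rep_degree G \<rho> = rep_degree G \<sigma> \<and>
     (\<exists>P\<in>carrier_mat (rep_degree G \<rho>) (rep_degree G \<rho>).
        invertible_mat P \<and> (\<forall>x\<in>carrier G. P * \<rho> x = \<sigma> x * P))"

definition conj_rep :: "('g \<Rightarrow> complex mat) \<Rightarrow> 'g \<Rightarrow> complex mat" where
  "conj_rep \<rho> = (\<lambda>x. map_mat cnj (\<rho> x))"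

definition trivial_rep :: "'g \<Rightarrow> complex mat" where
  "trivial_rep = (\<lambda>_. 1\<^sub>m 1)"

datatype rep_kind = Real_Type | Complex_Type | Quaternionic_Type

fun beta :: "rep_kind \<Rightarrow> nat" where
  "beta Real_Type = 1"
| "beta Complex_Type = 2"
| "beta Quaternionic_Type = 4"

text \<open>
  Matrices over R, C and H are all handled as complex matrices.  The matrix whose entry in
  position (p,q) has real coordinates f p q 0, ..., f p q (beta - 1) is turned into a complex
  matrix; a quaternion a + b i + c j + d k becomes the 2 x 2 block with rows (a + b i, c + d i)
  and (- c + d i, a - b i).  This embedding is an injective real algebra homomorphism taking
  quaternionic conjugate transposes to complex conjugate transposes.
\<close>

fun quat_block :: "(nat \<Rightarrow> real) \<Rightarrow> nat \<Rightarrow> nat \<Rightarrow> complex" where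
  "quat_block h a b =
     (if a = 0 then (if b = 0 then Complex (h 0) (h 1) else Complex (h 2) (h 3))
      else (if b = 0 then Complex (- h 2) (h 3) else Complex (h 0) (- h 1)))"

fun embed_dim :: "rep_kind \<Rightarrow> nat \<Rightarrow> nat" where
  "embed_dim Real_Type N = N"
| "embed_dim Complex_Type N = N"
| "embed_dim Quaternionic_Type N = 2 * N"

fun embed_mat :: "rep_kind \<Rightarrow> nat \<Rightarrow> (nat \<Rightarrow> nat \<Rightarrow> nat \<Rightarrow> real) \<Rightarrow> complex mat" where
  "embed_mat Real_Type N f = Matrix.mat N N (\<lambda>(p, q). complex_of_real (f p q 0))"
| "embed_mat Complex_Type N f = Matrix.mat N N (\<lambda>(p, q). Complex (f p q 0) (f p q 1))"
| "embed_mat Quaternionic_Type N f =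
     Matrix.mat (2 * N) (2 * N)
       (\<lambda>(i, j). quat_block (f (i div 2) (j div 2)) (i mod 2) (j mod 2))"

definition rep_over ::
  "rep_kind \<Rightarrow> nat \<Rightarrow> ('g, 'b) monoid_scheme \<Rightarrow> ('g \<Rightarrow> complex mat) \<Rightarrow> bool" where
  "rep_over t d G \<rho> \<longleftrightarrow> (\<forall>x\<in>carrier G. \<exists>f. \<rho> x = embed_mat t d f)"

text \<open>
  The classical trichotomy for an irreducible complex representation: complex type if it is
  not isomorphic to its conjugate; otherwise real type if it can be realised by real matrices
  and quaternionic type if it cannot.
\<close>

definition rep_type :: "('g, 'b) monoid_scheme \<Rightarrow> ('g \<Rightarrow> complex mat) \<Rightarrow> rep_kind" where
  "rep_type G \<rho> =
     (if \<not> rep_iso G \<rho> (conj_rep \<rho>) then Complex_Type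
      else if \<exists>\<sigma> D. is_rep G D \<sigma> \<and> rep_iso G \<rho> \<sigma> \<and> rep_over Real_Type D G \<sigma> then Real_Type
      else Quaternionic_Type)"

text \<open>The dimension over R, C or H according to type.\<close>

definition rep_dim :: "('g, 'b) monoid_scheme \<Rightarrow> ('g \<Rightarrow> complex mat) \<Rightarrow> nat" where
  "rep_dim G \<rho> =
     (if rep_type G \<rho> = Quaternionic_Type then rep_degree G \<rho> div 2 else rep_degree G \<rho>)"

text \<open>
  A frequency is a nontrivial irreducible representation given in normal form: by unitary
  matrices over R, C or H according to its type.
\<close>

definition frequency :: "('g, 'b) monoid_scheme \<Rightarrow> ('g \<Rightarrow> complex mat) \<Rightarrow> bool" where
  "frequency G \<rho> \<longleftrightarrow>
     irreducible_rep G \<rho> \<and> \<not> rep_iso G \<rho> trivial_rep \<and>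
     unitary_rep G \<rho> \<and> rep_over (rep_type G \<rho>) (rep_dim G \<rho>) G \<rho>"

text \<open>
  Representations of real or quaternionic type are isomorphic to their conjugates, so the
  second disjunct matters for complex type only, where it keeps one of each conjugate pair.
\<close>

definition all_frequencies :: "('g, 'b) monoid_scheme \<Rightarrow> ('g \<Rightarrow> complex mat) set \<Rightarrow> bool" where
  "all_frequencies G \<Psi> \<longleftrightarrow>
     finite \<Psi> \<and> (\<forall>\<rho>\<in>\<Psi>. frequency G \<rho>) \<and>
     (\<forall>\<sigma>. irreducible_rep G \<sigma> \<and> \<not> rep_iso G \<sigma> trivial_rep \<longrightarrow>
          (\<exists>!\<rho>. \<rho> \<in> \<Psi> \<and> (rep_iso G \<sigma> \<rho> \<or> rep_iso G \<sigma> (conj_rep \<rho>))))"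

section \<open>The synchronization model\<close>

text \<open>The Borel sigma-algebra on N x N complex matrices.\<close>

definition mat_borel :: "nat \<Rightarrow> complex mat measure" where
  "mat_borel N =
     vimage_algebra (carrier_mat N N)
       (\<lambda>A. \<lambda>(i, j)\<in>{..<N} \<times> {..<N}. A $$ (i, j))
       (\<Pi>\<^sub>M ij\<in>{..<N} \<times> {..<N}. (borel :: complex measure))"

text \<open>
  The independent real Gaussians in the upper triangle of an N x N GOE, GUE or GSE matrix:
  position (p,q), coordinate c.  The second argument of normal_density is the standard deviation.
\<close>

definition gaussian_coords :: "rep_kind \<Rightarrow> nat \<Rightarrow> (nat \<times> nat \<times> nat \<Rightarrow> real) measure" where
  "gaussian_coords t N =
     (\<Pi>\<^sub>M (p, q, c)\<in>{(p, q, c). p \<le> q \<and> q < N \<and> c < beta t \<and> (p = q \<longrightarrow> c = 0)}.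
        density lborel
          (normal_density 0 (if p = q then sqrt (2 / beta t) else sqrt (1 / beta t))))"

text \<open>Below the diagonal, conjugation negates every coordinate except the real one.\<close>

definition hermitian_coords ::
  "(nat \<times> nat \<times> nat \<Rightarrow> real) \<Rightarrow> nat \<Rightarrow> nat \<Rightarrow> nat \<Rightarrow> real" where
  "hermitian_coords z p q c =
     (if p < q then z (p, q, c)
      else if p = q then (if c = 0 then z (p, p, 0) else 0)
      else (if c = 0 then z (q, p, 0) else - z (q, p, c)))"

definition gaussian_ensemble :: "rep_kind \<Rightarrow> nat \<Rightarrow> complex mat measure" where
  "gaussian_ensemble t N =
     distr (gaussian_coords t N) (mat_borel (embed_dim t N))
       (\<lambda>z. embed_mat t N (hermitian_coords z))"

definition stack ::
  "('g, 'b) monoid_scheme \<Rightarrow> nat \<Rightarrow> ('g \<Rightarrow> complex mat) \<Rightarrow> (nat \<Rightarrow> 'g) \<Rightarrow> complex mat" where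
  "stack G n \<rho> g =
     (let D = rep_degree G \<rho> in
       Matrix.mat (n * D) D (\<lambda>(i, j). \<rho> (g (i div D)) $$ (i mod D, j)))"

definition observation ::
  "('g, 'b) monoid_scheme \<Rightarrow> nat \<Rightarrow> (('g \<Rightarrow> complex mat) \<Rightarrow> real) \<Rightarrow> ('g \<Rightarrow> complex mat) \<Rightarrow>
   (nat \<Rightarrow> 'g) \<Rightarrow> complex mat \<Rightarrow> complex mat" where
  "observation G n lam \<rho> g W =
     complex_of_real (lam \<rho> / real n) \<cdot>\<^sub>m (stack G n \<rho> g * mat_adjoint (stack G n \<rho> g)) +
     complex_of_real (1 / sqrt (real (n * rep_dim G \<rho>))) \<cdot>\<^sub>m W"

definition GSynch ::
  "nat \<Rightarrow> (('g \<Rightarrow> complex mat) \<Rightarrow> real) \<Rightarrow> ('g, 'b) monoid_scheme \<Rightarrow> ('g \<Rightarrow> complex mat) set \<Rightarrow>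
   (('g \<Rightarrow> complex mat) \<Rightarrow> complex mat) measure" where
  "GSynch n lam G \<Psi> =
     distr
       ((\<Pi>\<^sub>M u\<in>{..<n}. uniform_count_measure (carrier G)) \<Otimes>\<^sub>M
        (\<Pi>\<^sub>M \<rho>\<in>\<Psi>. gaussian_ensemble (rep_type G \<rho>) (n * rep_dim G \<rho>)))
       (\<Pi>\<^sub>M \<rho>\<in>\<Psi>. mat_borel (n * rep_degree G \<rho>))
       (\<lambda>(g, W). \<lambda>\<rho>\<in>\<Psi>. observation G n lam \<rho> g (W \<rho>))"

section \<open>Contiguity and the threshold\<close>

definition contiguous :: "(nat \<Rightarrow> 'a measure) \<Rightarrow> (nat \<Rightarrow> 'a measure) \<Rightarrow> bool" where
  "contiguous P Q \<longleftrightarrow>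
     (\<forall>n. prob_space (P n) \<and> prob_space (Q n) \<and> sets (P n) = sets (Q n)) \<and>
     (\<forall>A. (\<forall>n. A n \<in> sets (Q n)) \<longrightarrow>
          (\<lambda>n. measure (Q n) (A n)) \<longlonglongrightarrow> 0 \<longrightarrow>
          (\<lambda>n. measure (P n) (A n)) \<longlonglongrightarrow> 0)"

definition lambda_star :: "nat \<Rightarrow> real" where
  "lambda_star L =
     (if L = 2 then 1
      else sqrt (2 * (real L - 1) * ln (real L - 1) / (real L * (real L - 2))))"

end

theory Submission
  imports Defs "HOL-Real_Asymp.Real_Asymp" "Jordan_Normal_Form.Spectral_Radius"
begin

text \<open>
  The second moment method.  In the real coordinates of the noise, the planted model is a uniform
  mixture over \<open>g\<close> of Gaussian shifts, so the second moment of its likelihood ratio is the average over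
  two independent words \<open>g\<close>, \<open>g'\<close> of \<open>exp\<close> of the inner product of the two signals.  This inner product depends
  only on \<open>h u = inv (g u) \<otimes> g' u\<close>, and Schur orthogonality with Bessel's inequality bounds
  it by \<open>(\<lambda>\<^sup>2 L / 2 n) \<Sum>x. (N x - n / L)\<^sup>2\<close>, where \<open>N x\<close> counts the occurrences of \<open>x\<close> in \<open>h\<close> and
  \<open>\<lambda>\<close> is the largest of the signal strengths.  Linearising the
  square by an auxiliary Gaussian vector turns the average over \<open>h\<close> into a power of the moment
  generating function of one uniform letter, which is subgaussian with the constant dual to the sharp
  inequality between the Kullback-Leibler divergence from the uniform distribution and the squared
  Euclidean distance.  This bounds the second moment uniformly in \<open>n\<close> below the threshold, and the
  Cauchy-Schwarz inequality gives contiguity.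
\<close>

section \<open>Divergence from the uniform distribution and Euclidean distance\<close>

text \<open>The threshold balances two exponential rates. A word of length n with letter frequencies
  \<alpha> has probability about exp(- n D), where D is the divergence of \<alpha> from the uniform
  u, while its weight is exp(n c |\<alpha> - u|^2 / 2) with c = \<lambda>^2 L. So c / 2 must stay
  below the best K in D >= K |\<alpha> - u|^2. For L > 2 equality holds at one entry 1 - 1/L and all
  others 1 / (L (L - 1)), which gives K = (L - 1) ln (L - 1) / (L - 2); for L = 2 the second-order
  expansion at u gives K = 1. Counting words by type would leave polynomial factors in n; the moment
  generating function form leaves none.

  The three types are the other obstacle. The factors \<open>beta\<close>, \<open>rep_dim\<close>
  and the doubling in the quaternionic embedding combine to the complex degree, times 2 exactly for
  complex type. That 2 accounts for the conjugate missing from \<Psi>, so Bessel's inequality can be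
  applied to a family containing both members of each pair. The noise lives on real subspaces of
  complex matrices, hence likelihood ratios are taken in real coordinates, where the noise is a
  product of one-dimensional Gaussians.\<close>

definition kl_const :: "nat \<Rightarrow> real" where
  "kl_const L = (if L = 2 then 1 else (real L - 1) * ln (real L - 1) / (real L - 2))"

lemma kl_const_pos: "L \<ge> 2 \<Longrightarrow> kl_const L > 0"
  by (auto simp: kl_const_def intro!: divide_pos_pos mult_pos_pos)

text \<open>The deficit in the inequality \<open>kl_quadratic\<close> below, for the probability vector with one entry \<open>b\<close> and
  \<open>L - 1\<close> equal entries.  It is symmetric about \<open>1/2\<close> and vanishes at \<open>1/L\<close>, hence also at \<open>1 - 1/L\<close>;
  this is where the constant comes from.\<close>

definition two_level_gap :: "nat \<Rightarrow> real \<Rightarrow> real" where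
  "two_level_gap L b = b * ln b + (1 - b) * ln (1 - b) - (1 - b) * ln (real L - 1) + ln L
     - kl_const L * L / (real L - 1) * (b - 1 / L)\<^sup>2"

text \<open>Under \<open>b\<close> to \<open>1 - b\<close> the entropy is invariant, the term with
  \<open>ln (real L - 1)\<close> changes by a multiple of \<open>1 - 2 * b\<close>, and so does the
  quadratic term. The value of \<open>kl_const\<close> is the one for which the two changes
  cancel.\<close>

lemma two_level_gap_symmetric:
  assumes "L \<ge> 2"
  shows "two_level_gap L (1 - b) = two_level_gap L b"
proof -
  define K where "K = kl_const L"
  define l where "l = ln (real L - 1)"
  \<comment> \<open>The product form also covers \<open>L = 2\<close>, where both sides
    vanish.\<close>
  have Kl: "K * (real L - 2) = (real L - 1) * l"
    using assms by (auto simp: K_def l_def kl_const_def)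
  have L: "real L > 1" using assms by simp
  have "two_level_gap L (1 - b) - two_level_gap L b =
      (1 - 2 * b) * l - K * L / (real L - 1) * ((1 - b - 1 / L)\<^sup>2 - (b - 1 / L)\<^sup>2)"
    by (simp add: two_level_gap_def K_def l_def algebra_simps)
  also have "(1 - b - 1 / L)\<^sup>2 - (b - 1 / L)\<^sup>2 = (1 - 2 * b) * (real L - 2) / L"
    using L by (simp add: power2_eq_square field_simps)
  also have "K * L / (real L - 1) * ((1 - 2 * b) * (real L - 2) / L) =
      (1 - 2 * b) * (K * (real L - 2)) / (real L - 1)"
    using L by (simp add: field_simps)
  also have "\<dots> = (1 - 2 * b) * l"
    unfolding Kl using L by simp
  finally show ?thesis by simp
qed

text \<open>The derivative \<open>g\<close> of the gap is convex on [1/2, 1) and vanishes at 1/2 and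
  at \<open>p = 1 - 1 / L\<close>. Hence it is nonpositive up to \<open>p\<close> and nonnegative
  after it, so \<open>p\<close> is the minimum; by symmetry the value there is the value at
  \<open>1 / L\<close>, the uniform vector, which is 0.\<close>

lemma two_level_gap_nonneg_upper:
  assumes L: "L \<ge> 2" and b: "1 / 2 \<le> b" "b < 1"
  shows "two_level_gap L b \<ge> 0"
proof -
  define K where "K = kl_const L"
  define l where "l = ln (real L - 1)"
  define k where "k = 2 * K * L / (real L - 1)"
  define p where "p = 1 - 1 / real L"
  define g where "g x = ln x - ln (1 - x) - k * (x - 1 / 2)" for x
  have Kl: "K * (real L - 2) = (real L - 1) * l"
    using L by (auto simp: K_def l_def kl_const_def)
  have L1: "real L > 1" using L by simp
  have p: "1 / 2 \<le> p" "p < 1" using L by (auto simp: p_def field_simps)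
  \<comment> \<open>This moves the centre of the affine part of the derivative from
    \<open>1 / L\<close> to \<open>1 / 2\<close>, so that \<open>g\<close> becomes odd about
    \<open>1 / 2\<close>.\<close>
  have lin: "l + k * (1 / L - 1 / 2) = 0"
  proof -
    have "k * (1 / L - 1 / 2) = - (K * (real L - 2)) / (real L - 1)"
      using L1 by (simp add: k_def field_simps)
    then show ?thesis unfolding Kl using L1 by simp
  qed
  have der: "(two_level_gap L has_real_derivative g x) (at x)" if "0 < x" "x < 1" for x
  proof -
    define c d q where "c = K * L / (real L - 1)" and "d = ln (real L)" and "q = 1 / real L"
    have k: "2 * c = k" by (simp add: c_def k_def)
    have "((\<lambda>b. b * ln b + (1 - b) * ln (1 - b) - (1 - b) * l + d - c * (b - q)\<^sup>2)
        has_real_derivative ln x - ln (1 - x) + l - (2 * c) * (x - q)) (at x)"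
      using that by (auto intro!: derivative_eq_intros simp: divide_simps)
    then have "(two_level_gap L has_real_derivative ln x - ln (1 - x) + l - k * (x - 1 / L)) (at x)"
      unfolding k unfolding two_level_gap_def[abs_def] c_def d_def q_def K_def l_def .
    moreover have "ln x - ln (1 - x) + l - k * (x - 1 / L) = g x"
      using lin by (simp add: g_def algebra_simps)
    ultimately show ?thesis by simp
  qed
  have gder: "(g has_real_derivative 1 / x + 1 / (1 - x) - k) (at x)" if "0 < x" "x < 1" for x
    unfolding g_def[abs_def] using that by (auto intro!: derivative_eq_intros simp: field_simps)
  have ghalf: "g (1 / 2) = 0" by (simp add: g_def)
  have gp: "g p = 0"
  proof -
    have "ln p - ln (1 - p) = l"
    proof -
      have "p = (real L - 1) / L" "1 - p = 1 / L" using L1 by (auto simp: p_def field_simps)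
      then show ?thesis using L1 by (simp add: l_def ln_div)
    qed
    moreover have "p - 1 / 2 = - (1 / L - 1 / 2)" by (simp add: p_def)
    ultimately show ?thesis using lin unfolding g_def by (metis add.commute diff_minus_eq_add mult_minus_right add_eq_0_iff)
  qed
  have conv: "convex_on {1/2..<1} g"
  proof (rule f''_ge0_imp_convex)
    show "convex {1/2..<(1::real)}" by simp
    show "DERIV g x :> 1 / x + 1 / (1 - x) - k" if "x \<in> {1/2..<1}" for x using gder that by auto
    show "DERIV (\<lambda>x. 1 / x + 1 / (1 - x) - k) x :> - 1 / x\<^sup>2 + 1 / (1 - x)\<^sup>2" if "x \<in> {1/2..<1}" for x
      using that by (auto intro!: derivative_eq_intros simp: field_simps power2_eq_square)
    show "- 1 / x\<^sup>2 + 1 / (1 - x)\<^sup>2 \<ge> 0" if "x \<in> {1/2..<1}" for x :: real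
    proof -
      have "(1 - x)\<^sup>2 \<le> x\<^sup>2" using that by (intro power_mono) auto
      moreover have "(1 - x)\<^sup>2 > 0" using that by auto
      moreover have "x\<^sup>2 > 0" using that by auto
      ultimately have "1 / x\<^sup>2 \<le> 1 / (1 - x)\<^sup>2" by (intro divide_left_mono) auto
      then show ?thesis by simp
    qed
  qed
  have gneg: "g x \<le> 0" if "1 / 2 \<le> x" "x \<le> p" for x
  proof (cases "p = 1 / 2")
    case True then show ?thesis using that ghalf by (metis order_antisym order_refl)
  next
    case False
    define t where "t = (x - 1 / 2) / (p - 1 / 2)"
    have t: "0 \<le> t" "t \<le> 1" using that False p by (auto simp: t_def field_simps)
    have "t * (p - 1 / 2) = x - 1 / 2" using False by (simp add: t_def)
    then have "x = (1 - t) *\<^sub>R (1 / 2) + t *\<^sub>R p" by (simp add: field_simps)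
    then show ?thesis using convex_onD[OF conv t, of "1/2" p] ghalf gp p by auto
  qed
  \<comment> \<open>For \<open>L = 2\<close> the two zeros of \<open>g\<close> coincide and the
    chord argument is void; there \<open>k = 4\<close> and \<open>g\<close> is increasing because
    1/y + 1/(1 - y) is at least 4. Otherwise \<open>p\<close> lies on the chord from 1/2 to
    \<open>x\<close>, and \<open>g p = 0\<close> forces \<open>g x\<close> to be
    nonnegative.\<close>
  have gpos: "g x \<ge> 0" if "p \<le> x" "x < 1" for x
  proof (cases "L = 2")
    case True
    have k4: "k = 4" "p = 1 / 2" using True by (auto simp: k_def K_def kl_const_def p_def)
    have "g (1 / 2) \<le> g x"
    proof (rule DERIV_nonneg_imp_nondecreasing[where f = g and a = "1 / 2" and b = x])
      show "1 / 2 \<le> x" using that k4 by simp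
      fix y assume y: "1 / 2 \<le> y" "y \<le> x"
      then have y1: "0 < y" "y < 1" using that by auto
      have "0 \<le> (2 * y - 1)\<^sup>2" by simp
      then have "4 \<le> 1 / y + 1 / (1 - y)"
        using y1 by (simp add: field_simps power2_eq_square)
      then show "\<exists>z. (g has_real_derivative z) (at y) \<and> 0 \<le> z"
        using gder[OF y1] k4 by (intro exI[of _ "1 / y + 1 / (1 - y) - k"]) auto
    qed
    then show ?thesis using ghalf by simp
  next
    case False
    then have ph: "p > 1 / 2" using L by (auto simp: p_def field_simps)
    define t where "t = (p - 1 / 2) / (x - 1 / 2)"
    have t: "0 < t" "t \<le> 1" using that ph by (auto simp: t_def field_simps)
    have "t * (x - 1 / 2) = p - 1 / 2" using ph that by (simp add: t_def)
    then have "p = (1 - t) *\<^sub>R (1 / 2) + t *\<^sub>R x" by (simp add: field_simps)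
    then have "g p \<le> t * g x" using convex_onD[OF conv _ t(2), of "1/2" x] t ghalf that ph by auto
    then show ?thesis using t gp by (simp add: zero_le_mult_iff)
  qed
  have min: "two_level_gap L p \<le> two_level_gap L b"
  proof (cases "b \<le> p")
    case True
    show ?thesis
    proof (rule DERIV_nonpos_imp_nonincreasing[OF True])
      fix x assume "b \<le> x" "x \<le> p"
      then show "\<exists>y. (two_level_gap L has_real_derivative y) (at x) \<and> y \<le> 0"
        using b p by (intro exI[of _ "g x"] conjI der gneg) auto
    qed
  next
    case False
    show ?thesis
    proof (rule DERIV_nonneg_imp_nondecreasing[where a = p and b = b])
      show "p \<le> b" using False by simp
      fix x assume "p \<le> x" "x \<le> b"
      then show "\<exists>y. (two_level_gap L has_real_derivative y) (at x) \<and> 0 \<le> y"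
        using b p by (intro exI[of _ "g x"] conjI der gpos) auto
    qed
  qed
  have "two_level_gap L p = two_level_gap L (1 / L)"
    using two_level_gap_symmetric[OF L, of "1 / L"] by (simp add: p_def)
  also have "\<dots> = 0"
  proof -
    have e: "1 - 1 / real L = (real L - 1) / L" using L1 by (simp add: field_simps)
    show ?thesis
      unfolding two_level_gap_def e using L1 by (simp add: ln_div field_simps)
  qed
  finally show ?thesis using min by simp
qed

lemma two_level_gap_nonneg:
  assumes "L \<ge> 2" "0 < b" "b < 1"
  shows "two_level_gap L b \<ge> 0"
proof (cases "1 / 2 \<le> b")
  case True then show ?thesis using two_level_gap_nonneg_upper assms by blast
next
  case False
  then show ?thesis
    using two_level_gap_nonneg_upper[OF assms(1), of "1 - b"] two_level_gap_symmetric[OF assms(1), of b] assms by simp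
qed


section \<open>Minimising entropy minus a quadratic on the simplex\<close>

lemma ln_less_minus_one: "0 < x \<Longrightarrow> x \<noteq> 1 \<Longrightarrow> ln x < x - 1" for x :: real
  using ln_le_minus_one[of x] ln_eq_minus_one[of x] by linarith

text \<open>Up to the constant 1, \<open>ln x - 2 * A * x\<close> is the derivative of
  \<open>ent A\<close> below, and Lagrange's condition equates its values at the coordinates of a
  minimiser. The monotonicity on either side of its critical point \<open>1 / (2 * A)\<close>
  follows from the strict bound ln u < u - 1 at the two quotients.\<close>

lemma ln_minus_linear_less:
  fixes A :: real
  assumes "A > 0" "0 < x" "x < y"
  shows "y \<le> 1 / (2 * A) \<Longrightarrow> ln x - 2 * A * x < ln y - 2 * A * y"
    and "1 / (2 * A) \<le> x \<Longrightarrow> ln y - 2 * A * y < ln x - 2 * A * x"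
proof -
  assume y: "y \<le> 1 / (2 * A)"
  have "ln (x / y) < x / y - 1" using assms by (intro ln_less_minus_one) auto
  moreover have "2 * A * (y - x) \<le> 1 / y * (y - x)"
    using assms y by (intro mult_right_mono) (auto simp: field_simps)
  moreover have "1 / y * (y - x) = 1 - x / y" "ln (x / y) = ln x - ln y"
    using assms by (auto simp: ln_div field_simps)
  ultimately show "ln x - 2 * A * x < ln y - 2 * A * y"
    by (simp add: algebra_simps)
next
  assume x: "1 / (2 * A) \<le> x"
  have "ln (y / x) < y / x - 1" using assms by (intro ln_less_minus_one) auto
  moreover have "1 / x * (y - x) \<le> 2 * A * (y - x)"
    using assms x by (intro mult_right_mono) (auto simp: field_simps)
  moreover have "1 / x * (y - x) = y / x - 1" "ln (y / x) = ln y - ln x"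
    using assms by (auto simp: ln_div field_simps)
  ultimately show "ln y - 2 * A * y < ln x - 2 * A * x"
    by (simp add: algebra_simps)
qed

text \<open>For a probability vector of length L, the sum of \<open>ent A\<close> over the entries
  plus ln L + A / L is the divergence from uniform minus A times the squared distance from
  it.\<close>

definition ent :: "real \<Rightarrow> real \<Rightarrow> real" where
  "ent A x = x * ln x - A * x\<^sup>2"

lemma DERIV_ent: "0 < x \<Longrightarrow> (ent A has_real_derivative ln x + 1 - 2 * A * x) (at x)"
  unfolding ent_def[abs_def] by (auto intro!: derivative_eq_intros)

lemma DERIV_ent_pair:
  assumes "0 < x" "x < s"
  shows "((\<lambda>x. ent A x + ent A (s - x)) has_real_derivative ln x - ln (s - x) - 2 * A * (2 * x - s)) (at x)"
proof -
  have "((\<lambda>x. ent A (s - x)) has_real_derivative (ln (s - x) + 1 - 2 * A * (s - x)) * (0 - 1)) (at x)"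
    using assms by (intro DERIV_chain'[where g = "ent A"] DERIV_ent derivative_intros) auto
  from DERIV_add[OF DERIV_ent[OF assms(1)] this] show ?thesis
    by (rule DERIV_cong) (simp add: algebra_simps)
qed

text \<open>Necessary conditions for two coordinates whose sum is held fixed. A zero coordinate is
  excluded by the infinite negative slope of x ln x at 0, and the first-order condition holds in the
  interior. Two coordinates above \<open>1 / (2 * A)\<close> would have to be equal, but there the
  second derivative is negative and moving them apart lowers the sum.\<close>

lemma ent_pair_min:
  assumes A: "A > 0" and x: "0 \<le> x" "0 \<le> y" "0 < x + y"
    and min: "\<And>z. 0 \<le> z \<Longrightarrow> z \<le> x + y \<Longrightarrow> ent A x + ent A y \<le> ent A z + ent A (x + y - z)"
  shows "0 < x" and "0 < y" and "ln x - 2 * A * x = ln y - 2 * A * y"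
    and "1 / (2 * A) < x \<Longrightarrow> 1 / (2 * A) < y \<Longrightarrow> False"
proof -
  have pos: "0 < x" if x: "0 \<le> x" "0 \<le> y" "0 < x + y"
    and min: "\<And>z. 0 \<le> z \<Longrightarrow> z \<le> x + y \<Longrightarrow> ent A x + ent A y \<le> ent A z + ent A (x + y - z)"
    for x y
  proof (rule ccontr)
    assume "\<not> 0 < x"
    with x have [simp]: "x = 0" and y: "y > 0" by auto
    \<comment> \<open>The mass \<open>z\<close> to move is small enough that the entropy gain
      \<open>z * (ln z - ln y)\<close> beats the change of the quadratic part, leaving a total of at
      most - z - 2 A z^2.\<close>
    define z where "z = y * exp (- (2 * A * y) - 1)"
    have z: "0 < z" "z < y"
    proof -
      have "exp (- (2 * A * y) - 1) < 1" using mult_pos_pos[OF A y] by simp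
      then show "0 < z" "z < y" using y by (auto simp: z_def)
    qed
    have le: "z * ln z + (y - z) * ln (y - z) \<le> z * ln z + (y - z) * ln y"
      using z by (intro add_left_mono mult_left_mono) auto
    have lz: "ln z = ln y - (2 * A * y) - 1" using y by (simp add: z_def ln_mult)
    have "z * ln z = z * ln y - 2 * A * y * z - z"
      unfolding lz by (simp add: algebra_simps)
    moreover have "(y - z) * ln y = y * ln y - z * ln y" by (simp add: algebra_simps)
    ultimately have "z * ln z + (y - z) * ln (y - z) - y * ln y \<le> - 2 * A * y * z - z"
      using le by linarith
    then have "ent A z + ent A (y - z) - ent A y \<le> - 2 * A * y * z - z + 2 * A * z * (y - z)"
      by (simp add: ent_def power2_eq_square algebra_simps)
    also have "\<dots> = - z - 2 * A * z\<^sup>2" by (simp add: algebra_simps power2_eq_square)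
    also have "\<dots> < 0"
    proof -
      have "0 < 2 * A * z\<^sup>2" using z(1) A by simp
      then show ?thesis using z(1) by linarith
    qed
    finally show False using min[of z] z by (simp add: ent_def)
  qed
  show x0: "0 < x" using pos[OF x min] .
  show y0: "0 < y" using pos[of y x] x min
    by (smt (verit) add.commute)
  define s where "s = x + y"
  define \<phi> where "\<phi> z = ent A z + ent A (s - z)" for z
  have \<phi>': "(\<phi> has_real_derivative ln z - ln (s - z) - 2 * A * (2 * z - s)) (at z)" if "0 < z" "z < s" for z
    unfolding \<phi>_def[abs_def] using DERIV_ent_pair that by blast
  have "ln x - ln (s - x) - 2 * A * (2 * x - s) = 0"
  proof (rule DERIV_local_min)
    show "(\<phi> has_real_derivative ln x - ln (s - x) - 2 * A * (2 * x - s)) (at x)"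
      using x0 y0 by (intro \<phi>') (auto simp: s_def)
    show "0 < min x y" using x0 y0 by simp
    show "\<forall>z. \<bar>x - z\<bar> < min x y \<longrightarrow> \<phi> x \<le> \<phi> z"
      using min by (auto simp: \<phi>_def s_def)
  qed
  then show eq: "ln x - 2 * A * x = ln y - 2 * A * y"
    by (simp add: s_def algebra_simps)
  assume big: "1 / (2 * A) < x" "1 / (2 * A) < y"
  have "x = y"
    using ln_minus_linear_less(2)[OF A x0, of y] ln_minus_linear_less(2)[OF A y0, of x] big eq
    by (cases x y rule: linorder_cases) auto
  then have s2: "x = s / 2" and s0: "s > 0" using x0 by (auto simp: s_def)
  \<comment> \<open>With both coordinates at the midpoint \<open>s / 2\<close>, being above
    \<open>1 / (2 * A)\<close> is the negativity of the second derivative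
    \<open>4 / s - 4 * A\<close>.\<close>
  have sA: "1 / s < A" using big(1) A s0 unfolding s2 by (simp add: field_simps)
  have d2: "((\<lambda>z. ln z - ln (s - z) - 2 * A * (2 * z - s)) has_real_derivative 4 / s - 4 * A) (at (s / 2))"
    using s0 by (auto intro!: derivative_eq_intros simp: field_simps)
  obtain d where d: "d > 0" and dneg: "\<And>h. 0 < h \<Longrightarrow> h < d \<Longrightarrow>
      ln (s / 2 + h) - ln (s - (s / 2 + h)) - 2 * A * (2 * (s / 2 + h) - s) < 0"
  proof -
    have "4 / s - 4 * A < 0" using sA by simp
    from DERIV_neg_dec_right[OF d2 this] show ?thesis using that by auto
  qed
  define h where "h = min d (s / 2) / 2"
  have h: "0 < h" "h < d" "h < s / 2" using d s0 by (auto simp: h_def)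
  have "\<phi> (s / 2 + h) < \<phi> (s / 2)"
  proof (rule DERIV_neg_imp_decreasing_open[where f = \<phi> and a = "s / 2" and b = "s / 2 + h"])
    show "s / 2 < s / 2 + h" using h by simp
    fix z assume z: "s / 2 < z" "z < s / 2 + h"
    have "ln z - ln (s - z) - 2 * A * (2 * z - s) < 0"
      using dneg[of "z - s / 2"] z h by simp
    then show "\<exists>y. (\<phi> has_real_derivative y) (at z) \<and> y < 0"
      using \<phi>'[of z] z h s0 by (intro exI[of _ "ln z - ln (s - z) - 2 * A * (2 * z - s)"] conjI) auto
  next
    show "continuous_on {s / 2..s / 2 + h} \<phi>"
      using h s0 by (intro continuous_at_imp_continuous_on ballI DERIV_isCont[OF \<phi>']) auto
  qed
  moreover have "\<phi> x \<le> \<phi> (s / 2 + h)"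
  proof -
    have "0 \<le> s / 2 + h" "s / 2 + h \<le> x + y" using h x0 y0 s_def by linarith+
    from min[OF this] show ?thesis by (simp add: \<phi>_def s_def)
  qed
  ultimately show False by (simp only: s2)
qed

text \<open>Continuity at the boundary point 0, where x ln x tends to 0, allows the minimum to be
  sought on the closed, hence compact, simplex.\<close>

lemma continuous_on_ent: "continuous_on {0..} (ent A)"
proof -
  have "continuous (at x within {0..}) (ent A)" if "x \<ge> 0" for x
  proof (cases "x = 0")
    case True
    have "filterlim (\<lambda>x. x * ln x - A * x\<^sup>2) (nhds 0) (at_right 0)" by real_asymp
    moreover have "at (0::real) within {0..} = at_right 0"
      by (rule at_within_nhd[of _ "UNIV"]) auto
    ultimately show ?thesis using True by (simp add: continuous_within ent_def[abs_def])
  next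
    case False
    then show ?thesis using DERIV_isCont[OF DERIV_ent] that
      by (simp add: continuous_at_imp_continuous_at_within)
  qed
  then show ?thesis by (simp add: continuous_on_eq_continuous_within)
qed

lemma ent_simplex_attains_min:
  assumes I: "finite I" "I \<noteq> {}"
  obtains m where "\<And>i. i \<in> I \<Longrightarrow> m i \<ge> 0" "sum m I = 1"
    "\<And>\<alpha>. (\<And>i. i \<in> I \<Longrightarrow> \<alpha> i \<ge> 0) \<Longrightarrow> sum \<alpha> I = 1 \<Longrightarrow> (\<Sum>i\<in>I. ent A (m i)) \<le> (\<Sum>i\<in>I. ent A (\<alpha> i))"
proof -
  \<comment> \<open>Coordinates outside \<open>I\<close> are pinned to 0, so that the product over
    the whole index type is compact and the simplex is a closed slice of it.\<close>
  define B where "B = (\<lambda>i. if i \<in> I then {0..1} else {0::real})"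
  define S where "S = PiE UNIV B \<inter> {f. sum f I = 1}"
  have "compact (PiE UNIV B)"
    using compactin_PiE[of "\<lambda>_. euclidean" UNIV B]
    by (auto simp: B_def euclidean_product_topology)
  moreover have "closed {f :: 'a \<Rightarrow> real. sum f I = 1}"
    by (intro closed_Collect_eq continuous_on_sum continuous_on_product_coordinates continuous_on_const)
  ultimately have "compact S" unfolding S_def by (rule compact_Int_closed)
  have cont: "continuous_on S (\<lambda>f. \<Sum>i\<in>I. ent A (f i))"
  proof (intro continuous_on_sum)
    fix i assume "i \<in> I"
    then have "(\<lambda>f. f i) ` S \<subseteq> {0..}" using PiE_mem[of _ UNIV B i] by (auto simp: S_def B_def)
    then show "continuous_on S (\<lambda>f. ent A (f i))"
      by (intro continuous_on_compose2[OF continuous_on_ent]) (auto intro: continuous_on_subset[OF continuous_on_product_coordinates])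
  qed
  obtain i0 where "i0 \<in> I" using I by auto
  then have "(\<lambda>i. if i = i0 then 1 else 0) \<in> S"
    using I by (auto simp: S_def B_def PiE_iff split: if_splits)
  then have "S \<noteq> {}" by auto
  from continuous_attains_inf[OF \<open>compact S\<close> this cont]
  obtain m where m: "m \<in> S" "\<And>f. f \<in> S \<Longrightarrow> (\<Sum>i\<in>I. ent A (m i)) \<le> (\<Sum>i\<in>I. ent A (f i))" by blast
  show thesis
  proof (rule that[of m])
    show "m i \<ge> 0" if "i \<in> I" for i
      using m(1) that PiE_mem[of m UNIV B i] by (auto simp: S_def B_def)
    show "sum m I = 1" using m(1) by (simp add: S_def)
    fix \<alpha> :: "'a \<Rightarrow> real" assume \<alpha>: "\<And>i. i \<in> I \<Longrightarrow> \<alpha> i \<ge> 0" "sum \<alpha> I = 1"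
    have "\<alpha> i \<le> 1" if "i \<in> I" for i
      using member_le_sum[of i I \<alpha>] \<alpha> that I by auto
    then have "(\<lambda>i. if i \<in> I then \<alpha> i else 0) \<in> S"
      using \<alpha> by (auto simp: S_def B_def)
    from m(2)[OF this] show "(\<Sum>i\<in>I. ent A (m i)) \<le> (\<Sum>i\<in>I. ent A (\<alpha> i))" by simp
  qed
qed

text \<open>At a minimiser any two coordinates \<open>x\<close>, \<open>y\<close> satisfy \<open>ln x - 2 A x = ln y - 2 A y\<close> and at most one
  coordinate exceeds \<open>1/(2A)\<close>; since the function is strictly increasing below that point, all other
  coordinates are equal, and one is left with \<open>two_level_gap\<close>.\<close>

lemma kl_quadratic:
  assumes I: "finite I" "card I \<ge> 2" and \<alpha>: "\<And>i. i \<in> I \<Longrightarrow> \<alpha> i \<ge> 0" "sum \<alpha> I = 1"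
  shows "(\<Sum>i\<in>I. \<alpha> i * ln (\<alpha> i)) + ln (card I) \<ge> kl_const (card I) * (\<Sum>i\<in>I. (\<alpha> i - 1 / card I)\<^sup>2)"
proof -
  define L where "L = card I"
  define A where "A = kl_const L"
  have L2: "L \<ge> 2" using I by (simp add: L_def)
  have A: "A > 0" using kl_const_pos[OF L2] by (simp add: A_def)
  have ne: "I \<noteq> {}" using I by auto
  obtain m where m: "\<And>i. i \<in> I \<Longrightarrow> m i \<ge> 0" "sum m I = 1"
    "\<And>\<alpha>. (\<And>i. i \<in> I \<Longrightarrow> \<alpha> i \<ge> 0) \<Longrightarrow> sum \<alpha> I = 1 \<Longrightarrow> (\<Sum>i\<in>I. ent A (m i)) \<le> (\<Sum>i\<in>I. ent A (\<alpha> i))"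
    using ent_simplex_attains_min[OF I(1) ne, of A] by blast
  have pairmin: "ent A (m i) + ent A (m j) \<le> ent A z + ent A (m i + m j - z)"
    if ij: "i \<in> I" "j \<in> I" "i \<noteq> j" and z: "0 \<le> z" "z \<le> m i + m j" for i j z
  proof -
    \<comment> \<open>Mass is exchanged between \<open>i\<close> and \<open>j\<close> alone, so
      minimality on the simplex becomes minimality of the pair with fixed sum.\<close>
    define \<alpha>' where "\<alpha>' = m(i := z, j := m i + m j - z)"
    have split: "(\<Sum>k\<in>I. f k) = f i + f j + (\<Sum>k\<in>I - {i, j}. f k)" for f :: "'a \<Rightarrow> real"
      using ij I(1) sum.remove[of I i f] sum.remove[of "I - {i}" j f]
      by (simp add: Diff_insert[symmetric] insert_commute)
    have "(\<Sum>k\<in>I - {i, j}. \<alpha>' k) = (\<Sum>k\<in>I - {i, j}. m k)" "(\<Sum>k\<in>I - {i, j}. ent A (\<alpha>' k)) = (\<Sum>k\<in>I - {i, j}. ent A (m k))"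
      by (auto intro!: sum.cong simp: \<alpha>'_def)
    note eqs = this
    have "sum \<alpha>' I = 1"
      using m(2) ij unfolding split[of \<alpha>'] split[of m] eqs by (simp add: \<alpha>'_def)
    moreover have "\<alpha>' k \<ge> 0" if "k \<in> I" for k using m(1)[OF that] z by (auto simp: \<alpha>'_def)
    ultimately have "(\<Sum>i\<in>I. ent A (m i)) \<le> (\<Sum>i\<in>I. ent A (\<alpha>' i))" by (intro m(3)) auto
    then show ?thesis unfolding split[of "\<lambda>k. ent A (m k)"] split[of "\<lambda>k. ent A (\<alpha>' k)"] eqs
      using ij by (simp add: \<alpha>'_def)
  qed
  have mpos: "m i > 0" if i: "i \<in> I" for i
  proof (rule ccontr)
    assume "\<not> m i > 0"
    then have mi: "m i = 0" using m(1)[OF i] by simp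
    have "\<exists>j\<in>I. m j > 0"
    proof (rule ccontr)
      assume "\<not> (\<exists>j\<in>I. m j > 0)"
      then have "sum m I \<le> 0" by (intro sum_nonpos) (auto simp: not_less)
      then show False using m(2) by simp
    qed
    then obtain j where j: "j \<in> I" "m j > 0" by auto
    then have "i \<noteq> j" using mi by auto
    from ent_pair_min(1)[OF A _ _ _ pairmin[OF i j(1) this]] mi j m(1) show False by force
  qed
  have pair: "ln (m i) - 2 * A * m i = ln (m j) - 2 * A * m j" "\<not> (1 / (2 * A) < m i \<and> 1 / (2 * A) < m j)"
    if ij: "i \<in> I" "j \<in> I" "i \<noteq> j" for i j
    using ent_pair_min(3,4)[OF A _ _ _ pairmin[OF ij]] mpos[of i] mpos[of j] ij by auto
  have small_eq: "m i = m j" if ij: "i \<in> I" "j \<in> I" and le: "m i \<le> 1 / (2 * A)" "m j \<le> 1 / (2 * A)" for i j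
  proof (cases "i = j")
    case False
    then show ?thesis
      using ln_minus_linear_less(1)[OF A mpos[OF ij(1)], of "m j"] ln_minus_linear_less(1)[OF A mpos[OF ij(2)], of "m i"]
        pair(1)[OF ij False] le by (cases "m i" "m j" rule: linorder_cases) auto
  qed auto
  \<comment> \<open>Take \<open>i0\<close> to be the one coordinate above \<open>1 / (2 * A)\<close>
    if there is one, and any coordinate otherwise.\<close>
  have "\<exists>i0\<in>I. \<forall>i\<in>I - {i0}. m i \<le> 1 / (2 * A)"
  proof (cases "\<exists>i0\<in>I. 1 / (2 * A) < m i0")
    case True
    then obtain i0 where i0: "i0 \<in> I" "1 / (2 * A) < m i0" by blast
    have "m i \<le> 1 / (2 * A)" if "i \<in> I - {i0}" for i
      using pair(2)[OF i0(1), of i] i0(2) that by auto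
    then show ?thesis using i0(1) by blast
  next
    case False
    obtain i0 where "i0 \<in> I" using ne by blast
    moreover have "m i \<le> 1 / (2 * A)" if "i \<in> I" for i using False that by (auto simp: not_less)
    ultimately show ?thesis by blast
  qed
  then obtain i0 where i0: "i0 \<in> I" "\<And>i. i \<in> I - {i0} \<Longrightarrow> m i \<le> 1 / (2 * A)" by blast
  have c: "card (I - {i0}) = L - 1" using i0 I by (simp add: L_def)
  then have "I - {i0} \<noteq> {}" using L2 by force
  then obtain i1 where i1: "i1 \<in> I - {i0}" by blast
  define b a where "b = m i0" and "a = m i1"
  have ma: "m i = a" if "i \<in> I - {i0}" for i
    using small_eq[of i i1] i0(2)[OF that] i0(2)[OF i1] that i1 by (auto simp: a_def)
  have sumf: "(\<Sum>i\<in>I. f (m i)) = f b + (real L - 1) * f a" for f :: "real \<Rightarrow> real"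
  proof -
    have "(\<Sum>i\<in>I. f (m i)) = f b + (\<Sum>i\<in>I - {i0}. f (m i))"
      using i0 I by (simp add: sum.remove b_def)
    also have "(\<Sum>i\<in>I - {i0}. f (m i)) = (\<Sum>i\<in>I - {i0}. f a)" using ma by (intro sum.cong) auto
    finally show ?thesis using c L2 by (simp add: of_nat_diff)
  qed
  have L1: "real L > 1" using L2 by simp
  have ba: "b + (real L - 1) * a = 1" using sumf[of "\<lambda>x. x"] m(2) by simp
  have a0: "a > 0" "b > 0" using mpos i1 i0 by (auto simp: a_def b_def)
  have a: "a = (1 - b) / (real L - 1)" using ba L1 by (simp add: field_simps)
  have b1: "b < 1" using ba a0 L1 by (smt (verit) mult_pos_pos)
  have lna: "ln a = ln (1 - b) - ln (real L - 1)" unfolding a using b1 L1 by (simp add: ln_div)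
  have "(\<Sum>i\<in>I. ent A (m i)) + ln L + A / L = two_level_gap L b"
  proof -
    define K l x c1 where "K = ln (1 - b)" and "l = ln (real L - 1)" and "x = real L" and "c1 = b * ln b + ln x"
    have x: "x > 1" using L1 by (simp add: x_def)
    have "(\<Sum>i\<in>I. ent A (m i)) = ent A b + (real L - 1) * ent A a" by (rule sumf)
    also have "\<dots> = b * ln b + (1 - b) * (K - l) - A * b\<^sup>2 - A * (1 - b)\<^sup>2 / (x - 1)"
    proof -
      have "(x - 1) * ent A a = ((x - 1) * a) * (K - l) - A * ((x - 1) * a) * a"
        by (simp add: ent_def lna K_def l_def power2_eq_square algebra_simps)
      also have "(x - 1) * a = 1 - b" using ba by (simp add: x_def)
      finally show ?thesis by (simp add: x_def a ent_def power2_eq_square)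
    qed
    finally have "(\<Sum>i\<in>I. ent A (m i)) + ln L + A / L =
      c1 + (1 - b) * (K - l) + A * (1 / x - b\<^sup>2 - (1 - b)\<^sup>2 / (x - 1))"
      by (simp add: c1_def x_def algebra_simps)
    also have "1 / x - b\<^sup>2 - (1 - b)\<^sup>2 / (x - 1) = - (x / (x - 1) * (b - 1 / x)\<^sup>2)"
    proof -
      have "x * (x - 1) * (1 / x - b\<^sup>2 - (1 - b)\<^sup>2 / (x - 1)) = x * (x - 1) * (- (x / (x - 1) * (b - 1 / x)\<^sup>2))"
        using x by (simp add: field_simps power2_eq_square)
      moreover have "x * (x - 1) \<noteq> 0" using x by simp
      ultimately show ?thesis by (metis mult_left_cancel)
    qed
    finally show ?thesis by (simp add: two_level_gap_def c1_def x_def K_def l_def A_def algebra_simps)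
  qed
  also have "\<dots> \<ge> 0" using two_level_gap_nonneg[OF L2 a0(2) b1] .
  finally have "0 \<le> (\<Sum>i\<in>I. ent A (m i)) + ln L + A / L" .
  also have "\<dots> \<le> (\<Sum>i\<in>I. ent A (\<alpha> i)) + ln L + A / L" using m(3)[OF \<alpha>] by simp
  also have "(\<Sum>i\<in>I. ent A (\<alpha> i)) = (\<Sum>i\<in>I. \<alpha> i * ln (\<alpha> i)) - A * (\<Sum>i\<in>I. (\<alpha> i)\<^sup>2)"
    by (simp add: ent_def sum_subtractf sum_distrib_left)
  also have "(\<Sum>i\<in>I. (\<alpha> i)\<^sup>2) = (\<Sum>i\<in>I. (\<alpha> i - 1 / L)\<^sup>2) + 1 / L"
  proof -
    have "(\<Sum>i\<in>I. (\<alpha> i - 1 / L)\<^sup>2) = (\<Sum>i\<in>I. (\<alpha> i)\<^sup>2) - 2 / L * sum \<alpha> I + L * (1 / L)\<^sup>2"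
      by (simp add: power2_diff sum.distrib sum_subtractf sum_distrib_left L_def)
    then show ?thesis using \<alpha>(2) L1 by (simp add: power2_eq_square field_simps)
  qed
  finally show ?thesis by (simp add: A_def L_def algebra_simps)
qed

section \<open>Exponential moments of multinomial counts\<close>

text \<open>Dual form of \<open>kl_quadratic\<close>, read off at the vector \<open>exp (t i)\<close> normalised to sum 1.\<close>

lemma mean_exp_le:
  assumes I: "finite I" "card I \<ge> 2"
  shows "(\<Sum>i\<in>I. exp (t i)) / card I \<le> exp ((\<Sum>i\<in>I. t i) / card I + (\<Sum>i\<in>I. (t i)\<^sup>2) / (4 * kl_const (card I)))"
proof -
  define L where "L = real (card I)"
  define A where "A = kl_const (card I)"
  have A: "A > 0" using kl_const_pos[OF I(2)] by (simp add: A_def)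
  have L0: "L > 0" using I by (simp add: L_def)
  have "I \<noteq> {}" using I by auto
  define Z where "Z = (\<Sum>i\<in>I. exp (t i))"
  have Z: "Z > 0" unfolding Z_def using I \<open>I \<noteq> {}\<close> by (intro sum_pos) auto
  define \<alpha> where "\<alpha> i = exp (t i) / Z" for i
  have sum1: "sum \<alpha> I = 1" using Z by (simp add: \<alpha>_def sum_divide_distrib[symmetric] flip: Z_def)
  have ln\<alpha>: "ln (\<alpha> i) = t i - ln Z" for i using Z by (simp add: \<alpha>_def ln_div)
  have "A * (\<Sum>i\<in>I. (\<alpha> i - 1 / L)\<^sup>2) \<le> (\<Sum>i\<in>I. \<alpha> i * ln (\<alpha> i)) + ln L"
    unfolding A_def L_def using kl_quadratic[OF I, of \<alpha>] sum1 Z by (simp add: \<alpha>_def)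
  also have "(\<Sum>i\<in>I. \<alpha> i * ln (\<alpha> i)) = (\<Sum>i\<in>I. \<alpha> i * t i) - ln Z"
    unfolding ln\<alpha> using sum1 by (simp add: right_diff_distrib sum_subtractf sum_distrib_right[symmetric])
  finally have "ln Z - ln L \<le> (\<Sum>i\<in>I. \<alpha> i * t i) - A * (\<Sum>i\<in>I. (\<alpha> i - 1 / L)\<^sup>2)" by simp
  also have "\<dots> = (\<Sum>i\<in>I. t i) / L + (\<Sum>i\<in>I. (\<alpha> i - 1 / L) * t i - A * (\<alpha> i - 1 / L)\<^sup>2)"
    by (simp add: sum_subtractf sum_distrib_left sum_divide_distrib left_diff_distrib)
  also have "\<dots> \<le> (\<Sum>i\<in>I. t i) / L + (\<Sum>i\<in>I. (t i)\<^sup>2 / (4 * A))"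
  proof (intro add_left_mono sum_mono)
    fix i
    \<comment> \<open>Completing the square: t^2 / (4 A) is the Legendre transform of A a^2.\<close>
    define a where "a = \<alpha> i - 1 / L"
    have "0 \<le> (t i - 2 * A * a)\<^sup>2" by simp
    then have "4 * A * (a * t i - A * a\<^sup>2) \<le> (t i)\<^sup>2" by (simp add: power2_eq_square algebra_simps)
    then have "a * t i - A * a\<^sup>2 \<le> (t i)\<^sup>2 / (4 * A)" using A by (simp add: pos_le_divide_eq mult.commute)
    then show "(\<alpha> i - 1 / L) * t i - A * (\<alpha> i - 1 / L)\<^sup>2 \<le> (t i)\<^sup>2 / (4 * A)" by (simp add: a_def)
  qed
  finally have "ln (Z / L) \<le> (\<Sum>i\<in>I. t i) / L + (\<Sum>i\<in>I. (t i)\<^sup>2) / (4 * A)"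
    using Z L0 by (simp add: ln_div sum_divide_distrib)
  then have "Z / L \<le> exp ((\<Sum>i\<in>I. t i) / L + (\<Sum>i\<in>I. (t i)\<^sup>2) / (4 * A))"
    using Z L0 by (metis divide_pos_pos exp_le_cancel_iff exp_ln)
  then show ?thesis by (simp add: Z_def L_def A_def)
qed

section \<open>Gaussian integrals and the averaged exponential\<close>

abbreviation gauss :: "real \<Rightarrow> real measure" where
  "gauss \<sigma> \<equiv> density lborel (\<lambda>x. ennreal (normal_density 0 \<sigma> x))"

lemma nn_integral_normal_density:
  assumes "\<sigma> > 0"
  shows "(\<integral>\<^sup>+x. ennreal (normal_density \<mu> \<sigma> x) \<partial>lborel) = 1"
proof -
  interpret prob_space "density lborel (normal_density \<mu> \<sigma>)" by (rule prob_space_normal_density[OF assms])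
  show ?thesis using emeasure_space_1 by (simp add: emeasure_density)
qed

text \<open>An exponential tilt moves the mean of the Gaussian to \<sigma>^2 a. Read from right to
  left, this is the identity that linearises a square.\<close>

lemma gauss_exp_linear:
  assumes "\<sigma> > 0"
  shows "(\<integral>\<^sup>+x. ennreal (exp (a * x)) \<partial>gauss \<sigma>) = ennreal (exp (\<sigma>\<^sup>2 * a\<^sup>2 / 2))"
proof -
  have dens: "normal_density 0 \<sigma> x * exp (a * x) = exp (\<sigma>\<^sup>2 * a\<^sup>2 / 2) * normal_density (\<sigma>\<^sup>2 * a) \<sigma> x" for x
  proof -
    have "- (x\<^sup>2 / (2 * \<sigma>\<^sup>2)) + a * x = \<sigma>\<^sup>2 * a\<^sup>2 / 2 - (x - \<sigma>\<^sup>2 * a)\<^sup>2 / (2 * \<sigma>\<^sup>2)"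
      using assms by (simp add: field_simps power2_eq_square)
    then show ?thesis by (simp add: normal_density_def exp_add[symmetric] mult_ac exp_diff[symmetric])
  qed
  have "(\<integral>\<^sup>+x. ennreal (exp (a * x)) \<partial>gauss \<sigma>) = (\<integral>\<^sup>+x. ennreal (normal_density 0 \<sigma> x * exp (a * x)) \<partial>lborel)"
    by (subst nn_integral_density) (auto simp: ennreal_mult)
  also have "\<dots> = (\<integral>\<^sup>+x. ennreal (exp (\<sigma>\<^sup>2 * a\<^sup>2 / 2)) * ennreal (normal_density (\<sigma>\<^sup>2 * a) \<sigma> x) \<partial>lborel)"
    unfolding dens by (simp add: ennreal_mult)
  also have "\<dots> = ennreal (exp (\<sigma>\<^sup>2 * a\<^sup>2 / 2))"
    using nn_integral_normal_density[OF assms] by (subst nn_integral_cmult) auto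
  finally show ?thesis .
qed

text \<open>The weight turns the standard Gaussian into a centred one of variance 1 / (1 - k), up to
  normalisation. The condition \<open>k < 1\<close> is where being below the threshold enters the
  exponential moment.\<close>

lemma gauss_exp_square:
  assumes "k < 1"
  shows "(\<integral>\<^sup>+x. ennreal (exp (k * x\<^sup>2 / 2)) \<partial>gauss 1) = ennreal (1 / sqrt (1 - k))"
proof -
  define \<sigma> where "\<sigma> = 1 / sqrt (1 - k)"
  have \<sigma>: "\<sigma> > 0" and \<sigma>2: "1 / \<sigma>\<^sup>2 = 1 - k" using assms by (auto simp: \<sigma>_def power_divide)
  have dens: "normal_density 0 1 x * exp (k * x\<^sup>2 / 2) = \<sigma> * normal_density 0 \<sigma> x" for x
  proof -
    have "sqrt (2 * pi * \<sigma>\<^sup>2) = sqrt (2 * pi) * \<sigma>" using \<sigma> by (simp add: real_sqrt_mult)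
    moreover have "x\<^sup>2 / (2 * \<sigma>\<^sup>2) = (1 - k) * x\<^sup>2 / 2" using \<sigma>2 by (metis mult.commute times_divide_eq_left divide_divide_eq_left mult.left_neutral)
    moreover have "- x\<^sup>2 / 2 + k * x\<^sup>2 / 2 = - ((1 - k) * x\<^sup>2 / 2)" by (simp add: field_simps)
    ultimately show ?thesis using \<sigma> by (simp add: normal_density_def exp_add[symmetric])
  qed
  have "(\<integral>\<^sup>+x. ennreal (exp (k * x\<^sup>2 / 2)) \<partial>gauss 1) = (\<integral>\<^sup>+x. ennreal (normal_density 0 1 x * exp (k * x\<^sup>2 / 2)) \<partial>lborel)"
    by (subst nn_integral_density) (auto simp: ennreal_mult)
  also have "\<dots> = (\<integral>\<^sup>+x. ennreal \<sigma> * ennreal (normal_density 0 \<sigma> x) \<partial>lborel)"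
    unfolding dens using \<sigma> by (simp add: ennreal_mult)
  also have "\<dots> = ennreal \<sigma>"
    using nn_integral_normal_density[OF \<sigma>] by (subst nn_integral_cmult) auto
  finally show ?thesis by (simp add: \<sigma>_def)
qed

text \<open>The square is linearised by an auxiliary Gaussian vector, after which the coordinates of
  the random word are independent; this gives a bound uniform in the length of the word.\<close>

lemma multinomial_exp_moment:
  fixes S :: "'s set" and n :: nat
  assumes S: "finite S" "card S \<ge> 2" and n: "n > 0"
    and c: "c \<ge> 0" "c < 2 * kl_const (card S)"
  defines "W \<equiv> ({..<n} \<rightarrow>\<^sub>E S)"
  shows "(\<Sum>h\<in>W. exp (c / (2 * n) * (\<Sum>x\<in>S. (real (card {u. u < n \<and> h u = x}) - n / card S)\<^sup>2))) \<le>
    card S ^ n * (1 / sqrt (1 - c / (2 * kl_const (card S)))) ^ card S"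
proof -
  define L where "L = card S"
  define A where "A = kl_const L"
  \<comment> \<open>Scaled so that half the square of r (N - n/L) is the exponent contributed by one
    letter.\<close>
  define r where "r = sqrt (c / n)"
  define k where "k = c / (2 * A)"
  have L0: "L > 0" using S by (simp add: L_def)
  have A: "A > 0" using kl_const_pos S by (simp add: A_def L_def)
  have k: "k < 1" using c A by (simp add: k_def A_def L_def)
  have r2: "r\<^sup>2 = c / n" using c n by (simp add: r_def)
  define N where "N h x = real (card {u. u < n \<and> h u = x})" for h and x :: 's
  have finW: "finite W" using S by (auto simp: W_def intro: finite_PiE)
  interpret G: prob_space "gauss 1" by (rule prob_space_normal_density) simp
  interpret P: product_sigma_finite "\<lambda>_ :: 's. gauss 1" ..
  let ?P = "PiM S (\<lambda>_. gauss 1)"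
  have lin: "ennreal (exp (c / (2 * n) * (\<Sum>x\<in>S. (N h x - n / L)\<^sup>2))) =
      (\<integral>\<^sup>+z. ennreal (exp (r * (\<Sum>u<n. z (h u) - (\<Sum>x\<in>S. z x) / L))) \<partial>?P)" if h: "h \<in> W" for h
  proof -
    have "exp (c / (2 * n) * (\<Sum>x\<in>S. (N h x - n / L)\<^sup>2)) = (\<Prod>x\<in>S. exp ((r * (N h x - n / L))\<^sup>2 / 2))"
      unfolding exp_sum[OF S(1), symmetric] by (simp add: power_mult_distrib r2 sum_distrib_left mult.commute)
    then have "ennreal (exp (c / (2 * n) * (\<Sum>x\<in>S. (N h x - n / L)\<^sup>2))) =
        (\<Prod>x\<in>S. ennreal (exp ((r * (N h x - n / L))\<^sup>2 / 2)))" by (simp add: prod_ennreal)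
    also have "\<dots> = (\<Prod>x\<in>S. \<integral>\<^sup>+y. ennreal (exp (r * (N h x - n / L) * y)) \<partial>gauss 1)"
      using gauss_exp_linear[of 1] by simp
    also have "\<dots> = (\<integral>\<^sup>+z. (\<Prod>x\<in>S. ennreal (exp (r * (N h x - n / L) * z x))) \<partial>?P)"
      using S by (intro P.product_nn_integral_prod[symmetric]) auto
    also have "\<dots> = (\<integral>\<^sup>+z. ennreal (exp (r * (\<Sum>u<n. z (h u) - (\<Sum>x\<in>S. z x) / L))) \<partial>?P)"
    proof (intro nn_integral_cong)
      fix z :: "'s \<Rightarrow> real"
      have "(\<Sum>u<n. z (h u)) = (\<Sum>x\<in>S. \<Sum>u\<in>{u \<in> {..<n}. h u = x}. z (h u))"
        using h S by (intro sum.group[symmetric]) (auto simp: W_def)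
      also have "\<dots> = (\<Sum>x\<in>S. N h x * z x)" by (intro sum.cong refl) (simp add: N_def)
      finally have "(\<Sum>u<n. z (h u) - (\<Sum>x\<in>S. z x) / L) = (\<Sum>x\<in>S. (N h x - n / L) * z x)"
        by (simp add: sum_subtractf left_diff_distrib sum_distrib_left sum_divide_distrib)
      then show "(\<Prod>x\<in>S. ennreal (exp (r * (N h x - n / L) * z x))) = ennreal (exp (r * (\<Sum>u<n. z (h u) - (\<Sum>x\<in>S. z x) / L)))"
        using S(1) by (simp add: prod_ennreal exp_sum[symmetric] sum_distrib_left mult_ac)
    qed
    finally show ?thesis .
  qed
  \<comment> \<open>For frozen \<open>z\<close> the sum over words factorises over positions into an
    n-th power. The centring by \<open>m\<close> cancels the linear term of
    \<open>mean_exp_le\<close>, and n r^2 / (4 A) = k / 2, so \<open>n\<close> survives only in the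
    number of words.\<close>
  have bound: "(\<Sum>h\<in>W. exp (r * (\<Sum>u<n. z (h u) - (\<Sum>x\<in>S. z x) / L))) \<le> L ^ n * exp (\<Sum>x\<in>S. k * (z x)\<^sup>2 / 2)"
    for z :: "'s \<Rightarrow> real"
  proof -
    define m where "m = (\<Sum>x\<in>S. z x) / L"
    have "(\<Sum>h\<in>W. exp (r * (\<Sum>u<n. z (h u) - m))) = (\<Sum>h\<in>W. \<Prod>u<n. exp (r * (z (h u) - m)))"
      by (simp add: sum_distrib_left exp_sum)
    also have "\<dots> = (\<Sum>x\<in>S. exp (r * (z x - m))) ^ n"
      unfolding W_def using S by (subst prod_sum_PiE[symmetric]) auto
    also have "\<dots> \<le> (L * exp (r\<^sup>2 * (\<Sum>x\<in>S. (z x)\<^sup>2) / (4 * A))) ^ n"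
    proof (intro power_mono sum_nonneg)
      have "(\<Sum>x\<in>S. exp (r * z x)) / L \<le> exp ((\<Sum>x\<in>S. r * z x) / L + (\<Sum>x\<in>S. (r * z x)\<^sup>2) / (4 * A))"
        unfolding A_def L_def by (rule mean_exp_le[OF S])
      also have "\<dots> = exp (r * m) * exp (r\<^sup>2 * (\<Sum>x\<in>S. (z x)\<^sup>2) / (4 * A))"
        by (simp add: m_def sum_distrib_left power_mult_distrib exp_add)
      finally have *: "(\<Sum>x\<in>S. exp (r * z x)) \<le> L * (exp (r * m) * exp (r\<^sup>2 * (\<Sum>x\<in>S. (z x)\<^sup>2) / (4 * A)))"
        using L0 by (simp add: pos_divide_le_eq mult.commute)
      have "(\<Sum>x\<in>S. exp (r * (z x - m))) = exp (- (r * m)) * (\<Sum>x\<in>S. exp (r * z x))"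
        by (simp add: sum_distrib_left exp_add[symmetric] right_diff_distrib)
      also have "\<dots> \<le> exp (- (r * m)) * (L * (exp (r * m) * exp (r\<^sup>2 * (\<Sum>x\<in>S. (z x)\<^sup>2) / (4 * A))))"
        using * by (intro mult_left_mono) auto
      also have "\<dots> = L * exp (r\<^sup>2 * (\<Sum>x\<in>S. (z x)\<^sup>2) / (4 * A))"
        by (simp add: exp_minus)
      finally show "(\<Sum>x\<in>S. exp (r * (z x - m))) \<le> L * exp (r\<^sup>2 * (\<Sum>x\<in>S. (z x)\<^sup>2) / (4 * A))" .
    qed auto
    also have "\<dots> = L ^ n * exp (\<Sum>x\<in>S. k * (z x)\<^sup>2 / 2)"
    proof -
      have "n * (r\<^sup>2 * (\<Sum>x\<in>S. (z x)\<^sup>2) / (4 * A)) = (\<Sum>x\<in>S. k * (z x)\<^sup>2 / 2)"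
        using n unfolding r2 by (simp add: k_def sum_distrib_left sum_divide_distrib)
      then show ?thesis by (simp add: power_mult_distrib exp_of_nat_mult[symmetric])
    qed
    finally show ?thesis by (simp add: m_def)
  qed
  have "ennreal (\<Sum>h\<in>W. exp (c / (2 * n) * (\<Sum>x\<in>S. (N h x - n / L)\<^sup>2))) =
      (\<Sum>h\<in>W. \<integral>\<^sup>+z. ennreal (exp (r * (\<Sum>u<n. z (h u) - (\<Sum>x\<in>S. z x) / L))) \<partial>?P)"
    unfolding sum_ennreal[symmetric, OF exp_ge_zero] by (intro sum.cong refl lin)
  also have "\<dots> = (\<integral>\<^sup>+z. (\<Sum>h\<in>W. ennreal (exp (r * (\<Sum>u<n. z (h u) - (\<Sum>x\<in>S. z x) / L)))) \<partial>?P)"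
  proof (intro nn_integral_sum[symmetric])
    fix h assume "h \<in> W"
    then have "h u \<in> S" if "u < n" for u using that by (auto simp: W_def)
    then show "(\<lambda>z. ennreal (exp (r * (\<Sum>u<n. z (h u) - (\<Sum>x\<in>S. z x) / L)))) \<in> borel_measurable ?P"
      by measurable
  qed
  also have "\<dots> \<le> (\<integral>\<^sup>+z. ennreal (L ^ n) * (\<Prod>x\<in>S. ennreal (exp (k * (z x)\<^sup>2 / 2))) \<partial>?P)"
  proof (intro nn_integral_mono)
    fix z :: "'s \<Rightarrow> real"
    have "(\<Sum>h\<in>W. ennreal (exp (r * (\<Sum>u<n. z (h u) - (\<Sum>x\<in>S. z x) / L)))) =
        ennreal (\<Sum>h\<in>W. exp (r * (\<Sum>u<n. z (h u) - (\<Sum>x\<in>S. z x) / L)))" by simp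
    also have "\<dots> \<le> ennreal (L ^ n * exp (\<Sum>x\<in>S. k * (z x)\<^sup>2 / 2))"
      using bound by (intro ennreal_leI) auto
    also have "\<dots> = ennreal (L ^ n) * (\<Prod>x\<in>S. ennreal (exp (k * (z x)\<^sup>2 / 2)))"
      using S(1) by (simp add: exp_sum prod_ennreal ennreal_mult prod_nonneg)
    finally show "(\<Sum>h\<in>W. ennreal (exp (r * (\<Sum>u<n. z (h u) - (\<Sum>x\<in>S. z x) / L)))) \<le>
        ennreal (L ^ n) * (\<Prod>x\<in>S. ennreal (exp (k * (z x)\<^sup>2 / 2)))" .
  qed
  also have "\<dots> = ennreal (L ^ n) * (\<integral>\<^sup>+z. (\<Prod>x\<in>S. ennreal (exp (k * (z x)\<^sup>2 / 2))) \<partial>?P)"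
    using S(1) by (intro nn_integral_cmult) measurable
  also have "(\<integral>\<^sup>+z. (\<Prod>x\<in>S. ennreal (exp (k * (z x)\<^sup>2 / 2))) \<partial>?P) = (\<Prod>x\<in>S. ennreal (1 / sqrt (1 - k)))"
    using S(1) gauss_exp_square[OF k] by (subst P.product_nn_integral_prod) auto
  also have "\<dots> = ennreal ((1 / sqrt (1 - k)) ^ L)"
    using k by (simp add: L_def ennreal_power)
  also have "ennreal (L ^ n) * \<dots> = ennreal (L ^ n * (1 / sqrt (1 - k)) ^ L)"
    using k by (simp add: ennreal_mult)
  finally have "(\<Sum>h\<in>W. exp (c / (2 * n) * (\<Sum>x\<in>S. (N h x - n / L)\<^sup>2))) \<le> L ^ n * (1 / sqrt (1 - k)) ^ L"
    using k by (subst (asm) ennreal_le_iff) auto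
  then show ?thesis by (simp add: N_def L_def k_def A_def)
qed

section \<open>Schur orthogonality\<close>

lemma mat_adjoint_index [simp]:
  assumes "i < dim_col A" "j < dim_row A"
  shows "mat_adjoint A $$ (i, j) = cnj (A $$ (j, i))"
  using assms by (simp add: mat_adjoint_def mat_of_rows_def conjugate_complex_def)

lemma mat_adjoint_dims [simp]:
  "dim_row (mat_adjoint A) = dim_col A" "dim_col (mat_adjoint A) = dim_row A"
  by (simp_all add: mat_adjoint_def mat_of_rows_def)

lemma mat_adjoint_carrier: "A \<in> carrier_mat m n \<Longrightarrow> mat_adjoint A \<in> carrier_mat n m"
  by auto

lemma mult_mat_unit_vec:
  fixes A :: "complex mat"
  assumes "A \<in> carrier_mat n m" "j < m"
  shows "A *\<^sub>v unit_vec m j = col A j"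
  using assms by (intro eq_vecI) (auto simp: scalar_prod_right_unit)

lemma map_cnj_mult:
  assumes "A \<in> carrier_mat n m" "B \<in> carrier_mat m k"
  shows "map_mat cnj (A * B) = map_mat cnj A * map_mat cnj B"
  using assms by (intro eq_matI) (auto simp: scalar_prod_def)

lemma map_cnj_one: "map_mat cnj (1\<^sub>m n) = 1\<^sub>m n"
  by (intro eq_matI) auto

lemma map_cnj_cnj [simp]: "map_mat cnj (map_mat cnj A) = A"
  by (intro eq_matI) auto

lemma map_cnj_mult_vec:
  assumes "A \<in> carrier_mat n m" "v \<in> carrier_vec m"
  shows "map_vec cnj (A *\<^sub>v v) = map_mat cnj A *\<^sub>v map_vec cnj v"
  using assms by (intro eq_vecI) (auto simp: scalar_prod_def)

text \<open>The function \<open>g\<close> is the orthogonal projection of \<open>f\<close> onto the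
  span of the conjugates of the \<phi> k. All three inner products involving \<open>g\<close> equal
  \<open>S\<close>, so the squared norm of \<open>f - g\<close> is that of \<open>f\<close> minus
  \<open>S\<close>. The coefficients carry no conjugate because they will be sums of matrix entries
  over the letters of a word.\<close>

lemma bessel_inequality:
  fixes f :: "'x \<Rightarrow> complex" and \<phi> :: "'k \<Rightarrow> 'x \<Rightarrow> complex" and w :: "'k \<Rightarrow> real"
  assumes K: "finite K" and w: "\<And>k. k \<in> K \<Longrightarrow> w k > 0"
    and orth: "\<And>k l. k \<in> K \<Longrightarrow> l \<in> K \<Longrightarrow> (\<Sum>x\<in>U. \<phi> k x * cnj (\<phi> l x)) = (if k = l then of_real (w k) else 0)"
  shows "(\<Sum>k\<in>K. (cmod (\<Sum>x\<in>U. f x * \<phi> k x))\<^sup>2 / w k) \<le> (\<Sum>x\<in>U. (cmod (f x))\<^sup>2)"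
proof -
  define c where "c k = (\<Sum>x\<in>U. f x * \<phi> k x)" for k
  define g where "g x = (\<Sum>k\<in>K. c k / w k * cnj (\<phi> k x))" for x
  define S where "S = (\<Sum>k\<in>K. (cmod (c k))\<^sup>2 / w k)"
  have fg: "(\<Sum>x\<in>U. f x * cnj (g x)) = of_real S"
  proof -
    have "(\<Sum>x\<in>U. f x * cnj (g x)) = (\<Sum>x\<in>U. \<Sum>k\<in>K. cnj (c k) / w k * (f x * \<phi> k x))"
      by (simp add: g_def sum_distrib_left mult_ac)
    also have "\<dots> = (\<Sum>k\<in>K. cnj (c k) / w k * c k)"
      by (subst sum.swap) (simp add: c_def sum_distrib_left)
    also have "\<dots> = of_real S"
      unfolding S_def of_real_sum
      by (intro sum.cong refl) (simp add: complex_norm_square mult.commute del: of_real_power)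
    finally show ?thesis .
  qed
  have gf: "(\<Sum>x\<in>U. g x * cnj (f x)) = of_real S"
  proof -
    have "(\<Sum>x\<in>U. g x * cnj (f x)) = cnj (\<Sum>x\<in>U. f x * cnj (g x))" by (simp add: mult.commute)
    then show ?thesis unfolding fg by simp
  qed
  have gg: "(\<Sum>x\<in>U. g x * cnj (g x)) = of_real S"
  proof -
    have "(\<Sum>x\<in>U. g x * cnj (g x)) =
        (\<Sum>x\<in>U. \<Sum>k\<in>K. \<Sum>l\<in>K. c k / w k * (cnj (c l) / w l) * (\<phi> l x * cnj (\<phi> k x)))"
      unfolding g_def cnj_sum sum_product by (intro sum.cong refl) (simp add: mult_ac)
    also have "\<dots> = (\<Sum>k\<in>K. \<Sum>l\<in>K. c k / w k * (cnj (c l) / w l) * (\<Sum>x\<in>U. \<phi> l x * cnj (\<phi> k x)))"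
      by (subst sum.swap, intro sum.cong refl, subst sum.swap) (simp add: sum_distrib_left)
    also have "\<dots> = (\<Sum>k\<in>K. \<Sum>l\<in>K. if l = k then c k / w k * (cnj (c l) / w l) * of_real (w l) else 0)"
      by (intro sum.cong refl) (simp add: orth)
    also have "\<dots> = (\<Sum>k\<in>K. c k / w k * (cnj (c k) / w k) * of_real (w k))"
      using K by (simp add: sum.delta)
    also have "\<dots> = of_real S"
      unfolding S_def of_real_sum
    proof (intro sum.cong refl)
      fix k assume "k \<in> K"
      then show "c k / w k * (cnj (c k) / w k) * of_real (w k) = of_real ((cmod (c k))\<^sup>2 / w k)"
        using w[of k] by (simp add: complex_norm_square mult.commute del: of_real_power)
    qed
    finally show ?thesis .
  qed
  have "of_real (\<Sum>x\<in>U. (cmod (f x - g x))\<^sup>2) = (\<Sum>x\<in>U. (f x - g x) * cnj (f x - g x))"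
    unfolding of_real_sum complex_norm_square ..
  also have "\<dots> = (\<Sum>x\<in>U. f x * cnj (f x)) - (\<Sum>x\<in>U. f x * cnj (g x)) - (\<Sum>x\<in>U. g x * cnj (f x)) + (\<Sum>x\<in>U. g x * cnj (g x))"
    by (simp add: algebra_simps sum.distrib sum_subtractf)
  also have "(\<Sum>x\<in>U. f x * cnj (f x)) = of_real (\<Sum>x\<in>U. (cmod (f x))\<^sup>2)"
    unfolding of_real_sum complex_norm_square ..
  finally have "complex_of_real (\<Sum>x\<in>U. (cmod (f x - g x))\<^sup>2) = of_real ((\<Sum>x\<in>U. (cmod (f x))\<^sup>2) - S)"
    unfolding fg gf gg by simp
  then have "(\<Sum>x\<in>U. (cmod (f x - g x))\<^sup>2) = (\<Sum>x\<in>U. (cmod (f x))\<^sup>2) - S" by (simp only: of_real_eq_iff)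
  moreover have "(\<Sum>x\<in>U. (cmod (f x - g x))\<^sup>2) \<ge> 0" by (intro sum_nonneg) auto
  ultimately show ?thesis by (simp add: S_def c_def)
qed

locale finite_group = group G for G :: "('g, 'b) monoid_scheme" +
  assumes finite_carrier: "finite (carrier G)"
begin

abbreviation deg :: "('g \<Rightarrow> complex mat) \<Rightarrow> nat" where "deg \<equiv> rep_degree G"

lemma irreducible_is_rep: "irreducible_rep G \<rho> \<Longrightarrow> is_rep G (deg \<rho>) \<rho>"
  by (simp add: irreducible_rep_def Let_def)

lemma irreducible_deg_pos: "irreducible_rep G \<rho> \<Longrightarrow> deg \<rho> > 0"
  by (simp add: irreducible_rep_def Let_def)

lemma rep_carrier: "is_rep G D \<rho> \<Longrightarrow> x \<in> carrier G \<Longrightarrow> \<rho> x \<in> carrier_mat D D"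
  by (simp add: is_rep_def)

lemma rep_mult: "is_rep G D \<rho> \<Longrightarrow> x \<in> carrier G \<Longrightarrow> y \<in> carrier G \<Longrightarrow> \<rho> (x \<otimes>\<^bsub>G\<^esub> y) = \<rho> x * \<rho> y"
  by (simp add: is_rep_def)

lemma rep_mult_index:
  assumes "is_rep G D \<rho>" "x \<in> carrier G" "y \<in> carrier G" "i < D" "j < D"
  shows "\<rho> (x \<otimes>\<^bsub>G\<^esub> y) $$ (i, j) = (\<Sum>k<D. \<rho> x $$ (i, k) * \<rho> y $$ (k, j))"
  using assms rep_carrier[OF assms(1)] 
  by (simp add: rep_mult[OF assms(1-3)] times_mat_def scalar_prod_def carrier_matD[OF rep_carrier[OF assms(1,2)]]
      carrier_matD[OF rep_carrier[OF assms(1,3)]] lessThan_atLeast0)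

lemma is_rep_degree: "is_rep G D \<rho> \<Longrightarrow> deg \<rho> = D"
  by (auto simp: is_rep_def rep_degree_def)

lemma unitary_inv:
  assumes rep: "is_rep G D \<rho>" and u: "unitary_rep G \<rho>" and x: "x \<in> carrier G"
  shows "\<rho> (inv\<^bsub>G\<^esub> x) = mat_adjoint (\<rho> x)"
proof -
  note c = rep_carrier[OF rep x] rep_carrier[OF rep inv_closed[OF x]]
  have "\<rho> (inv\<^bsub>G\<^esub> x) = \<rho> (inv\<^bsub>G\<^esub> x) * (\<rho> x * mat_adjoint (\<rho> x))"
    using u x c is_rep_degree[OF rep] by (auto simp: unitary_rep_def)
  also have "\<dots> = \<rho> (inv\<^bsub>G\<^esub> x) * \<rho> x * mat_adjoint (\<rho> x)"
    using assoc_mult_mat[OF c(2) c(1) mat_adjoint_carrier[OF c(1)]] by simp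
  also have "\<rho> (inv\<^bsub>G\<^esub> x) * \<rho> x = 1\<^sub>m D"
    using rep_mult[OF rep inv_closed[OF x] x] rep x by (simp add: is_rep_def)
  finally show ?thesis using left_mult_one_mat[OF mat_adjoint_carrier[OF c(1)]] by simp
qed

lemma unitary_inv_index:
  assumes "is_rep G D \<rho>" "unitary_rep G \<rho>" "x \<in> carrier G" "i < D" "j < D"
  shows "\<rho> (inv\<^bsub>G\<^esub> x) $$ (i, j) = cnj (\<rho> x $$ (j, i))"
  using unitary_inv[OF assms(1-3)] rep_carrier[OF assms(1,3)] assms by simp

section \<open>Schur's lemma\<close>

lemma irreducible_invariant:
  assumes irr: "irreducible_rep G \<rho>"
    and W: "W \<subseteq> carrier_vec (deg \<rho>)" "0\<^sub>v (deg \<rho>) \<in> W"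
    and add: "\<And>v w. v \<in> W \<Longrightarrow> w \<in> W \<Longrightarrow> v + w \<in> W"
    and smult: "\<And>c v. v \<in> W \<Longrightarrow> c \<cdot>\<^sub>v v \<in> W"
    and inv: "\<And>x w. x \<in> carrier G \<Longrightarrow> w \<in> W \<Longrightarrow> \<rho> x *\<^sub>v w \<in> W"
  shows "W = {0\<^sub>v (deg \<rho>)} \<or> W = carrier_vec (deg \<rho>)"
proof -
  interpret vs: vec_space "TYPE(complex)" "deg \<rho>" .
  have "VectorSpace.subspace class_ring W (module_vec TYPE(complex) (deg \<rho>))"
    unfolding VectorSpace.subspace_def
    using W add smult vs.vectorspace_axioms
    by (auto intro!: submodule.intro vs.module_axioms simp: module_vec_simps)
  then show ?thesis using irr inv by (auto simp: irreducible_rep_def Let_def)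
qed

definition intertwines :: "('g \<Rightarrow> complex mat) \<Rightarrow> ('g \<Rightarrow> complex mat) \<Rightarrow> complex mat \<Rightarrow> bool" where
  "intertwines \<rho> \<sigma> A \<longleftrightarrow> A \<in> carrier_mat (deg \<sigma>) (deg \<rho>) \<and> (\<forall>x\<in>carrier G. A * \<rho> x = \<sigma> x * A)"

text \<open>The kernel of an intertwiner is invariant under the source representation, so
  irreducibility leaves only the two extremes.\<close>

lemma intertwiner_kernel:
  assumes irr: "irreducible_rep G \<rho>" and rep: "is_rep G (deg \<sigma>) \<sigma>" and A: "intertwines \<rho> \<sigma> A"
  shows "{v \<in> carrier_vec (deg \<rho>). A *\<^sub>v v = 0\<^sub>v (deg \<sigma>)} = {0\<^sub>v (deg \<rho>)} \<or>
         {v \<in> carrier_vec (deg \<rho>). A *\<^sub>v v = 0\<^sub>v (deg \<sigma>)} = carrier_vec (deg \<rho>)"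
proof (rule irreducible_invariant[OF irr])
  have Ac: "A \<in> carrier_mat (deg \<sigma>) (deg \<rho>)" using A by (simp add: intertwines_def)
  note r = rep_carrier[OF irreducible_is_rep[OF irr]] and s = rep_carrier[OF rep]
  show "0\<^sub>v (deg \<rho>) \<in> {v \<in> carrier_vec (deg \<rho>). A *\<^sub>v v = 0\<^sub>v (deg \<sigma>)}" using Ac by auto
  show "v + w \<in> {v \<in> carrier_vec (deg \<rho>). A *\<^sub>v v = 0\<^sub>v (deg \<sigma>)}"
    if "v \<in> {v \<in> carrier_vec (deg \<rho>). A *\<^sub>v v = 0\<^sub>v (deg \<sigma>)}" "w \<in> {v \<in> carrier_vec (deg \<rho>). A *\<^sub>v v = 0\<^sub>v (deg \<sigma>)}" for v w
    using that by (auto simp: mult_add_distrib_mat_vec[OF Ac])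
  show "c \<cdot>\<^sub>v v \<in> {v \<in> carrier_vec (deg \<rho>). A *\<^sub>v v = 0\<^sub>v (deg \<sigma>)}"
    if "v \<in> {v \<in> carrier_vec (deg \<rho>). A *\<^sub>v v = 0\<^sub>v (deg \<sigma>)}" for c v
    using that by (auto simp: mult_mat_vec[OF Ac])
  show "\<rho> x *\<^sub>v w \<in> {v \<in> carrier_vec (deg \<rho>). A *\<^sub>v v = 0\<^sub>v (deg \<sigma>)}"
    if x: "x \<in> carrier G" and "w \<in> {v \<in> carrier_vec (deg \<rho>). A *\<^sub>v v = 0\<^sub>v (deg \<sigma>)}" for x w
  proof -
    have w: "w \<in> carrier_vec (deg \<rho>)" "A *\<^sub>v w = 0\<^sub>v (deg \<sigma>)" using that by auto
    have "A *\<^sub>v (\<rho> x *\<^sub>v w) = (A * \<rho> x) *\<^sub>v w" using assoc_mult_mat_vec[OF Ac r[OF x] w(1)] by simp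
    also have "\<dots> = \<sigma> x *\<^sub>v (A *\<^sub>v w)"
      using A x assoc_mult_mat_vec[OF s[OF x] Ac w(1)] by (simp add: intertwines_def)
    also have "\<dots> = 0\<^sub>v (deg \<sigma>)" unfolding w using s[OF x] by auto
    finally show ?thesis using r[OF x] w(1) by auto
  qed
qed auto

lemma intertwiner_image:
  assumes irr: "irreducible_rep G \<sigma>" and rep: "is_rep G (deg \<rho>) \<rho>" and A: "intertwines \<rho> \<sigma> A"
  shows "(\<lambda>v. A *\<^sub>v v) ` carrier_vec (deg \<rho>) = {0\<^sub>v (deg \<sigma>)} \<or>
         (\<lambda>v. A *\<^sub>v v) ` carrier_vec (deg \<rho>) = carrier_vec (deg \<sigma>)"
proof (rule irreducible_invariant[OF irr])
  have Ac: "A \<in> carrier_mat (deg \<sigma>) (deg \<rho>)" using A by (simp add: intertwines_def)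
  note s = rep_carrier[OF irreducible_is_rep[OF irr]] and r = rep_carrier[OF rep]
  let ?W = "(\<lambda>v. A *\<^sub>v v) ` carrier_vec (deg \<rho>)"
  show "?W \<subseteq> carrier_vec (deg \<sigma>)" using Ac by auto
  show "0\<^sub>v (deg \<sigma>) \<in> ?W" using Ac by (intro image_eqI[of _ _ "0\<^sub>v (deg \<rho>)"]) auto
  show "v + w \<in> ?W" if "v \<in> ?W" "w \<in> ?W" for v w
  proof -
    from that obtain a b where "v = A *\<^sub>v a" "w = A *\<^sub>v b" "a \<in> carrier_vec (deg \<rho>)" "b \<in> carrier_vec (deg \<rho>)" by auto
    then show ?thesis using mult_add_distrib_mat_vec[OF Ac, of a b] by (intro image_eqI[of _ _ "a + b"]) auto
  qed
  show "c \<cdot>\<^sub>v v \<in> ?W" if "v \<in> ?W" for c v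
  proof -
    from that obtain a where "v = A *\<^sub>v a" "a \<in> carrier_vec (deg \<rho>)" by auto
    then show ?thesis using mult_mat_vec[OF Ac, of a c] by (intro image_eqI[of _ _ "c \<cdot>\<^sub>v a"]) auto
  qed
  show "\<sigma> x *\<^sub>v v \<in> ?W" if x: "x \<in> carrier G" and "v \<in> ?W" for x v
  proof -
    from that obtain a where a: "v = A *\<^sub>v a" "a \<in> carrier_vec (deg \<rho>)" by auto
    have "A *\<^sub>v (\<rho> x *\<^sub>v a) = (A * \<rho> x) *\<^sub>v a" using assoc_mult_mat_vec[OF Ac r[OF x] a(2)] by simp
    also have "\<dots> = \<sigma> x *\<^sub>v v"
      using A x a assoc_mult_mat_vec[OF s[OF x] Ac a(2)] by (simp add: intertwines_def)
    finally show ?thesis using r[OF x] a(2) by (intro image_eqI[of _ _ "\<rho> x *\<^sub>v a"]) auto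
  qed
qed

text \<open>A nonzero intertwiner has trivial kernel and full image. Its inverse is assembled from
  preimages of the unit vectors, and comparing traces shows that the degrees agree.\<close>

lemma schur_iso:
  assumes irr: "irreducible_rep G \<rho>" "irreducible_rep G \<sigma>" and A: "intertwines \<rho> \<sigma> A"
    and nz: "A \<noteq> 0\<^sub>m (deg \<sigma>) (deg \<rho>)"
  shows "rep_iso G \<rho> \<sigma>"
proof -
  define m n where "m = deg \<rho>" and "n = deg \<sigma>"
  have Ac: "A \<in> carrier_mat n m" using A by (simp add: intertwines_def m_def n_def)
  have "\<exists>v\<in>carrier_vec m. A *\<^sub>v v \<noteq> 0\<^sub>v n"
  proof (rule ccontr)
    assume "\<not> ?thesis"
    then have z: "A *\<^sub>v v = 0\<^sub>v n" if "v \<in> carrier_vec m" for v using that by auto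
    have "A = 0\<^sub>m n m"
    proof (rule eq_matI)
      fix i j assume ij: "i < dim_row (0\<^sub>m n m :: complex mat)" "j < dim_col (0\<^sub>m n m :: complex mat)"
      then have "col A j = 0\<^sub>v n" using z[of "unit_vec m j"] mult_mat_unit_vec[OF Ac, of j] by auto
      then have "vec_index (col A j) i = 0" using ij by simp
      then show "A $$ (i, j) = 0\<^sub>m n m $$ (i, j)" using ij Ac by auto
    qed (use Ac in auto)
    then show False using nz by (simp add: m_def n_def)
  qed
  then obtain v where v: "v \<in> carrier_vec m" "A *\<^sub>v v \<noteq> 0\<^sub>v n" by blast
  have ker: "w = 0\<^sub>v m" if "w \<in> carrier_vec m" "A *\<^sub>v w = 0\<^sub>v n" for w
    using intertwiner_kernel[OF irr(1) irreducible_is_rep[OF irr(2)] A] v that unfolding m_def n_def by blast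
  have im: "\<exists>v\<in>carrier_vec m. A *\<^sub>v v = w" if "w \<in> carrier_vec n" for w
  proof -
    have "(\<lambda>v. A *\<^sub>v v) ` carrier_vec m = carrier_vec n"
      using intertwiner_image[OF irr(2) irreducible_is_rep[OF irr(1)] A] v unfolding m_def n_def by blast
    then show ?thesis using that by (metis imageE)
  qed
  have "\<forall>j. \<exists>v. v \<in> carrier_vec m \<and> A *\<^sub>v v = unit_vec n j"
    using im[OF unit_vec_carrier] by blast
  from choice[OF this] obtain f where f: "f j \<in> carrier_vec m \<and> A *\<^sub>v f j = unit_vec n j" for j
    by blast
  define B where "B = mat_of_cols m (map f [0..<n])"
  have Bc: "B \<in> carrier_mat m n" by (auto simp: B_def)
  have colB: "col B j = f j" if "j < n" for j
    using that f[of j] by (simp add: B_def)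
  have AB: "A * B = 1\<^sub>m n"
  proof (rule mat_col_eqI)
    fix j assume "j < dim_col (1\<^sub>m n :: complex mat)"
    then have j: "j < n" by simp
    have "col (A * B) j = A *\<^sub>v col B j" using col_mult2[OF Ac Bc j] .
    also have "\<dots> = unit_vec n j" using colB[OF j] f by simp
    finally show "col (A * B) j = col (1\<^sub>m n) j" using j by simp
  qed (use Ac Bc in auto)
  have BA: "B * A = 1\<^sub>m m"
  proof (rule mat_col_eqI)
    fix j assume "j < dim_col (1\<^sub>m m :: complex mat)"
    then have j: "j < m" by simp
    \<comment> \<open>Since \<open>A * B = 1\<close>, the matrix \<open>A\<close> has the same
      effect on both terms, so \<open>A\<close> kills \<open>u\<close> and injectivity gives
      \<open>B * A = 1\<close>.\<close>
    define u where "u = col (B * A) j - unit_vec m j"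
    have c: "col (B * A) j \<in> carrier_vec m" using Ac Bc j by auto
    have "A *\<^sub>v col (B * A) j = col (A * (B * A)) j" using col_mult2[OF Ac _ j, of "B * A"] Ac Bc by simp
    also have "A * (B * A) = A" using AB assoc_mult_mat[OF Ac Bc Ac] Ac by simp
    finally have "A *\<^sub>v u = 0\<^sub>v n"
      unfolding u_def using mult_minus_distrib_mat_vec[OF Ac c, of "unit_vec m j"] mult_mat_unit_vec[OF Ac j] Ac j
      by auto
    then have u: "u = 0\<^sub>v m" using ker[of u] c by (auto simp: u_def)
    have "col (B * A) j = unit_vec m j"
    proof (rule eq_vecI)
      fix i assume i: "i < dim_vec (unit_vec m j :: complex Matrix.vec)"
      have "vec_index u i = 0" unfolding u using i by simp
      then show "vec_index (col (B * A) j) i = vec_index (unit_vec m j) i"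
        using i c j by (simp add: u_def)
    qed (use carrier_vecD[OF c] in simp)
    then show "col (B * A) j = col (1\<^sub>m m) j" using j by simp
  qed (use Ac Bc in auto)
  \<comment> \<open>The trace of \<open>A * B\<close> is \<open>n\<close> and the trace of
    \<open>B * A\<close> is \<open>m\<close>.\<close>
  have "of_nat n = (\<Sum>i<n. (A * B) $$ (i, i))" using AB by simp
  also have "\<dots> = (\<Sum>i<n. \<Sum>k<m. A $$ (i, k) * B $$ (k, i))"
    using Ac Bc by (intro sum.cong) (auto simp: scalar_prod_def lessThan_atLeast0)
  also have "\<dots> = (\<Sum>k<m. \<Sum>i<n. B $$ (k, i) * A $$ (i, k))"
    by (subst sum.swap) (simp add: mult.commute)
  also have "\<dots> = (\<Sum>k<m. (B * A) $$ (k, k))"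
    using Ac Bc by (intro sum.cong) (auto simp: scalar_prod_def lessThan_atLeast0)
  also have "\<dots> = of_nat m" using BA by simp
  finally have "n = m" using of_nat_eq_iff[where 'a = complex] by blast
  then have nm: "deg \<rho> = deg \<sigma>" "m = n" by (simp_all add: m_def n_def)
  have "invertible_mat A"
    unfolding invertible_mat_def inverts_mat_def using AB BA Ac Bc nm by auto
  then show ?thesis
    unfolding rep_iso_def using A nm by (auto simp: intertwines_def)
qed

text \<open>Over the complex numbers \<open>A\<close> has an eigenvalue \<open>c\<close>; then
  \<open>A - c\<close> is again an intertwiner with a nonzero kernel, so its kernel is
  everything.\<close>

lemma schur_scalar:
  assumes irr: "irreducible_rep G \<rho>" and A: "intertwines \<rho> \<rho> A"
  shows "\<exists>c. A = c \<cdot>\<^sub>m 1\<^sub>m (deg \<rho>)"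
proof -
  define m where "m = deg \<rho>"
  have Ac: "A \<in> carrier_mat m m" using A by (simp add: intertwines_def m_def)
  have m0: "m > 0" using irreducible_deg_pos[OF irr] by (simp add: m_def)
  obtain c v where ev: "eigenvector A v c"
    using spectrum_non_empty[OF Ac] m0 by (auto simp: spectrum_def eigenvalue_def)
  then have v: "v \<in> carrier_vec m" "v \<noteq> 0\<^sub>v m" "A *\<^sub>v v = c \<cdot>\<^sub>v v" using Ac by (auto simp: eigenvector_def)
  define B where "B = A - c \<cdot>\<^sub>m 1\<^sub>m m"
  have Bc: "B \<in> carrier_mat m m" using Ac by (auto simp: B_def)
  note r = rep_carrier[OF irreducible_is_rep[OF irr], folded m_def]
  have "B * \<rho> x = \<rho> x * B" if x: "x \<in> carrier G" for x
  proof -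
    have "B * \<rho> x = A * \<rho> x - c \<cdot>\<^sub>m \<rho> x"
      unfolding B_def using Ac r[OF x] by (subst minus_mult_distrib_mat[of _ m m]) auto
    also have "A * \<rho> x = \<rho> x * A" using A x by (simp add: intertwines_def)
    also have "\<rho> x * A - c \<cdot>\<^sub>m \<rho> x = \<rho> x * B"
      unfolding B_def using Ac r[OF x] by (subst mult_minus_distrib_mat[of _ m m]) auto
    finally show ?thesis .
  qed
  then have B: "intertwines \<rho> \<rho> B" using Bc by (simp add: intertwines_def m_def)
  have "B *\<^sub>v v = 0\<^sub>v m"
    unfolding B_def using Ac v by (subst minus_mult_distrib_mat_vec[of _ m m]) auto
  then have all: "{v \<in> carrier_vec m. B *\<^sub>v v = 0\<^sub>v m} = carrier_vec m"
    using intertwiner_kernel[OF irr irreducible_is_rep[OF irr] B] v unfolding m_def by blast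
  have "A = c \<cdot>\<^sub>m 1\<^sub>m m"
  proof (rule eq_matI)
    fix i j assume ij: "i < dim_row (c \<cdot>\<^sub>m 1\<^sub>m m)" "j < dim_col (c \<cdot>\<^sub>m 1\<^sub>m m)"
    have "unit_vec m j \<in> {v \<in> carrier_vec m. B *\<^sub>v v = 0\<^sub>v m}" unfolding all by simp
    then have "col B j = 0\<^sub>v m" using ij mult_mat_unit_vec[OF Bc, of j] by auto
    then have "vec_index (col B j) i = 0" using ij by simp
    then have "B $$ (i, j) = 0" using ij Bc by auto
    then show "A $$ (i, j) = (c \<cdot>\<^sub>m 1\<^sub>m m) $$ (i, j)" using ij Ac by (auto simp: B_def)
  qed (use Ac in auto)
  then show ?thesis unfolding m_def by blast
qed


section \<open>Orthogonality of matrix coefficients\<close>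

lemma sum_translate:
  assumes "y \<in> carrier G"
  shows "(\<Sum>x\<in>carrier G. f (y \<otimes>\<^bsub>G\<^esub> x)) = (\<Sum>x\<in>carrier G. f x)"
  using sum.reindex[OF inj_on_cmult[OF assms], of f] surj_const_mult[OF assms] by simp

text \<open>The matrix is the sum over the group of \<sigma>(x) E \<rho>(x)^-1 with E the matrix
  unit at (\<open>k\<close>, \<open>l\<close>), since \<rho> is unitary. Replacing x by y x moves a
  group element from one side to the other.\<close>

lemma average_intertwines:
  assumes \<rho>: "is_rep G (deg \<rho>) \<rho>" "unitary_rep G \<rho>" and \<sigma>: "is_rep G (deg \<sigma>) \<sigma>"
    and kl: "k < deg \<sigma>" "l < deg \<rho>"
  shows "intertwines \<rho> \<sigma> (Matrix.mat (deg \<sigma>) (deg \<rho>)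
           (\<lambda>(i, j). \<Sum>x\<in>carrier G. \<sigma> x $$ (i, k) * cnj (\<rho> x $$ (j, l))))"
    (is "intertwines \<rho> \<sigma> ?A")
  unfolding intertwines_def
proof (intro conjI ballI)
  fix y assume y: "y \<in> carrier G"
  define S where "S i j = (\<Sum>x\<in>carrier G. \<sigma> x $$ (i, k) * cnj (\<rho> x $$ (j, l)))" for i j
  note r = rep_carrier[OF \<rho>(1)] and s = rep_carrier[OF \<sigma>]
  show "?A * \<rho> y = \<sigma> y * ?A"
  proof (rule eq_matI)
    fix i j assume "i < dim_row (\<sigma> y * ?A)" "j < dim_col (\<sigma> y * ?A)"
    then have ij: "i < deg \<sigma>" "j < deg \<rho>" using s[OF y] by auto
    have "(\<sigma> y * ?A) $$ (i, j) = (\<Sum>m<deg \<sigma>. \<sigma> y $$ (i, m) * S m j)"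
      using s[OF y] ij by (simp add: scalar_prod_def S_def lessThan_atLeast0 carrier_matD[OF s[OF y]])
    also have "\<dots> = (\<Sum>x\<in>carrier G. \<Sum>m<deg \<sigma>. \<sigma> y $$ (i, m) * \<sigma> x $$ (m, k) * cnj (\<rho> x $$ (j, l)))"
      unfolding S_def sum_distrib_left by (subst sum.swap) (simp add: mult.assoc)
    also have "\<dots> = (\<Sum>x\<in>carrier G. \<sigma> (y \<otimes>\<^bsub>G\<^esub> x) $$ (i, k) * cnj (\<rho> x $$ (j, l)))"
      using rep_mult_index[OF \<sigma> y _ ij(1) kl(1)] by (intro sum.cong refl) (simp add: sum_distrib_right)
    \<comment> \<open>Rewriting x as y^-1 (y x) makes the whole summand a function of y x, ready for
      translation.\<close>
    also have "\<dots> = (\<Sum>x\<in>carrier G. \<sigma> (y \<otimes>\<^bsub>G\<^esub> x) $$ (i, k) * cnj (\<rho> (inv\<^bsub>G\<^esub> y \<otimes>\<^bsub>G\<^esub> (y \<otimes>\<^bsub>G\<^esub> x)) $$ (j, l)))"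
      using y by (intro sum.cong refl) (simp add: m_assoc[symmetric])
    also have "\<dots> = (\<Sum>x\<in>carrier G. \<sigma> x $$ (i, k) * cnj (\<rho> (inv\<^bsub>G\<^esub> y \<otimes>\<^bsub>G\<^esub> x) $$ (j, l)))"
      by (rule sum_translate[OF y])
    also have "\<dots> = (\<Sum>x\<in>carrier G. \<Sum>m<deg \<rho>. \<rho> y $$ (m, j) * (\<sigma> x $$ (i, k) * cnj (\<rho> x $$ (m, l))))"
    proof (intro sum.cong refl)
      fix x assume x: "x \<in> carrier G"
      have "\<rho> (inv\<^bsub>G\<^esub> y \<otimes>\<^bsub>G\<^esub> x) $$ (j, l) = (\<Sum>m<deg \<rho>. cnj (\<rho> y $$ (m, j)) * \<rho> x $$ (m, l))"
        using rep_mult_index[OF \<rho>(1) inv_closed[OF y] x ij(2) kl(2)] unitary_inv_index[OF \<rho> y ij(2)] by simp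
      then show "\<sigma> x $$ (i, k) * cnj (\<rho> (inv\<^bsub>G\<^esub> y \<otimes>\<^bsub>G\<^esub> x) $$ (j, l)) = (\<Sum>m<deg \<rho>. \<rho> y $$ (m, j) * (\<sigma> x $$ (i, k) * cnj (\<rho> x $$ (m, l))))"
        by (simp add: sum_distrib_left mult_ac)
    qed
    also have "\<dots> = (\<Sum>m<deg \<rho>. S i m * \<rho> y $$ (m, j))"
      unfolding S_def by (subst sum.swap) (simp add: sum_distrib_right sum_distrib_left mult_ac)
    also have "\<dots> = (?A * \<rho> y) $$ (i, j)"
      using r[OF y] ij by (simp add: scalar_prod_def S_def lessThan_atLeast0 carrier_matD[OF r[OF y]])
    finally show "(?A * \<rho> y) $$ (i, j) = (\<sigma> y * ?A) $$ (i, j)" by simp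
  qed (use r[OF y] s[OF y] in auto)
qed auto

lemma orthogonality_distinct:
  assumes \<rho>: "irreducible_rep G \<rho>" "unitary_rep G \<rho>" and \<sigma>: "irreducible_rep G \<sigma>"
    and niso: "\<not> rep_iso G \<rho> \<sigma>"
    and ix: "i < deg \<sigma>" "k < deg \<sigma>" "j < deg \<rho>" "l < deg \<rho>"
  shows "(\<Sum>x\<in>carrier G. \<sigma> x $$ (i, k) * cnj (\<rho> x $$ (j, l))) = 0"
proof -
  define A where "A = Matrix.mat (deg \<sigma>) (deg \<rho>)
           (\<lambda>(i, j). \<Sum>x\<in>carrier G. \<sigma> x $$ (i, k) * cnj (\<rho> x $$ (j, l)))"
  have "intertwines \<rho> \<sigma> A"
    unfolding A_def by (intro average_intertwines irreducible_is_rep assms)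
  then have "A = 0\<^sub>m (deg \<sigma>) (deg \<rho>)" using schur_iso[OF \<rho>(1) \<sigma>] niso by blast
  then have "A $$ (i, j) = 0" using ix by simp
  then show ?thesis using ix by (simp add: A_def)
qed

text \<open>The averaged matrix unit is a scalar matrix. Its trace determines the scalar, and by
  unitarity each group element contributes the inner product of columns \<open>k\<close> and
  \<open>l\<close>.\<close>

lemma orthogonality_same:
  assumes \<rho>: "irreducible_rep G \<rho>" "unitary_rep G \<rho>"
    and ix: "i < deg \<rho>" "k < deg \<rho>" "j < deg \<rho>" "l < deg \<rho>"
  shows "(\<Sum>x\<in>carrier G. \<rho> x $$ (i, k) * cnj (\<rho> x $$ (j, l))) =
         (if i = j \<and> k = l then of_nat (card (carrier G)) / of_nat (deg \<rho>) else 0)"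
proof -
  note rep = irreducible_is_rep[OF \<rho>(1)]
  define A where "A = Matrix.mat (deg \<rho>) (deg \<rho>)
           (\<lambda>(i, j). \<Sum>x\<in>carrier G. \<rho> x $$ (i, k) * cnj (\<rho> x $$ (j, l)))"
  have "intertwines \<rho> \<rho> A"
    unfolding A_def by (intro average_intertwines rep \<rho> ix)
  then obtain c where c: "A = c \<cdot>\<^sub>m 1\<^sub>m (deg \<rho>)" using schur_scalar[OF \<rho>(1)] by blast
  have "of_nat (deg \<rho>) * c = (\<Sum>a<deg \<rho>. A $$ (a, a))" unfolding c by simp
  also have "\<dots> = (\<Sum>x\<in>carrier G. \<Sum>a<deg \<rho>. \<rho> x $$ (a, k) * cnj (\<rho> x $$ (a, l)))"
    by (subst sum.swap) (simp add: A_def)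
  also have "\<dots> = (\<Sum>x\<in>carrier G. if k = l then 1 else 0)"
  proof (intro sum.cong refl)
    fix x assume x: "x \<in> carrier G"
    have "(\<Sum>a<deg \<rho>. \<rho> x $$ (a, k) * cnj (\<rho> x $$ (a, l))) = (\<Sum>a<deg \<rho>. \<rho> (inv\<^bsub>G\<^esub> x) $$ (l, a) * \<rho> x $$ (a, k))"
      using unitary_inv_index[OF rep \<rho>(2) x ix(4)] by (intro sum.cong refl) (simp add: mult.commute)
    also have "\<dots> = \<rho> (inv\<^bsub>G\<^esub> x \<otimes>\<^bsub>G\<^esub> x) $$ (l, k)"
      using rep_mult_index[OF rep inv_closed[OF x] x ix(4) ix(2)] by simp
    also have "\<dots> = (if k = l then 1 else 0)" using x rep ix by (auto simp: is_rep_def)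
    finally show "(\<Sum>a<deg \<rho>. \<rho> x $$ (a, k) * cnj (\<rho> x $$ (a, l))) = (if k = l then 1 else 0)" .
  qed
  finally have "c = (if k = l then of_nat (card (carrier G)) / of_nat (deg \<rho>) else 0)"
    using irreducible_deg_pos[OF \<rho>(1)] by (auto simp: field_simps split: if_splits)
  moreover have "A $$ (i, j) = (if i = j then c else 0)" unfolding c using ix by simp
  moreover have "A $$ (i, j) = (\<Sum>x\<in>carrier G. \<rho> x $$ (i, k) * cnj (\<rho> x $$ (j, l)))"
    using ix by (simp add: A_def)
  ultimately show ?thesis by auto
qed

section \<open>Trivial and conjugate representations\<close>

lemma irreducible_repI:
  assumes "is_rep G D \<rho>" "D > 0"
    and "\<And>W. W \<subseteq> carrier_vec D \<Longrightarrow> 0\<^sub>v D \<in> W \<Longrightarrow> (\<And>v w. v \<in> W \<Longrightarrow> w \<in> W \<Longrightarrow> v + w \<in> W) \<Longrightarrow>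
      (\<And>c v. v \<in> W \<Longrightarrow> c \<cdot>\<^sub>v v \<in> W) \<Longrightarrow> (\<And>x w. x \<in> carrier G \<Longrightarrow> w \<in> W \<Longrightarrow> \<rho> x *\<^sub>v w \<in> W) \<Longrightarrow>
      W = {0\<^sub>v D} \<or> W = carrier_vec D"
  shows "irreducible_rep G \<rho>"
proof -
  have d: "deg \<rho> = D" by (rule is_rep_degree[OF assms(1)])
  have "W = {0\<^sub>v D} \<or> W = carrier_vec D"
    if "VectorSpace.subspace class_ring W (module_vec TYPE(complex) D)"
      "\<And>x w. x \<in> carrier G \<Longrightarrow> w \<in> W \<Longrightarrow> \<rho> x *\<^sub>v w \<in> W" for W
  proof (rule assms(3))
    have sub: "submodule class_ring W (module_vec TYPE(complex) D)"
      using that(1) by (simp add: VectorSpace.subspace_def)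
    note sm = submodule.subset[OF sub] submodule.m_closed[OF sub] submodule.zero_closed[OF sub] submodule.smult_closed[OF sub]
    show "W \<subseteq> carrier_vec D" "0\<^sub>v D \<in> W" using sm by (simp_all add: module_vec_simps)
    show "v + w \<in> W" if "v \<in> W" "w \<in> W" for v w using sm(2)[OF that] by (simp add: module_vec_simps)
    show "c \<cdot>\<^sub>v v \<in> W" if "v \<in> W" for c v using sm(4)[OF _ that, of c] by (simp add: module_vec_simps)
  qed (use that(2) in blast)
  then show ?thesis using assms(1,2) d by (auto simp: irreducible_rep_def Let_def)
qed

lemma irreducible_trivial: "irreducible_rep G trivial_rep"
proof (rule irreducible_repI[where D = 1])
  show "is_rep G 1 trivial_rep" by (auto simp: is_rep_def trivial_rep_def)
  fix W :: "complex Matrix.vec set"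
  assume W: "W \<subseteq> carrier_vec 1" "0\<^sub>v 1 \<in> W" and smult: "\<And>c v. v \<in> W \<Longrightarrow> c \<cdot>\<^sub>v v \<in> W"
  show "W = {0\<^sub>v 1} \<or> W = carrier_vec 1"
  proof (cases "W = {0\<^sub>v 1}")
    case False
    then obtain w where w: "w \<in> W" "w \<noteq> 0\<^sub>v 1" using W by auto
    then have wc: "w \<in> carrier_vec 1" using W by auto
    have w0: "vec_index w 0 \<noteq> 0"
    proof
      assume "vec_index w 0 = 0"
      then have "w = 0\<^sub>v 1" using wc by (intro eq_vecI) auto
      then show False using w by simp
    qed
    have "v \<in> W" if "v \<in> carrier_vec 1" for v
    proof -
      have "v = (vec_index v 0 / vec_index w 0) \<cdot>\<^sub>v w" using that wc w0 by (intro eq_vecI) auto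
      then show ?thesis using smult[OF w(1)] by metis
    qed
    then show ?thesis using W by auto
  qed simp
qed simp

lemma deg_conj [simp]: "deg (conj_rep \<rho>) = deg \<rho>"
  by (simp add: rep_degree_def conj_rep_def)

lemma conj_conj [simp]: "conj_rep (conj_rep \<rho>) = \<rho>"
  by (simp add: conj_rep_def)

lemma conj_trivial [simp]: "conj_rep trivial_rep = trivial_rep"
  by (simp add: conj_rep_def trivial_rep_def map_cnj_one)

lemma conj_is_rep: "is_rep G D \<rho> \<Longrightarrow> is_rep G D (conj_rep \<rho>)"
  by (auto simp: is_rep_def conj_rep_def map_cnj_one intro!: map_cnj_mult[where n = D and m = D and k = D])

lemma conj_unitary:
  assumes "is_rep G (deg \<rho>) \<rho>" "unitary_rep G \<rho>"
  shows "unitary_rep G (conj_rep \<rho>)"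
proof -
  have "conj_rep \<rho> x * mat_adjoint (conj_rep \<rho> x) = 1\<^sub>m (deg \<rho>)" if x: "x \<in> carrier G" for x
  proof -
    note c = rep_carrier[OF assms(1) x]
    have "mat_adjoint (conj_rep \<rho> x) = map_mat cnj (mat_adjoint (\<rho> x))"
      using c by (intro eq_matI) (auto simp: conj_rep_def)
    then show ?thesis
      using map_cnj_mult[OF c mat_adjoint_carrier[OF c]] assms(2) x
      by (simp add: conj_rep_def unitary_rep_def map_cnj_one)
  qed
  then show ?thesis by (simp add: unitary_rep_def)
qed

text \<open>Entrywise conjugation carries invariant subspaces of the conjugate representation to
  invariant subspaces of \<rho>. It is only semilinear, but the image of a complex subspace is still
  one.\<close>

lemma conj_irreducible:
  assumes irr: "irreducible_rep G \<rho>"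
  shows "irreducible_rep G (conj_rep \<rho>)"
proof (rule irreducible_repI[where D = "deg \<rho>"])
  let ?D = "deg \<rho>"
  note rep = irreducible_is_rep[OF irr]
  show "is_rep G ?D (conj_rep \<rho>)" by (rule conj_is_rep[OF rep])
  show "?D > 0" by (rule irreducible_deg_pos[OF irr])
  have cc: "map_vec cnj (map_vec cnj v) = v" for v by (intro eq_vecI) auto
  have cz: "map_vec cnj (0\<^sub>v ?D) = 0\<^sub>v ?D" by (intro eq_vecI) auto
  fix W :: "complex Matrix.vec set"
  assume W: "W \<subseteq> carrier_vec ?D" "0\<^sub>v ?D \<in> W" and add: "\<And>v w. v \<in> W \<Longrightarrow> w \<in> W \<Longrightarrow> v + w \<in> W"
    and smult: "\<And>c v. v \<in> W \<Longrightarrow> c \<cdot>\<^sub>v v \<in> W"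
    and inv: "\<And>x w. x \<in> carrier G \<Longrightarrow> w \<in> W \<Longrightarrow> conj_rep \<rho> x *\<^sub>v w \<in> W"
  define W' where "W' = map_vec cnj ` W"
  have "W' = {0\<^sub>v ?D} \<or> W' = carrier_vec ?D"
  proof (rule irreducible_invariant[OF irr])
    show "W' \<subseteq> carrier_vec ?D" using W by (auto simp: W'_def)
    show "0\<^sub>v ?D \<in> W'" using W cz by (auto simp: W'_def image_iff intro!: bexI[of _ "0\<^sub>v ?D"])
    show "v + w \<in> W'" if "v \<in> W'" "w \<in> W'" for v w
    proof -
      from that obtain a b where ab: "v = map_vec cnj a" "w = map_vec cnj b" "a \<in> W" "b \<in> W" by (auto simp: W'_def)
      then have "a \<in> carrier_vec ?D" "b \<in> carrier_vec ?D" using W by auto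
      then have "v + w = map_vec cnj (a + b)" unfolding ab by (intro eq_vecI) auto
      then show ?thesis using add[OF ab(3,4)] by (auto simp: W'_def)
    qed
    show "c \<cdot>\<^sub>v v \<in> W'" if "v \<in> W'" for c v
    proof -
      from that obtain a where a: "v = map_vec cnj a" "a \<in> W" by (auto simp: W'_def)
      have "c \<cdot>\<^sub>v v = map_vec cnj (cnj c \<cdot>\<^sub>v a)" using a by (intro eq_vecI) auto
      then show ?thesis using smult[OF a(2)] by (auto simp: W'_def)
    qed
    show "\<rho> x *\<^sub>v w \<in> W'" if "x \<in> carrier G" "w \<in> W'" for x w
    proof -
      from that obtain a where a: "w = map_vec cnj a" "a \<in> W" by (auto simp: W'_def)
      have "\<rho> x *\<^sub>v w = map_vec cnj (conj_rep \<rho> x *\<^sub>v a)"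
        using map_cnj_mult_vec[of "conj_rep \<rho> x" ?D ?D a] a W rep_carrier[OF rep that(1)]
        by (auto simp: conj_rep_def)
      then show ?thesis using inv[OF that(1) a(2)] by (auto simp: W'_def)
    qed
  qed
  moreover have "W = map_vec cnj ` W'" by (auto simp: W'_def image_iff cc)
  moreover have "map_vec cnj ` carrier_vec ?D = carrier_vec ?D"
    using cc by (auto simp: image_iff) (metis cc map_carrier_vec)
  ultimately show "W = {0\<^sub>v ?D} \<or> W = carrier_vec ?D" using cz by auto
qed

lemma conj_rep_iso:
  assumes \<rho>: "is_rep G (deg \<rho>) \<rho>" and \<sigma>: "is_rep G (deg \<sigma>) \<sigma>" and iso: "rep_iso G \<rho> \<sigma>"
  shows "rep_iso G (conj_rep \<rho>) (conj_rep \<sigma>)"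
proof -
  let ?D = "deg \<rho>"
  have d: "deg \<sigma> = ?D" using iso by (simp add: rep_iso_def)
  obtain P where P: "P \<in> carrier_mat ?D ?D" "invertible_mat P" "\<And>x. x \<in> carrier G \<Longrightarrow> P * \<rho> x = \<sigma> x * P"
    using iso by (auto simp: rep_iso_def)
  obtain Q where Q: "P * Q = 1\<^sub>m (dim_row P)" "Q * P = 1\<^sub>m (dim_row Q)"
    using P(2) by (auto simp: invertible_mat_def inverts_mat_def)
  \<comment> \<open>\<open>invertible_mat\<close> supplies an inverse without its dimensions;
    comparing column counts in the two identities recovers them.\<close>
  have Qc: "Q \<in> carrier_mat ?D ?D"
    using arg_cong[OF Q(1), of dim_col] arg_cong[OF Q(2), of dim_col] P(1) by auto
  have "map_mat cnj P * map_mat cnj Q = 1\<^sub>m ?D" "map_mat cnj Q * map_mat cnj P = 1\<^sub>m ?D"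
    unfolding map_cnj_mult[OF P(1) Qc, symmetric] map_cnj_mult[OF Qc P(1), symmetric]
    using Q P(1) Qc by (auto simp: map_cnj_one)
  then have "invertible_mat (map_mat cnj P)"
    unfolding invertible_mat_def inverts_mat_def
    using P(1) Qc by (auto intro!: exI[of _ "map_mat cnj Q"])
  moreover have "map_mat cnj P * conj_rep \<rho> x = conj_rep \<sigma> x * map_mat cnj P" if x: "x \<in> carrier G" for x
    using map_cnj_mult[OF P(1) rep_carrier[OF \<rho> x]] map_cnj_mult[OF rep_carrier[OF \<sigma> x, unfolded d] P(1)] P(3)[OF x]
    by (simp add: conj_rep_def)
  ultimately show ?thesis
    unfolding rep_iso_def using d P(1) by (auto intro!: bexI[of _ "map_mat cnj P"])
qed

lemma rep_iso_refl:
  assumes "is_rep G (deg \<rho>) \<rho>"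
  shows "rep_iso G \<rho> \<rho>"
  unfolding rep_iso_def
proof (intro conjI bexI[of _ "1\<^sub>m (deg \<rho>)"] ballI)
  show "invertible_mat (1\<^sub>m (deg \<rho>) :: complex mat)"
    unfolding invertible_mat_def inverts_mat_def by (auto intro!: exI[of _ "1\<^sub>m (deg \<rho>)"])
  show "1\<^sub>m (deg \<rho>) * \<rho> x = \<rho> x * 1\<^sub>m (deg \<rho>)" if "x \<in> carrier G" for x
    using rep_carrier[OF assms that] by (simp add: left_mult_one_mat right_mult_one_mat)
qed auto

section \<open>Energy of a word in the nontrivial representations\<close>

text \<open>The squared Frobenius norm of the matrix sum of \<rho> over the letters of the
  word.\<close>

definition coeff_energy :: "('g \<Rightarrow> complex mat) \<Rightarrow> nat \<Rightarrow> (nat \<Rightarrow> 'g) \<Rightarrow> real" where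
  "coeff_energy \<rho> n h = (\<Sum>a<deg \<rho>. \<Sum>b<deg \<rho>. (cmod (\<Sum>u<n. \<rho> (h u) $$ (a, b)))\<^sup>2)"

lemma coeff_energy_conj: "is_rep G (deg \<rho>) \<rho> \<Longrightarrow> h \<in> {..<n} \<rightarrow> carrier G \<Longrightarrow> coeff_energy (conj_rep \<rho>) n h = coeff_energy \<rho> n h"
proof -
  assume \<rho>: "is_rep G (deg \<rho>) \<rho>" and h: "h \<in> {..<n} \<rightarrow> carrier G"
  have "(\<Sum>u<n. conj_rep \<rho> (h u) $$ (a, b)) = cnj (\<Sum>u<n. \<rho> (h u) $$ (a, b))"
    if "a < deg \<rho>" "b < deg \<rho>" for a b
    unfolding cnj_sum
  proof (intro sum.cong refl)
    fix u assume "u \<in> {..<n}"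
    then have "h u \<in> carrier G" using h by auto
    then show "conj_rep \<rho> (h u) $$ (a, b) = cnj (\<rho> (h u) $$ (a, b))"
      using rep_carrier[OF \<rho>, of "h u"] that by (auto simp: conj_rep_def)
  qed
  then have "cmod (\<Sum>u<n. conj_rep \<rho> (h u) $$ (a, b)) = cmod (\<Sum>u<n. \<rho> (h u) $$ (a, b))"
    if "a < deg \<rho>" "b < deg \<rho>" for a b
    using that by (metis complex_mod_cnj)
  then show ?thesis unfolding coeff_energy_def by (intro sum.cong) auto
qed

text \<open>The matrix coefficients of the \<tau> i are orthogonal with squared norm L / deg, and
  Bessel's inequality is applied to the centred letter counts \<open>f\<close>. Centring leaves
  their Fourier coefficients unchanged, because matrix coefficients of nontrivial irreducibles sum
  to 0 over the group.\<close>

lemma sum_coeff_energy_le: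
  fixes \<tau> :: "'i \<Rightarrow> 'g \<Rightarrow> complex mat"
  assumes I: "finite I" and irr: "\<And>i. i \<in> I \<Longrightarrow> irreducible_rep G (\<tau> i)" "\<And>i. i \<in> I \<Longrightarrow> unitary_rep G (\<tau> i)"
    and nontriv: "\<And>i. i \<in> I \<Longrightarrow> \<not> rep_iso G (\<tau> i) trivial_rep"
    and niso: "\<And>i j. i \<in> I \<Longrightarrow> j \<in> I \<Longrightarrow> i \<noteq> j \<Longrightarrow> \<not> rep_iso G (\<tau> i) (\<tau> j)"
    and h: "h \<in> {..<n} \<rightarrow> carrier G"
  defines "L \<equiv> card (carrier G)"
  shows "(\<Sum>i\<in>I. real (deg (\<tau> i)) * coeff_energy (\<tau> i) n h) \<le>
         L * (\<Sum>x\<in>carrier G. (real (card {u. u < n \<and> h u = x}) - n / L)\<^sup>2)"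
proof -
  define N where "N x = card {u. u < n \<and> h u = x}" for x
  define f where "f x = complex_of_real (real (N x) - n / L)" for x
  define K where "K = (SIGMA i:I. {..<deg (\<tau> i)} \<times> {..<deg (\<tau> i)})"
  define \<phi> where "\<phi> k x = (case k of (i, a, b) \<Rightarrow> \<tau> i x $$ (a, b))" for k :: "'i \<times> nat \<times> nat" and x
  define w where "w k = real L / deg (\<tau> (fst k))" for k :: "'i \<times> nat \<times> nat"
  have L0: "L > 0" unfolding L_def using finite_carrier one_closed by (auto simp: card_gt_0_iff)
  have zero: "(\<Sum>x\<in>carrier G. \<tau> i x $$ (a, b)) = 0" if i: "i \<in> I" and ab: "a < deg (\<tau> i)" "b < deg (\<tau> i)" for i a b
  proof -
    have "(\<Sum>x\<in>carrier G. trivial_rep x $$ (0, 0) * cnj (\<tau> i x $$ (a, b))) = 0"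
      using i ab by (intro orthogonality_distinct irr irreducible_trivial nontriv) (auto simp: rep_degree_def trivial_rep_def)
    then have "cnj (\<Sum>x\<in>carrier G. \<tau> i x $$ (a, b)) = 0" by (simp add: trivial_rep_def)
    then show ?thesis by (simp only: complex_cnj_zero_iff)
  qed
  have coeff: "(\<Sum>x\<in>carrier G. f x * \<tau> i x $$ (a, b)) = (\<Sum>u<n. \<tau> i (h u) $$ (a, b))"
    if i: "i \<in> I" and ab: "a < deg (\<tau> i)" "b < deg (\<tau> i)" for i a b
  proof -
    have "(\<Sum>u<n. \<tau> i (h u) $$ (a, b)) = (\<Sum>x\<in>carrier G. \<Sum>u\<in>{u \<in> {..<n}. h u = x}. \<tau> i (h u) $$ (a, b))"
      using h finite_carrier by (intro sum.group[symmetric]) auto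
    also have "\<dots> = (\<Sum>x\<in>carrier G. of_nat (N x) * \<tau> i x $$ (a, b))"
      by (intro sum.cong refl) (simp add: N_def)
    also have "\<dots> = (\<Sum>x\<in>carrier G. f x * \<tau> i x $$ (a, b)) + of_real (n / L) * (\<Sum>x\<in>carrier G. \<tau> i x $$ (a, b))"
      by (simp add: f_def sum_distrib_left sum.distrib[symmetric] algebra_simps)
    finally show ?thesis using zero[OF i ab] by simp
  qed
  have sumK: "(\<Sum>k\<in>K. g k) = (\<Sum>i\<in>I. \<Sum>a<deg (\<tau> i). \<Sum>b<deg (\<tau> i). g (i, a, b))" for g :: "_ \<Rightarrow> real"
    using sum.Sigma[of I "\<lambda>i. {..<deg (\<tau> i)} \<times> {..<deg (\<tau> i)}" "\<lambda>i p. g (i, p)"] I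
    by (simp add: K_def sum.cartesian_product)
  have "(\<Sum>k\<in>K. (cmod (\<Sum>x\<in>carrier G. f x * \<phi> k x))\<^sup>2 / w k) \<le> (\<Sum>x\<in>carrier G. (cmod (f x))\<^sup>2)"
  proof (rule bessel_inequality)
    show "finite K" using I by (auto simp: K_def)
    show "w k > 0" if "k \<in> K" for k
      using that L0 irreducible_deg_pos[OF irr(1)] by (auto simp: w_def K_def)
    fix k l assume k: "k \<in> K" and l: "l \<in> K"
    obtain i a b where k': "k = (i, a, b)" by (cases k)
    obtain j c d where l': "l = (j, c, d)" by (cases l)
    have ij: "i \<in> I" "j \<in> I" "a < deg (\<tau> i)" "b < deg (\<tau> i)" "c < deg (\<tau> j)" "d < deg (\<tau> j)"
      using k l by (auto simp: K_def k' l')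
    show "(\<Sum>x\<in>carrier G. \<phi> k x * cnj (\<phi> l x)) = (if k = l then of_real (w k) else 0)"
    proof (cases "i = j")
      case True
      then show ?thesis
        using orthogonality_same[OF irr[OF ij(1)], of a b c d] ij by (simp add: \<phi>_def k' l' w_def L_def)
    next
      case False
      then show ?thesis
        using orthogonality_distinct[OF irr[OF ij(2)] irr(1)[OF ij(1)] niso[OF ij(2,1)], of a b c d] ij by (simp add: \<phi>_def k' l')
    qed
  qed
  also have "(\<Sum>k\<in>K. (cmod (\<Sum>x\<in>carrier G. f x * \<phi> k x))\<^sup>2 / w k) =
      (\<Sum>i\<in>I. real (deg (\<tau> i)) / L * coeff_energy (\<tau> i) n h)"
    unfolding sumK
    by (auto simp: coeff_energy_def sum_distrib_left \<phi>_def w_def coeff sum_divide_distrib mult_ac intro!: sum.cong)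
  finally have "(\<Sum>i\<in>I. real (deg (\<tau> i)) / L * coeff_energy (\<tau> i) n h) \<le> (\<Sum>x\<in>carrier G. (real (N x) - n / L)\<^sup>2)"
    by (simp add: f_def del: of_real_diff)
  then have "L * (\<Sum>i\<in>I. real (deg (\<tau> i)) / L * coeff_energy (\<tau> i) n h) \<le> L * (\<Sum>x\<in>carrier G. (real (N x) - n / L)\<^sup>2)"
    by (intro mult_left_mono) auto
  moreover have "L * (\<Sum>i\<in>I. real (deg (\<tau> i)) / L * coeff_energy (\<tau> i) n h) = (\<Sum>i\<in>I. real (deg (\<tau> i)) * coeff_energy (\<tau> i) n h)"
    using L0 by (simp add: sum_distrib_left)
  ultimately show ?thesis by (simp add: N_def)
qed

text \<open>Adjoining the conjugates of the complex-type members of \<Psi> keeps the family pairwise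
  non-isomorphic. A conjugate has the same energy, so the bound for the enlarged family puts weight
  2 on complex type.\<close>

lemma frequencies_energy_le:
  assumes \<Psi>: "all_frequencies G \<Psi>" and h: "h \<in> {..<n} \<rightarrow> carrier G"
  defines "L \<equiv> card (carrier G)"
  shows "(\<Sum>\<rho>\<in>\<Psi>. (if rep_type G \<rho> = Complex_Type then 2 else 1) * (real (deg \<rho>) * coeff_energy \<rho> n h)) \<le>
         L * (\<Sum>x\<in>carrier G. (real (card {u. u < n \<and> h u = x}) - n / L)\<^sup>2)"
proof -
  have fin: "finite \<Psi>" using \<Psi> by (simp add: all_frequencies_def)
  have freq: "irreducible_rep G \<rho>" "unitary_rep G \<rho>" "\<not> rep_iso G \<rho> trivial_rep" if "\<rho> \<in> \<Psi>" for \<rho>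
    using \<Psi> that by (auto simp: all_frequencies_def frequency_def)
  note rep = irreducible_is_rep[OF freq(1)]
  \<comment> \<open>The uniqueness clause of \<open>all_frequencies\<close> is applied to the member
    \<rho> itself, which already represents its own class.\<close>
  have distinct: "\<not> rep_iso G \<rho> \<sigma>" "\<not> rep_iso G \<rho> (conj_rep \<sigma>)" if "\<rho> \<in> \<Psi>" "\<sigma> \<in> \<Psi>" "\<rho> \<noteq> \<sigma>" for \<rho> \<sigma>
  proof -
    have "\<exists>!\<rho>'. \<rho>' \<in> \<Psi> \<and> (rep_iso G \<rho> \<rho>' \<or> rep_iso G \<rho> (conj_rep \<rho>'))"
      using \<Psi> freq(1,3)[OF that(1)] by (auto simp: all_frequencies_def)
    then show "\<not> rep_iso G \<rho> \<sigma>" "\<not> rep_iso G \<rho> (conj_rep \<sigma>)"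
      using rep_iso_refl[OF rep[OF that(1)]] that by metis+
  qed
  define B where "B \<rho> = (if rep_type G \<rho> = Complex_Type then {False, True} else {False})" for \<rho>
  define I where "I = (SIGMA \<rho>:\<Psi>. B \<rho>)"
  define \<tau> where "\<tau> i = (if snd i then conj_rep (fst i) else fst i)" for i :: "('g \<Rightarrow> complex mat) \<times> bool"
  have "(\<Sum>i\<in>I. real (deg (\<tau> i)) * coeff_energy (\<tau> i) n h) \<le>
         L * (\<Sum>x\<in>carrier G. (real (card {u. u < n \<and> h u = x}) - n / L)\<^sup>2)"
    unfolding L_def
  proof (rule sum_coeff_energy_le[OF _ _ _ _ _ h])
    show "finite I" using fin by (auto simp: I_def B_def)
    fix i assume i: "i \<in> I"
    then have f: "fst i \<in> \<Psi>" by (auto simp: I_def)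
    show "irreducible_rep G (\<tau> i)" using freq(1)[OF f] conj_irreducible by (auto simp: \<tau>_def)
    show "unitary_rep G (\<tau> i)" using freq(2)[OF f] conj_unitary[OF rep[OF f]] by (auto simp: \<tau>_def)
    show "\<not> rep_iso G (\<tau> i) trivial_rep"
      using freq(3)[OF f] conj_rep_iso[of "conj_rep (fst i)" trivial_rep] conj_is_rep[OF rep[OF f]]
        irreducible_is_rep[OF irreducible_trivial] by (auto simp: \<tau>_def)
    fix j assume j: "j \<in> I" "i \<noteq> j"
    obtain \<rho> b where i': "i = (\<rho>, b)" by (cases i)
    obtain \<sigma> c where j': "j = (\<sigma>, c)" by (cases j)
    have \<rho>: "\<rho> \<in> \<Psi>" "\<sigma> \<in> \<Psi>" using i j by (auto simp: I_def i' j')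
    note reps = rep[OF \<rho>(1)] rep[OF \<rho>(2)] conj_is_rep[OF rep[OF \<rho>(1)]] conj_is_rep[OF rep[OF \<rho>(2)]]
    \<comment> \<open>Only whether the two conjugation flags agree matters, since both sides may be
      conjugated at once. If \<rho> = \<sigma> the flags differ, which happens only for complex
      type, that is, for \<rho> not isomorphic to its conjugate.\<close>
    have *: "\<not> rep_iso G \<rho> (if c = b then \<sigma> else conj_rep \<sigma>)"
    proof (cases "\<rho> = \<sigma>")
      case True
      then have "c \<noteq> b" using j by (auto simp: i' j')
      then have "rep_type G \<rho> = Complex_Type" using i j True by (auto simp: I_def B_def i' j' split: if_splits)
      then show ?thesis using \<open>c \<noteq> b\<close> True by (auto simp: rep_type_def split: if_splits)
    next
      case False
      then show ?thesis using distinct[OF \<rho>] by auto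
    qed
    show "\<not> rep_iso G (\<tau> i) (\<tau> j)"
    proof (cases b)
      case False
      then show ?thesis using * by (auto simp: \<tau>_def i' j' split: if_splits)
    next
      case True
      then have "\<not> rep_iso G (conj_rep \<rho>) (if c then conj_rep \<sigma> else \<sigma>)"
        using * conj_rep_iso[of "conj_rep \<rho>" "if c then conj_rep \<sigma> else \<sigma>"] reps by (auto split: if_splits)
      then show ?thesis using True by (auto simp: \<tau>_def i' j')
    qed
  qed
  also have "(\<Sum>i\<in>I. real (deg (\<tau> i)) * coeff_energy (\<tau> i) n h) =
      (\<Sum>\<rho>\<in>\<Psi>. \<Sum>b\<in>B \<rho>. real (deg (\<tau> (\<rho>, b))) * coeff_energy (\<tau> (\<rho>, b)) n h)"
    unfolding I_def using fin by (subst sum.Sigma) (auto simp: B_def)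
  also have "\<dots> = (\<Sum>\<rho>\<in>\<Psi>. (if rep_type G \<rho> = Complex_Type then 2 else 1) * (real (deg \<rho>) * coeff_energy \<rho> n h))"
    by (intro sum.cong refl) (auto simp: B_def \<tau>_def coeff_energy_conj[OF rep h])
  finally show ?thesis .
qed

end

section \<open>Gaussian shifts\<close>

lemma PiM_box_eqI:
  assumes I: "finite I" and M: "\<And>i. prob_space (M i)" and P: "sets P = sets (PiM I M)"
    and eq: "\<And>A. (\<And>i. i \<in> I \<Longrightarrow> A i \<in> sets (M i)) \<Longrightarrow> emeasure P (Pi\<^sub>E I A) = (\<Prod>i\<in>I. emeasure (M i) (A i))"
  shows "P = PiM I M"
proof -
  interpret product_sigma_finite M
    using M by (intro product_sigma_finite.intro prob_space_imp_sigma_finite)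
  show ?thesis using I P eq by (rule PiM_eqI)
qed

lemma distr_PiM_componentwise:
  assumes I: "finite I" and M: "\<And>i. prob_space (M i)" and f: "\<And>i. f i \<in> M i \<rightarrow>\<^sub>M N i"
  shows "distr (PiM I M) (PiM I N) (\<lambda>z. \<lambda>i\<in>I. f i (z i)) = PiM I (\<lambda>i. distr (M i) (N i) (f i))"
proof (rule PiM_box_eqI[OF I])
  interpret product_sigma_finite M
    using M by (intro product_sigma_finite.intro prob_space_imp_sigma_finite)
  note f[measurable]
  show "prob_space (distr (M i) (N i) (f i))" for i by (intro prob_space.prob_space_distr M f)
  show "sets (distr (PiM I M) (PiM I N) (\<lambda>z. \<lambda>i\<in>I. f i (z i))) = sets (PiM I (\<lambda>i. distr (M i) (N i) (f i)))"
    by (simp cong: sets_PiM_cong)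
  fix A assume "\<And>i. i \<in> I \<Longrightarrow> A i \<in> sets (distr (M i) (N i) (f i))"
  then have A[measurable]: "\<And>i. i \<in> I \<Longrightarrow> A i \<in> sets (N i)" by simp
  have "emeasure (distr (PiM I M) (PiM I N) (\<lambda>z. \<lambda>i\<in>I. f i (z i))) (Pi\<^sub>E I A) =
      emeasure (PiM I M) ((\<lambda>z. \<lambda>i\<in>I. f i (z i)) -` Pi\<^sub>E I A \<inter> space (PiM I M))"
    using I by (intro emeasure_distr) (auto intro!: sets_PiM_I_finite)
  also have "(\<lambda>z. \<lambda>i\<in>I. f i (z i)) -` Pi\<^sub>E I A \<inter> space (PiM I M) = Pi\<^sub>E I (\<lambda>i. f i -` A i \<inter> space (M i))"
    by (auto simp: space_PiM PiE_iff)
  also have "emeasure (PiM I M) \<dots> = (\<Prod>i\<in>I. emeasure (M i) (f i -` A i \<inter> space (M i)))"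
    using I by (intro emeasure_PiM) auto
  also have "\<dots> = (\<Prod>i\<in>I. emeasure (distr (M i) (N i) (f i)) (A i))"
    by (intro prod.cong refl) (simp add: emeasure_distr[OF f A])
  finally show "emeasure (distr (PiM I M) (PiM I N) (\<lambda>z. \<lambda>i\<in>I. f i (z i))) (Pi\<^sub>E I A) =
    (\<Prod>i\<in>I. emeasure (distr (M i) (N i) (f i)) (A i))" .
qed

text \<open>\<open>l\<close> is the likelihood ratio of the law moved by \<open>T\<close> against
  the original law. In this form it passes to finite products, which is used twice: over the
  coordinates of one matrix and over the frequencies.\<close>

definition shift_density :: "'a measure \<Rightarrow> ('a \<Rightarrow> 'a) \<Rightarrow> ('a \<Rightarrow> ennreal) \<Rightarrow> bool" where
  "shift_density M T l \<longleftrightarrow> T \<in> M \<rightarrow>\<^sub>M M \<and> l \<in> borel_measurable M \<and> distr M M T = density M l"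

text \<open>Both measures are determined by their values on boxes, where the integral of a product
  of one-coordinate functions factorises.\<close>

lemma shift_density_PiM:
  assumes I: "finite I" and M: "\<And>i. prob_space (M i)" and sd: "\<And>i. shift_density (M i) (T i) (l i)"
  shows "shift_density (PiM I M) (\<lambda>z. \<lambda>i\<in>I. T i (z i)) (\<lambda>z. \<Prod>i\<in>I. l i (z i))"
proof -
  interpret product_sigma_finite M
    using M by (intro product_sigma_finite.intro prob_space_imp_sigma_finite)
  have T[measurable]: "T i \<in> M i \<rightarrow>\<^sub>M M i" and l[measurable]: "l i \<in> borel_measurable (M i)"
    and eq: "distr (M i) (M i) (T i) = density (M i) (l i)" for i
    using sd by (auto simp: shift_density_def)
  have prob: "prob_space (density (M i) (l i))" for i
    unfolding eq[symmetric] by (intro prob_space.prob_space_distr M T)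
  have "density (PiM I M) (\<lambda>z. \<Prod>i\<in>I. l i (z i)) = PiM I (\<lambda>i. density (M i) (l i))"
  proof (rule PiM_box_eqI[OF I prob])
    show "sets (density (PiM I M) (\<lambda>z. \<Prod>i\<in>I. l i (z i))) = sets (PiM I (\<lambda>i. density (M i) (l i)))"
      by (simp cong: sets_PiM_cong)
    fix A assume "\<And>i. i \<in> I \<Longrightarrow> A i \<in> sets (density (M i) (l i))"
    then have A[measurable]: "\<And>i. i \<in> I \<Longrightarrow> A i \<in> sets (M i)" by simp
    have "emeasure (density (PiM I M) (\<lambda>z. \<Prod>i\<in>I. l i (z i))) (Pi\<^sub>E I A) =
        (\<integral>\<^sup>+z. (\<Prod>i\<in>I. l i (z i)) * indicator (Pi\<^sub>E I A) z \<partial>PiM I M)"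
      using I by (intro emeasure_density) (auto intro!: sets_PiM_I_finite)
    also have "\<dots> = (\<integral>\<^sup>+z. (\<Prod>i\<in>I. l i (z i) * indicator (A i) (z i)) \<partial>PiM I M)"
    proof (intro nn_integral_cong)
      fix z assume z: "z \<in> space (PiM I M)"
      have "indicator (Pi\<^sub>E I A) z = (\<Prod>i\<in>I. indicator (A i) (z i) :: ennreal)"
      proof (cases "z \<in> Pi\<^sub>E I A")
        case False
        then obtain i where "i \<in> I" "z i \<notin> A i" using z by (auto simp: space_PiM PiE_iff)
        then have "(\<Prod>i\<in>I. indicator (A i) (z i) :: ennreal) = 0" using I by (intro prod_zero bexI[of _ i]) auto
        then show ?thesis using False by simp
      next
        case True
        then have "(\<Prod>i\<in>I. indicator (A i) (z i) :: ennreal) = 1"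
          by (intro prod.neutral) (auto simp: PiE_iff)
        then show ?thesis using True by simp
      qed
      then show "(\<Prod>i\<in>I. l i (z i)) * indicator (Pi\<^sub>E I A) z = (\<Prod>i\<in>I. l i (z i) * indicator (A i) (z i))"
        by (simp add: prod.distrib)
    qed
    also have "\<dots> = (\<Prod>i\<in>I. \<integral>\<^sup>+x. l i x * indicator (A i) x \<partial>M i)"
      using I by (intro product_nn_integral_prod) auto
    also have "\<dots> = (\<Prod>i\<in>I. emeasure (density (M i) (l i)) (A i))"
      by (intro prod.cong refl) (simp add: emeasure_density[OF l A])
    finally show "emeasure (density (PiM I M) (\<lambda>z. \<Prod>i\<in>I. l i (z i))) (Pi\<^sub>E I A) =
      (\<Prod>i\<in>I. emeasure (density (M i) (l i)) (A i))" .
  qed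
  moreover have "distr (PiM I M) (PiM I M) (\<lambda>z. \<lambda>i\<in>I. T i (z i)) = PiM I (\<lambda>i. density (M i) (l i))"
    using distr_PiM_componentwise[OF I M T] by (simp add: eq)
  ultimately show ?thesis using I by (simp add: shift_density_def)
qed

text \<open>The density of the Gaussian with mean \<open>s\<close> relative to the centred one, both
  with standard deviation \<sigma>.\<close>

definition gauss_ratio :: "real \<Rightarrow> real \<Rightarrow> real \<Rightarrow> ennreal" where
  "gauss_ratio \<sigma> s x = ennreal (exp (s * x / \<sigma>\<^sup>2 - s\<^sup>2 / (2 * \<sigma>\<^sup>2)))"

lemma shift_density_gauss:
  assumes "\<sigma> > 0"
  shows "shift_density (gauss \<sigma>) (\<lambda>x. x + s) (gauss_ratio \<sigma> s)"
  unfolding shift_density_def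
proof (intro conjI measure_eqI)
  have [measurable]: "gauss_ratio \<sigma> s \<in> borel_measurable borel" unfolding gauss_ratio_def by measurable
  then show "gauss_ratio \<sigma> s \<in> borel_measurable (gauss \<sigma>)" by simp
  fix A assume "A \<in> sets (distr (gauss \<sigma>) (gauss \<sigma>) (\<lambda>x. x + s))"
  then have A[measurable]: "A \<in> sets borel" by simp
  have dens: "normal_density 0 \<sigma> (x - s) = normal_density 0 \<sigma> x * exp (s * x / \<sigma>\<^sup>2 - s\<^sup>2 / (2 * \<sigma>\<^sup>2))" for x
  proof -
    have "- ((x - s)\<^sup>2 / (2 * \<sigma>\<^sup>2)) = - (x\<^sup>2 / (2 * \<sigma>\<^sup>2)) + (s * x / \<sigma>\<^sup>2 - s\<^sup>2 / (2 * \<sigma>\<^sup>2))"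
      using assms by (simp add: field_simps power2_eq_square)
    then show ?thesis by (simp add: normal_density_def exp_add[symmetric])
  qed
  have "emeasure (distr (gauss \<sigma>) (gauss \<sigma>) (\<lambda>x. x + s)) A = (\<integral>\<^sup>+x. indicator A x \<partial>distr (gauss \<sigma>) (gauss \<sigma>) (\<lambda>x. x + s))"
    by simp
  also have "\<dots> = (\<integral>\<^sup>+x. indicator A (x + s) \<partial>gauss \<sigma>)" by (intro nn_integral_distr) auto
  also have "\<dots> = (\<integral>\<^sup>+x. ennreal (normal_density 0 \<sigma> x) * indicator A (x + s) \<partial>lborel)"
    by (intro nn_integral_density) auto
  also have "\<dots> = (\<integral>\<^sup>+x. ennreal (normal_density 0 \<sigma> (- s + 1 * x)) * indicator A (- s + 1 * x + s) \<partial>lborel)"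
    by (subst nn_integral_real_affine[where c = 1 and t = "- s"]) auto
  also have "\<dots> = (\<integral>\<^sup>+x. ennreal (normal_density 0 \<sigma> x) * (gauss_ratio \<sigma> s x * indicator A x) \<partial>lborel)"
    by (intro nn_integral_cong) (simp add: dens gauss_ratio_def ennreal_mult mult.assoc)
  also have "\<dots> = (\<integral>\<^sup>+x. gauss_ratio \<sigma> s x * indicator A x \<partial>gauss \<sigma>)"
    by (intro nn_integral_density[symmetric]) auto
  also have "\<dots> = emeasure (density (gauss \<sigma>) (gauss_ratio \<sigma> s)) A"
    by (intro emeasure_density[symmetric]) auto
  finally show "emeasure (distr (gauss \<sigma>) (gauss \<sigma>) (\<lambda>x. x + s)) A = emeasure (density (gauss \<sigma>) (gauss_ratio \<sigma> s)) A" .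
qed auto

text \<open>The square terms produced by the tilt cancel the two normalisations, leaving only the
  cross term of the shifts. This is how the second moment becomes the exponential of an inner
  product of signals.\<close>

lemma gauss_ratio_product:
  assumes "\<sigma> > 0"
  shows "(\<integral>\<^sup>+x. gauss_ratio \<sigma> s x * gauss_ratio \<sigma> s' x \<partial>gauss \<sigma>) = ennreal (exp (s * s' / \<sigma>\<^sup>2))"
proof -
  have "gauss_ratio \<sigma> s x * gauss_ratio \<sigma> s' x =
      ennreal (exp (- (s\<^sup>2 + s'\<^sup>2) / (2 * \<sigma>\<^sup>2))) * ennreal (exp ((s + s') / \<sigma>\<^sup>2 * x))" for x
  proof -
    have "(s * x / \<sigma>\<^sup>2 - s\<^sup>2 / (2 * \<sigma>\<^sup>2)) + (s' * x / \<sigma>\<^sup>2 - s'\<^sup>2 / (2 * \<sigma>\<^sup>2)) = - (s\<^sup>2 + s'\<^sup>2) / (2 * \<sigma>\<^sup>2) + (s + s') / \<sigma>\<^sup>2 * x"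
      by (simp add: add_divide_distrib diff_divide_distrib distrib_right)
    then show ?thesis by (simp add: gauss_ratio_def ennreal_mult[symmetric] exp_add[symmetric])
  qed
  then have "(\<integral>\<^sup>+x. gauss_ratio \<sigma> s x * gauss_ratio \<sigma> s' x \<partial>gauss \<sigma>) =
      ennreal (exp (- (s\<^sup>2 + s'\<^sup>2) / (2 * \<sigma>\<^sup>2))) * (\<integral>\<^sup>+x. ennreal (exp ((s + s') / \<sigma>\<^sup>2 * x)) \<partial>gauss \<sigma>)"
    by (simp add: nn_integral_cmult)
  also have "\<dots> = ennreal (exp (- (s\<^sup>2 + s'\<^sup>2) / (2 * \<sigma>\<^sup>2) + \<sigma>\<^sup>2 * ((s + s') / \<sigma>\<^sup>2)\<^sup>2 / 2))"
    unfolding gauss_exp_linear[OF assms] by (simp add: ennreal_mult[symmetric] exp_add[symmetric])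
  also have "- (s\<^sup>2 + s'\<^sup>2) / (2 * \<sigma>\<^sup>2) + \<sigma>\<^sup>2 * ((s + s') / \<sigma>\<^sup>2)\<^sup>2 / 2 = s * s' / \<sigma>\<^sup>2"
    using assms by (simp add: field_simps power2_eq_square)
  finally show ?thesis .
qed

section \<open>Real coordinates of the noise matrices\<close>

definition coord_sd :: "rep_kind \<Rightarrow> nat \<times> nat \<times> nat \<Rightarrow> real" where
  "coord_sd t = (\<lambda>(p, q, c). if p = q then sqrt (2 / beta t) else sqrt (1 / beta t))"

definition coord_set :: "rep_kind \<Rightarrow> nat \<Rightarrow> (nat \<times> nat \<times> nat) set" where
  "coord_set t N = {(p, q, c). p \<le> q \<and> q < N \<and> c < beta t \<and> (p = q \<longrightarrow> c = 0)}"

lemma beta_pos: "beta t > 0"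
  by (cases t) auto

lemma coord_sd_pos: "coord_sd t j > 0"
  using beta_pos[of t] by (auto simp: coord_sd_def split: prod.splits)

lemma finite_coord_set: "finite (coord_set t N)"
  by (rule finite_subset[of _ "{..<N} \<times> {..<N} \<times> {..<beta t}"]) (auto simp: coord_set_def)

lemma gaussian_coords_eq: "gaussian_coords t N = PiM (coord_set t N) (\<lambda>j. gauss (coord_sd t j))"
  unfolding gaussian_coords_def coord_set_def coord_sd_def
  by (intro PiM_cong refl) (auto split: prod.splits)

lemma prob_space_gauss: "\<sigma> > 0 \<Longrightarrow> prob_space (gauss \<sigma>)"
  by (rule prob_space_normal_density)

lemma prob_space_gaussian_coords: "prob_space (gaussian_coords t N)"
  unfolding gaussian_coords_eq by (intro prob_space_PiM prob_space_gauss coord_sd_pos)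

definition coord_shift :: "rep_kind \<Rightarrow> nat \<Rightarrow> (nat \<times> nat \<times> nat \<Rightarrow> real) \<Rightarrow> (nat \<times> nat \<times> nat \<Rightarrow> real) \<Rightarrow> (nat \<times> nat \<times> nat \<Rightarrow> real)" where
  "coord_shift t N s z = (\<lambda>j\<in>coord_set t N. z j + s j)"

definition coord_ratio :: "rep_kind \<Rightarrow> nat \<Rightarrow> (nat \<times> nat \<times> nat \<Rightarrow> real) \<Rightarrow> (nat \<times> nat \<times> nat \<Rightarrow> real) \<Rightarrow> ennreal" where
  "coord_ratio t N s z = (\<Prod>j\<in>coord_set t N. gauss_ratio (coord_sd t j) (s j) (z j))"

lemma shift_density_coords: "shift_density (gaussian_coords t N) (coord_shift t N s) (coord_ratio t N s)"
  unfolding gaussian_coords_eq coord_shift_def[abs_def] coord_ratio_def[abs_def]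
  by (intro shift_density_PiM finite_coord_set prob_space_gauss shift_density_gauss coord_sd_pos)

lemma coord_ratio_product:
  "(\<integral>\<^sup>+z. coord_ratio t N s z * coord_ratio t N s' z \<partial>gaussian_coords t N) =
   ennreal (exp (\<Sum>j\<in>coord_set t N. s j * s' j / (coord_sd t j)\<^sup>2))"
proof -
  interpret product_sigma_finite "\<lambda>j. gauss (coord_sd t j)"
    by (intro product_sigma_finite.intro prob_space_imp_sigma_finite prob_space_gauss coord_sd_pos)
  have [measurable]: "gauss_ratio \<sigma> s \<in> borel_measurable borel" for \<sigma> s unfolding gauss_ratio_def by measurable
  have "(\<integral>\<^sup>+z. coord_ratio t N s z * coord_ratio t N s' z \<partial>gaussian_coords t N) =
    (\<Prod>j\<in>coord_set t N. \<integral>\<^sup>+x. gauss_ratio (coord_sd t j) (s j) x * gauss_ratio (coord_sd t j) (s' j) x \<partial>gauss (coord_sd t j))"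
    unfolding coord_ratio_def gaussian_coords_eq prod.distrib[symmetric]
    by (intro product_nn_integral_prod finite_coord_set) auto
  also have "\<dots> = ennreal (exp (\<Sum>j\<in>coord_set t N. s j * s' j / (coord_sd t j)\<^sup>2))"
    unfolding gauss_ratio_product[OF coord_sd_pos] using finite_coord_set by (simp add: prod_ennreal exp_sum)
  finally show ?thesis .
qed

section \<open>Matrices over the three division algebras\<close>

definition embed_entry :: "rep_kind \<Rightarrow> (nat \<Rightarrow> nat \<Rightarrow> nat \<Rightarrow> real) \<Rightarrow> nat \<Rightarrow> nat \<Rightarrow> complex" where
  "embed_entry t f i j = (case t of Real_Type \<Rightarrow> of_real (f i j 0)
     | Complex_Type \<Rightarrow> Complex (f i j 0) (f i j 1)
     | Quaternionic_Type \<Rightarrow> quat_block (f (i div 2) (j div 2)) (i mod 2) (j mod 2))"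

lemma embed_mat_eq:
  "embed_mat t N f = Matrix.mat (embed_dim t N) (embed_dim t N) (\<lambda>(i, j). embed_entry t f i j)"
  by (cases t) (auto simp: embed_entry_def intro!: eq_matI simp del: quat_block.simps)

lemma embed_mat_carrier: "embed_mat t N f \<in> carrier_mat (embed_dim t N) (embed_dim t N)"
  by (simp add: embed_mat_eq)

lemma embed_mat_index: "i < embed_dim t N \<Longrightarrow> j < embed_dim t N \<Longrightarrow> embed_mat t N f $$ (i, j) = embed_entry t f i j"
  by (simp add: embed_mat_eq)

lemma embed_entry_linear:
  "embed_entry t (\<lambda>p q c. f p q c + r * f' p q c) i j = embed_entry t f i j + of_real r * embed_entry t f' i j"
  by (cases t) (simp_all add: embed_entry_def complex_eq_iff)

lemma embed_mat_cong:
  assumes "\<And>p q c. p < N \<Longrightarrow> q < N \<Longrightarrow> c < beta t \<Longrightarrow> f p q c = f' p q c"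
  shows "embed_mat t N f = embed_mat t N f'"
  using assms by (cases t) (auto simp: embed_mat_eq embed_entry_def less_mult_imp_div_less mult.commute intro!: eq_matI)

lemma embed_dim_mult: "embed_dim t (n * d) = n * embed_dim t d"
  by (cases t) simp_all

lemma embed_dim_pos: "embed_dim t d > 0 \<Longrightarrow> d > 0"
  by (cases t) simp_all

text \<open>A quaternionic 2 x 2 block never straddles two group blocks: dividing by 2 and then by
  \<open>d\<close> is dividing by \<open>D = 2 * d\<close>. So embedding commutes with cutting into
  group blocks.\<close>

lemma embed_entry_block:
  assumes "D = embed_dim t d"
  shows "embed_entry t (\<lambda>P Q c. F (P div d) (Q div d) (P mod d) (Q mod d) c) i j =
    embed_entry t (F (i div D) (j div D)) (i mod D) (j mod D)"
proof (cases t)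
  case Quaternionic_Type
  have D: "D = 2 * d" using assms Quaternionic_Type by simp
  have "k div 2 div d = k div D" "k div 2 mod d = k mod D div 2" "k mod 2 = k mod D mod 2" for k
    unfolding D by (simp_all add: div_mult2_eq mod_mult2_eq)
  then show ?thesis using Quaternionic_Type by (simp add: embed_entry_def del: quat_block.simps)
qed (use assms in \<open>simp_all add: embed_entry_def\<close>)

text \<open>The embedding is injective on coordinates, so Hermitian symmetry of complex entries
  forces the symmetry built into \<open>hermitian_coords\<close>. For quaternions, entry (2p, 2q)
  controls coordinates 0 and 1, and entry (2p, 2q + 1) coordinates 2 and 3.\<close>

lemma hermitian_embedE:
  assumes herm: "\<And>i j. i < embed_dim t N \<Longrightarrow> j < embed_dim t N \<Longrightarrow> embed_entry t f j i = cnj (embed_entry t f i j)"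
    and pq: "p < N" "q < N" "c < beta t"
  shows "hermitian_coords (\<lambda>(p, q, c). f p q c) p q c = f p q c"
proof -
  have sym: "f q p 0 = f p q 0 \<and> (\<forall>c. 0 < c \<and> c < beta t \<longrightarrow> f q p c = - f p q c)" if pq: "p < N" "q < N" for p q
  proof (cases t)
    case Real_Type
    then show ?thesis using herm[of p q] pq by (auto simp: embed_entry_def)
  next
    case Complex_Type
    have *: "f q p 0 = f p q 0" "f q p 1 = - f p q 1"
      using herm[of p q] pq Complex_Type by (auto simp: embed_entry_def complex_eq_iff)
    have "f q p c = - f p q c" if "0 < c" "c < 2" for c
    proof -
      have "c = 1" using that by simp
      then show ?thesis using * by simp
    qed
    then show ?thesis using * Complex_Type by simp
  next
    case Quaternionic_Type
    have *: "f q p 0 = f p q 0" "f q p 1 = - f p q 1"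
      using herm[of "2 * p" "2 * q"] pq Quaternionic_Type by (auto simp: embed_entry_def complex_eq_iff)
    have **: "f q p 2 = - f p q 2" "f q p 3 = - f p q 3"
      using herm[of "2 * p" "2 * q + 1"] pq Quaternionic_Type by (auto simp: embed_entry_def complex_eq_iff)
    have "f q p c = - f p q c" if "0 < c" "c < 4" for c
    proof -
      have "c = 1 \<or> c = 2 \<or> c = 3" using that by arith
      then show ?thesis using * ** by (elim disjE) simp_all
    qed
    then show ?thesis using * Quaternionic_Type by simp
  qed
  show ?thesis
    using sym[OF pq(1,2)] pq(3) sym[OF pq(1) pq(1)] by (cases p q rule: linorder_cases) (auto simp: hermitian_coords_def)
qed

lemma hermitian_coords_linear:
  "hermitian_coords (\<lambda>j. z j + r * z' j) p q c = hermitian_coords z p q c + r * hermitian_coords z' p q c"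
  by (auto simp: hermitian_coords_def algebra_simps)

lemma hermitian_coords_cong:
  assumes "\<And>j. j \<in> coord_set t N \<Longrightarrow> z j = z' j" "p < N" "q < N" "c < beta t"
  shows "hermitian_coords z p q c = hermitian_coords z' p q c"
  using assms by (auto simp: hermitian_coords_def coord_set_def)

lemma sum_blocks: "(\<Sum>i<n * k. f i) = (\<Sum>u<n. \<Sum>r<k. f (u * k + r))" for f :: "nat \<Rightarrow> 'a :: comm_monoid_add"
proof -
  have "sum f {u * k..<u * k + k} = (\<Sum>r<k. f (u * k + r))" for u
    using sum.shift_bounds_nat_ivl[of f 0 "u * k" k] by (simp add: lessThan_atLeast0 add.commute)
  then show ?thesis by (simp flip: sum.nat_group)
qed

lemma sum_rotate:
  "(\<Sum>j\<in>J. \<Sum>a\<in>A. \<Sum>b\<in>B. h j a b) = (\<Sum>a\<in>A. \<Sum>b\<in>B. \<Sum>j\<in>J. h j a b)"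
proof -
  have "(\<Sum>j\<in>J. \<Sum>a\<in>A. \<Sum>b\<in>B. h j a b) = (\<Sum>a\<in>A. \<Sum>j\<in>J. \<Sum>b\<in>B. h j a b)" by (rule sum.swap)
  also have "\<dots> = (\<Sum>a\<in>A. \<Sum>b\<in>B. \<Sum>j\<in>J. h j a b)" by (rule sum.cong[OF refl], rule sum.swap)
  finally show ?thesis .
qed

text \<open>The 2 x 2 block of a quaternion has squared Frobenius norm twice the squared norm of the
  quaternion.\<close>

definition embed_mult :: "rep_kind \<Rightarrow> real" where
  "embed_mult t = (if t = Quaternionic_Type then 2 else 1)"

lemma embed_inner:
  "(\<Sum>i<embed_dim t N. \<Sum>j<embed_dim t N. Re (embed_entry t f i j * cnj (embed_entry t f' i j))) =
   embed_mult t * (\<Sum>p<N. \<Sum>q<N. \<Sum>c<beta t. f p q c * f' p q c)"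
proof (cases t)
  case Quaternionic_Type
  have two: "(\<Sum>r<2. g r) = g 0 + g 1" for g :: "nat \<Rightarrow> real" by (simp add: numeral_2_eq_2)
  have four: "(\<Sum>r<4. g r) = g 0 + g 1 + g 2 + g 3" for g :: "nat \<Rightarrow> real" by (simp add: numeral_eq_Suc)
  have "(\<Sum>i<N * 2. \<Sum>j<N * 2. Re (embed_entry t f i j * cnj (embed_entry t f' i j))) =
      (\<Sum>p<N. \<Sum>q<N. \<Sum>a<2. \<Sum>b<2. Re (embed_entry t f (p * 2 + a) (q * 2 + b) * cnj (embed_entry t f' (p * 2 + a) (q * 2 + b))))"
    unfolding sum_blocks by (rule sum.cong[OF refl], rule sum.swap)
  also have "\<dots> = (\<Sum>p<N. \<Sum>q<N. 2 * (\<Sum>c<4. f p q c * f' p q c))"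
    by (intro sum.cong refl) (simp add: two four embed_entry_def Quaternionic_Type)
  finally show ?thesis
    using Quaternionic_Type by (simp add: embed_mult_def sum_distrib_left mult.commute[of N])
qed (simp_all add: embed_entry_def embed_mult_def numeral_2_eq_2)

text \<open>The diagonal variance 2/\<beta> is twice the off-diagonal one. This matches the sum over
  the full matrix, where each off-diagonal pair is counted twice and the diagonal once, so a single
  factor \<beta>/2 serves for all entries.\<close>

lemma coord_inner:
  "(\<Sum>j\<in>coord_set t N. z j * z' j / (coord_sd t j)\<^sup>2) =
   beta t / 2 * (\<Sum>p<N. \<Sum>q<N. \<Sum>c<beta t. hermitian_coords z p q c * hermitian_coords z' p q c)"
proof -
  define T where "T p q = (\<Sum>c<beta t. hermitian_coords z p q c * hermitian_coords z' p q c)" for p q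
  define U where "U = {(p, q). p < q \<and> q < N}"
  define V where "V = {(p, q). q < p \<and> p < N}"
  define Dg where "Dg = (\<lambda>p. (p, p)) ` {..<N}"
  have fin: "finite U" "finite V" "finite Dg"
    by (auto simp: U_def V_def Dg_def intro: finite_subset[of _ "{..<N} \<times> {..<N}"])
  have sets: "{..<N} \<times> {..<N} = Dg \<union> (U \<union> V)" by (auto simp: U_def V_def Dg_def)
  have T0: "T p p = z (p, p, 0) * z' (p, p, 0)" for p
  proof -
    have "T p p = (\<Sum>c<beta t. if c = 0 then z (p, p, 0) * z' (p, p, 0) else 0)"
      unfolding T_def by (intro sum.cong refl) (simp add: hermitian_coords_def)
    then show ?thesis using beta_pos[of t] by simp
  qed
  have Tsym: "T q p = T p q" if "p < q" for p q
    using that unfolding T_def by (intro sum.cong refl) (simp add: hermitian_coords_def)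
  have TU: "T p q = (\<Sum>c<beta t. z (p, q, c) * z' (p, q, c))" if "p < q" for p q
    using that unfolding T_def by (intro sum.cong refl) (simp add: hermitian_coords_def)
  have "(\<Sum>p<N. \<Sum>q<N. T p q) = (\<Sum>(p, q)\<in>{..<N} \<times> {..<N}. T p q)" by (simp add: sum.cartesian_product)
  also have "\<dots> = (\<Sum>(p, q)\<in>Dg. T p q) + ((\<Sum>(p, q)\<in>U. T p q) + (\<Sum>(p, q)\<in>V. T p q))"
  proof -
    have "Dg \<inter> (U \<union> V) = {}" "U \<inter> V = {}" by (auto simp: U_def V_def Dg_def)
    then show ?thesis unfolding sets using fin by (simp add: sum.union_disjoint)
  qed
  also have "(\<Sum>(p, q)\<in>V. T p q) = (\<Sum>(p, q)\<in>U. T p q)"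
    by (rule sum.reindex_bij_witness[of _ "\<lambda>(p, q). (q, p)" "\<lambda>(p, q). (q, p)"]) (auto simp: U_def V_def intro: Tsym[symmetric])
  also have "(\<Sum>(p, q)\<in>Dg. T p q) = (\<Sum>p<N. z (p, p, 0) * z' (p, p, 0))"
    unfolding Dg_def by (subst sum.reindex) (auto simp: inj_on_def T0)
  finally have S: "(\<Sum>p<N. \<Sum>q<N. T p q) = (\<Sum>p<N. z (p, p, 0) * z' (p, p, 0)) + 2 * (\<Sum>(p, q)\<in>U. T p q)" by simp
  define D1 where "D1 = (\<lambda>p. (p, p, 0 :: nat)) ` {..<N}"
  define O1 where "O1 = (\<lambda>((p, q), c). (p, q, c)) ` (U \<times> {..<beta t})"
  have J: "coord_set t N = D1 \<union> O1"
  proof (rule Set.set_eqI)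
    fix j :: "nat \<times> nat \<times> nat"
    obtain p q c where j: "j = (p, q, c)" by (cases j)
    have "j \<in> D1 \<longleftrightarrow> p = q \<and> q < N \<and> c = 0" by (auto simp: D1_def j)
    moreover have "j \<in> O1 \<longleftrightarrow> p < q \<and> q < N \<and> c < beta t" by (auto simp: O1_def U_def j image_iff)
    ultimately show "j \<in> coord_set t N \<longleftrightarrow> j \<in> D1 \<union> O1"
      using beta_pos[of t] by (auto simp: coord_set_def j)
  qed
  have "(\<Sum>j\<in>coord_set t N. z j * z' j / (coord_sd t j)\<^sup>2) =
      (\<Sum>j\<in>D1. z j * z' j / (coord_sd t j)\<^sup>2) + (\<Sum>j\<in>O1. z j * z' j / (coord_sd t j)\<^sup>2)"
    unfolding J using fin by (intro sum.union_disjoint) (auto simp: D1_def O1_def U_def)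
  also have "(\<Sum>j\<in>D1. z j * z' j / (coord_sd t j)\<^sup>2) = (\<Sum>p<N. beta t / 2 * (z (p, p, 0) * z' (p, p, 0)))"
    unfolding D1_def by (subst sum.reindex) (auto simp: inj_on_def coord_sd_def mult_ac)
  also have "(\<Sum>j\<in>O1. z j * z' j / (coord_sd t j)\<^sup>2) = (\<Sum>((p, q), c)\<in>U \<times> {..<beta t}. beta t * (z (p, q, c) * z' (p, q, c)))"
    unfolding O1_def by (subst sum.reindex) (auto simp: inj_on_def coord_sd_def U_def intro!: sum.cong)
  also have "\<dots> = (\<Sum>x\<in>U. \<Sum>c<beta t. case x of (p, q) \<Rightarrow> beta t * (z (p, q, c) * z' (p, q, c)))"
    by (simp add: sum.cartesian_product split_def)
  also have "\<dots> = (\<Sum>(p, q)\<in>U. beta t * T p q)"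
    by (intro sum.cong refl) (auto simp: TU U_def sum_distrib_left)
  also have "\<dots> = beta t * (\<Sum>(p, q)\<in>U. T p q)" by (simp add: sum_distrib_left split_def)
  also have "(\<Sum>p<N. beta t / 2 * (z (p, p, 0) * z' (p, p, 0))) = beta t / 2 * (\<Sum>p<N. z (p, p, 0) * z' (p, p, 0))"
    by (simp add: sum_distrib_left)
  finally show ?thesis
    unfolding T_def[symmetric] S by (simp add: distrib_left)
qed

section \<open>The signal\<close>

context finite_group
begin

lemma frequencyD:
  assumes "frequency G \<rho>"
  shows "irreducible_rep G \<rho>" "unitary_rep G \<rho>" "is_rep G (deg \<rho>) \<rho>" "deg \<rho> > 0"
    "rep_over (rep_type G \<rho>) (rep_dim G \<rho>) G \<rho>"
    "embed_dim (rep_type G \<rho>) (rep_dim G \<rho>) = deg \<rho>" "rep_dim G \<rho> > 0"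
proof -
  show 1: "irreducible_rep G \<rho>" "unitary_rep G \<rho>" and ov: "rep_over (rep_type G \<rho>) (rep_dim G \<rho>) G \<rho>"
    using assms by (auto simp: frequency_def)
  show "is_rep G (deg \<rho>) \<rho>" "deg \<rho> > 0" using irreducible_is_rep irreducible_deg_pos 1 by auto
  from ov obtain f where "\<rho> \<one>\<^bsub>G\<^esub> = embed_mat (rep_type G \<rho>) (rep_dim G \<rho>) f"
    unfolding rep_over_def using one_closed by blast
  then show e: "embed_dim (rep_type G \<rho>) (rep_dim G \<rho>) = deg \<rho>"
    by (simp add: rep_degree_def embed_mat_eq)
  show "rep_dim G \<rho> > 0" using \<open>deg \<rho> > 0\<close> unfolding e[symmetric] by (rule embed_dim_pos)
qed

definition gram :: "nat \<Rightarrow> ('g \<Rightarrow> complex mat) \<Rightarrow> (nat \<Rightarrow> 'g) \<Rightarrow> complex mat" where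
  "gram n \<rho> g = stack G n \<rho> g * mat_adjoint (stack G n \<rho> g)"

lemma stack_carrier: "stack G n \<rho> g \<in> carrier_mat (n * deg \<rho>) (deg \<rho>)"
  by (simp add: stack_def Let_def)

lemma gram_carrier: "gram n \<rho> g \<in> carrier_mat (n * deg \<rho>) (n * deg \<rho>)"
  unfolding gram_def by (rule mult_carrier_mat[OF stack_carrier mat_adjoint_carrier[OF stack_carrier]])

lemma gram_index:
  assumes "i < n * deg \<rho>" "j < n * deg \<rho>"
  shows "gram n \<rho> g $$ (i, j) =
    (\<Sum>a<deg \<rho>. \<rho> (g (i div deg \<rho>)) $$ (i mod deg \<rho>, a) * cnj (\<rho> (g (j div deg \<rho>)) $$ (j mod deg \<rho>, a)))"
  using assms stack_carrier[of n \<rho> g]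
  by (simp add: gram_def scalar_prod_def lessThan_atLeast0) (simp add: stack_def Let_def)

lemma gram_hermitian:
  assumes "i < n * deg \<rho>" "j < n * deg \<rho>"
  shows "gram n \<rho> g $$ (j, i) = cnj (gram n \<rho> g $$ (i, j))"
  using assms by (simp add: gram_index mult.commute)

text \<open>By unitarity the block at positions u, v of the Gram matrix is \<rho>(g u (g v)^-1), a
  matrix over the same division algebra as \<rho>. The real coordinates of the blocks are then glued
  together.\<close>

lemma gram_embed:
  assumes \<rho>: "frequency G \<rho>" and g: "g \<in> {..<n} \<rightarrow> carrier G"
  shows "\<exists>f. gram n \<rho> g = embed_mat (rep_type G \<rho>) (n * rep_dim G \<rho>) f"
proof -
  let ?t = "rep_type G \<rho>" and ?d = "rep_dim G \<rho>" and ?D = "deg \<rho>"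
  note \<rho>' = frequencyD[OF \<rho>]
  have "\<exists>f. u < n \<and> v < n \<longrightarrow> \<rho> (g u \<otimes>\<^bsub>G\<^esub> inv\<^bsub>G\<^esub> g v) = embed_mat ?t ?d f" for u v
    using \<rho>'(5) g unfolding rep_over_def by (metis PiE Pi_mem inv_closed lessThan_iff m_closed)
  then obtain F where F: "\<And>u v. u < n \<Longrightarrow> v < n \<Longrightarrow> \<rho> (g u \<otimes>\<^bsub>G\<^esub> inv\<^bsub>G\<^esub> g v) = embed_mat ?t ?d (F u v)"
    by metis
  define f where "f = (\<lambda>P Q c. F (P div ?d) (Q div ?d) (P mod ?d) (Q mod ?d) c)"
  have "gram n \<rho> g = embed_mat ?t (n * ?d) f"
  proof (rule eq_matI)
    fix i j assume "i < dim_row (embed_mat ?t (n * ?d) f)" "j < dim_col (embed_mat ?t (n * ?d) f)"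
    then have ij: "i < n * ?D" "j < n * ?D" by (simp_all add: embed_mat_eq embed_dim_mult \<rho>')
    then have uv: "i div ?D < n" "j div ?D < n" by (auto simp: less_mult_imp_div_less)
    have m: "i mod ?D < ?D" "j mod ?D < ?D" using \<rho>'(4) by auto
    have gu: "g (i div ?D) \<in> carrier G" "g (j div ?D) \<in> carrier G" using uv g by auto
    have "gram n \<rho> g $$ (i, j) = \<rho> (g (i div ?D) \<otimes>\<^bsub>G\<^esub> inv\<^bsub>G\<^esub> g (j div ?D)) $$ (i mod ?D, j mod ?D)"
      unfolding gram_index[OF ij] rep_mult_index[OF \<rho>'(3) gu(1) inv_closed[OF gu(2)] m]
      using unitary_inv_index[OF \<rho>'(3,2) gu(2) _ m(2)] by (intro sum.cong refl) auto
    also have "\<dots> = embed_entry ?t (F (i div ?D) (j div ?D)) (i mod ?D) (j mod ?D)"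
      using F[OF uv] m by (simp add: embed_mat_index \<rho>')
    also have "\<dots> = embed_entry ?t f i j"
      unfolding f_def by (rule embed_entry_block[symmetric]) (simp add: \<rho>')
    finally show "gram n \<rho> g $$ (i, j) = embed_mat ?t (n * ?d) f $$ (i, j)"
      using ij by (simp add: embed_mat_index embed_dim_mult \<rho>')
  qed (use gram_carrier[of n \<rho> g] in \<open>simp_all add: embed_mat_eq embed_dim_mult \<rho>'\<close>)
  then show ?thesis by blast
qed

text \<open>For stacked matrices X, X' the Frobenius inner product of the two Gram matrices is the
  squared norm of the small matrix X^* X', and by unitarity this is the sum of \<rho>(g u)^-1
  \<rho>(g' u) over the positions.\<close>

lemma gram_inner:
  assumes \<rho>: "is_rep G (deg \<rho>) \<rho>" "unitary_rep G \<rho>" "deg \<rho> > 0"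
    and g: "g \<in> {..<n} \<rightarrow> carrier G" "g' \<in> {..<n} \<rightarrow> carrier G"
  shows "(\<Sum>i<n * deg \<rho>. \<Sum>j<n * deg \<rho>. gram n \<rho> g $$ (i, j) * cnj (gram n \<rho> g' $$ (i, j))) =
    of_real (coeff_energy \<rho> n (\<lambda>u. inv\<^bsub>G\<^esub> g u \<otimes>\<^bsub>G\<^esub> g' u))"
proof -
  let ?D = "deg \<rho>"
  define x where "x i a = \<rho> (g (i div ?D)) $$ (i mod ?D, a)" for i a
  define y where "y i a = \<rho> (g' (i div ?D)) $$ (i mod ?D, a)" for i a
  \<comment> \<open>The entries of the adjoint of the first stack times the second stack.\<close>
  define B where "B a b = (\<Sum>i<n * ?D. cnj (x i a) * y i b)" for a b
  have B: "B a b = (\<Sum>u<n. \<rho> (inv\<^bsub>G\<^esub> g u \<otimes>\<^bsub>G\<^esub> g' u) $$ (a, b))" if ab: "a < ?D" "b < ?D" for a b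
  proof -
    have "B a b = (\<Sum>u<n. \<Sum>r<?D. cnj (\<rho> (g u) $$ (r, a)) * \<rho> (g' u) $$ (r, b))"
      unfolding B_def sum_blocks by (intro sum.cong refl) (simp add: x_def y_def)
    also have "\<dots> = (\<Sum>u<n. \<rho> (inv\<^bsub>G\<^esub> g u \<otimes>\<^bsub>G\<^esub> g' u) $$ (a, b))"
    proof (intro sum.cong refl)
      fix u assume "u \<in> {..<n}"
      then have gu: "g u \<in> carrier G" "g' u \<in> carrier G" using g by auto
      show "(\<Sum>r<?D. cnj (\<rho> (g u) $$ (r, a)) * \<rho> (g' u) $$ (r, b)) = \<rho> (inv\<^bsub>G\<^esub> g u \<otimes>\<^bsub>G\<^esub> g' u) $$ (a, b)"
        unfolding rep_mult_index[OF \<rho>(1) inv_closed[OF gu(1)] gu(2) ab]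
        using unitary_inv_index[OF \<rho>(1,2) gu(1) ab(1)] by (intro sum.cong refl) auto
    qed
    finally show ?thesis .
  qed
  have "(\<Sum>i<n * ?D. \<Sum>j<n * ?D. gram n \<rho> g $$ (i, j) * cnj (gram n \<rho> g' $$ (i, j))) =
      (\<Sum>i<n * ?D. \<Sum>j<n * ?D. \<Sum>a<?D. \<Sum>b<?D. cnj (cnj (x i a) * y i b) * (cnj (x j a) * y j b))"
    by (intro sum.cong refl)
      (simp add: gram_index x_def[symmetric] y_def[symmetric] sum_product mult_ac)
  also have "\<dots> = (\<Sum>i<n * ?D. \<Sum>a<?D. \<Sum>b<?D. \<Sum>j<n * ?D. cnj (cnj (x i a) * y i b) * (cnj (x j a) * y j b))"
    by (rule sum.cong[OF refl], rule sum_rotate)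
  also have "\<dots> = (\<Sum>a<?D. \<Sum>b<?D. \<Sum>i<n * ?D. \<Sum>j<n * ?D. cnj (cnj (x i a) * y i b) * (cnj (x j a) * y j b))"
    by (rule sum_rotate)
  also have "\<dots> = (\<Sum>a<?D. \<Sum>b<?D. cnj (B a b) * B a b)"
    unfolding B_def cnj_sum sum_product ..
  also have "\<dots> = (\<Sum>a<?D. \<Sum>b<?D. of_real ((cmod (B a b))\<^sup>2))"
    by (intro sum.cong refl) (simp add: complex_norm_square mult.commute del: of_real_power)
  also have "\<dots> = of_real (coeff_energy \<rho> n (\<lambda>u. inv\<^bsub>G\<^esub> g u \<otimes>\<^bsub>G\<^esub> g' u))"
    by (simp add: coeff_energy_def B del: of_real_power)
  finally show ?thesis .
qed

text \<open>The factors are 1 d / 1 for real, 2 d / 1 for complex and 4 d / 2 for quaternionic type,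
  where the complex degree is d, d and 2 d. These are the weights of
  \<open>frequencies_energy_le\<close>.\<close>

lemma rep_dim_scale:
  assumes "frequency G \<rho>"
  shows "beta (rep_type G \<rho>) * real (rep_dim G \<rho>) / embed_mult (rep_type G \<rho>) =
    (if rep_type G \<rho> = Complex_Type then 2 else 1) * real (deg \<rho>)"
  using frequencyD(6)[OF assms] by (cases "rep_type G \<rho>") (auto simp: embed_mult_def)

lemma observation_zero:
  assumes "W \<in> carrier_mat (n * deg \<rho>) (n * deg \<rho>)"
  shows "observation G n (\<lambda>_. 0) \<rho> g W = complex_of_real (1 / sqrt (real (n * rep_dim G \<rho>))) \<cdot>\<^sub>m W"
  using assms gram_carrier[of n \<rho> g] unfolding observation_def gram_def[symmetric]
  by (intro eq_matI) auto

text \<open>The signal is itself Hermitian over the division algebra, so it can be absorbed into the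
  noise coordinates. The inner product of two shifts is then assembled from
  \<open>coord_inner\<close>, \<open>embed_inner\<close>, \<open>gram_inner\<close> and
  \<open>rep_dim_scale\<close>.\<close>

lemma observation_as_shift:
  assumes \<rho>: "frequency G \<rho>" and n: "n > 0"
  shows "\<exists>s. \<forall>g\<in>{..<n} \<rightarrow> carrier G.
     (\<forall>z. observation G n lam \<rho> g (embed_mat (rep_type G \<rho>) (n * rep_dim G \<rho>) (hermitian_coords z)) =
        observation G n (\<lambda>_. 0) \<rho> g (embed_mat (rep_type G \<rho>) (n * rep_dim G \<rho>)
          (hermitian_coords (coord_shift (rep_type G \<rho>) (n * rep_dim G \<rho>) (s g) z)))) \<and>
     (\<forall>g'\<in>{..<n} \<rightarrow> carrier G.
        (\<Sum>j\<in>coord_set (rep_type G \<rho>) (n * rep_dim G \<rho>). s g j * s g' j / (coord_sd (rep_type G \<rho>) j)\<^sup>2) =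
        (lam \<rho>)\<^sup>2 / (2 * n) * ((if rep_type G \<rho> = Complex_Type then 2 else 1) *
          (real (deg \<rho>) * coeff_energy \<rho> n (\<lambda>u. inv\<^bsub>G\<^esub> g u \<otimes>\<^bsub>G\<^esub> g' u))))"
proof -
  let ?t = "rep_type G \<rho>" and ?d = "rep_dim G \<rho>" and ?D = "deg \<rho>"
  define N where "N = n * ?d"
  note \<rho>' = frequencyD[OF \<rho>]
  have dim: "embed_dim ?t N = n * ?D" by (simp add: N_def embed_dim_mult \<rho>')
  have N0: "N > 0" using n \<rho>'(7) by (simp add: N_def)
  have "\<exists>f. g \<in> {..<n} \<rightarrow> carrier G \<longrightarrow> gram n \<rho> g = embed_mat ?t N f" for g
    using gram_embed[OF \<rho>] by (auto simp: N_def)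
  then obtain F where F: "\<And>g. g \<in> {..<n} \<rightarrow> carrier G \<Longrightarrow> gram n \<rho> g = embed_mat ?t N (F g)" by metis
  \<comment> \<open>The factor \<open>sqrt (real N)\<close> undoes the noise scale 1 / sqrt(n
    d).\<close>
  define r where "r = sqrt (real N) * (lam \<rho> / n)"
  define s where "s g = (\<lambda>(p, q, c). r * F g p q c)" for g
  have Fherm: "hermitian_coords (\<lambda>(p, q, c). F g p q c) p q c = F g p q c"
    if g: "g \<in> {..<n} \<rightarrow> carrier G" and pq: "p < N" "q < N" "c < beta ?t" for g p q c
  proof (rule hermitian_embedE[OF _ pq])
    fix i j assume ij: "i < embed_dim ?t N" "j < embed_dim ?t N"
    show "embed_entry ?t (F g) j i = cnj (embed_entry ?t (F g) i j)"
      using gram_hermitian[of i n \<rho> j g] ij by (simp add: F[OF g] embed_mat_index dim)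
  qed
  \<comment> \<open>Shifting the coordinates of the upper triangle thus moves the entire matrix by
    \<open>r\<close> times the Gram matrix.\<close>
  have sherm: "hermitian_coords (s g) p q c = r * F g p q c"
    if g: "g \<in> {..<n} \<rightarrow> carrier G" and pq: "p < N" "q < N" "c < beta ?t" for g p q c
  proof -
    have "s g = (\<lambda>j. 0 + r * (\<lambda>(p, q, c). F g p q c) j)" by (auto simp: s_def)
    then have "hermitian_coords (s g) p q c = hermitian_coords (\<lambda>_. 0) p q c + r * hermitian_coords (\<lambda>(p, q, c). F g p q c) p q c"
      by (simp only: hermitian_coords_linear)
    then show ?thesis using Fherm[OF g pq] by (simp add: hermitian_coords_def)
  qed
  have 1: "observation G n lam \<rho> g (embed_mat ?t N (hermitian_coords z)) =
        observation G n (\<lambda>_. 0) \<rho> g (embed_mat ?t N (hermitian_coords (coord_shift ?t N (s g) z)))"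
    if g: "g \<in> {..<n} \<rightarrow> carrier G" for g z
  proof -
    have "embed_mat ?t N (hermitian_coords (coord_shift ?t N (s g) z)) =
        embed_mat ?t N (\<lambda>p q c. hermitian_coords z p q c + r * F g p q c)"
    proof (rule embed_mat_cong)
      fix p q c assume pq: "p < N" "q < N" "c < beta ?t"
      have "hermitian_coords (coord_shift ?t N (s g) z) p q c = hermitian_coords (\<lambda>j. z j + 1 * s g j) p q c"
        using pq by (intro hermitian_coords_cong[of ?t N]) (auto simp: coord_shift_def)
      then show "hermitian_coords (coord_shift ?t N (s g) z) p q c = hermitian_coords z p q c + r * F g p q c"
        unfolding hermitian_coords_linear sherm[OF g pq] by simp
    qed
    then have E: "embed_mat ?t N (hermitian_coords (coord_shift ?t N (s g) z)) $$ (i, j) =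
        embed_mat ?t N (hermitian_coords z) $$ (i, j) + of_real r * gram n \<rho> g $$ (i, j)"
      if "i < n * ?D" "j < n * ?D" for i j
      using that by (simp add: F[OF g] embed_mat_index dim embed_entry_linear)
    note c = embed_mat_carrier[of ?t N, unfolded dim]
    have r: "complex_of_real (1 / sqrt N) * of_real r = of_real (lam \<rho> / n)"
      unfolding of_real_mult[symmetric] using N0 by (simp add: r_def)
    show ?thesis
      unfolding observation_zero[OF c]
    proof (rule eq_matI)
      fix i j assume "i < dim_row (complex_of_real (1 / sqrt (real (n * ?d))) \<cdot>\<^sub>m embed_mat ?t N (hermitian_coords (coord_shift ?t N (s g) z)))"
        "j < dim_col (complex_of_real (1 / sqrt (real (n * ?d))) \<cdot>\<^sub>m embed_mat ?t N (hermitian_coords (coord_shift ?t N (s g) z)))"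
      then have ij: "i < n * ?D" "j < n * ?D" using carrier_matD[OF c] by auto
      have "observation G n lam \<rho> g (embed_mat ?t N (hermitian_coords z)) $$ (i, j) =
          of_real (lam \<rho> / n) * gram n \<rho> g $$ (i, j) + complex_of_real (1 / sqrt N) * embed_mat ?t N (hermitian_coords z) $$ (i, j)"
        using ij carrier_matD[OF c] carrier_matD[OF gram_carrier] by (simp add: observation_def gram_def[symmetric] N_def)
      also have "\<dots> = complex_of_real (1 / sqrt N) * (embed_mat ?t N (hermitian_coords z) $$ (i, j) + of_real r * gram n \<rho> g $$ (i, j))"
        unfolding r[symmetric] by (simp add: algebra_simps)
      finally show "observation G n lam \<rho> g (embed_mat ?t N (hermitian_coords z)) $$ (i, j) =
          (complex_of_real (1 / sqrt (real (n * ?d))) \<cdot>\<^sub>m embed_mat ?t N (hermitian_coords (coord_shift ?t N (s g) z))) $$ (i, j)"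
        using ij carrier_matD[OF c] E[OF ij] by (simp add: N_def)
    qed (use carrier_matD[OF c] carrier_matD[OF gram_carrier] in \<open>simp_all add: observation_def gram_def[symmetric]\<close>)
  qed
  have 2: "(\<Sum>j\<in>coord_set ?t N. s g j * s g' j / (coord_sd ?t j)\<^sup>2) =
        (lam \<rho>)\<^sup>2 / (2 * n) * ((if ?t = Complex_Type then 2 else 1) *
          (real ?D * coeff_energy \<rho> n (\<lambda>u. inv\<^bsub>G\<^esub> g u \<otimes>\<^bsub>G\<^esub> g' u)))"
    if g: "g \<in> {..<n} \<rightarrow> carrier G" "g' \<in> {..<n} \<rightarrow> carrier G" for g g'
  proof -
    define S where "S = (\<Sum>p<N. \<Sum>q<N. \<Sum>c<beta ?t. F g p q c * F g' p q c)"
    define E where "E = coeff_energy \<rho> n (\<lambda>u. inv\<^bsub>G\<^esub> g u \<otimes>\<^bsub>G\<^esub> g' u)"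
    have "(\<Sum>j\<in>coord_set ?t N. s g j * s g' j / (coord_sd ?t j)\<^sup>2) =
        beta ?t / 2 * (\<Sum>p<N. \<Sum>q<N. \<Sum>c<beta ?t. hermitian_coords (s g) p q c * hermitian_coords (s g') p q c)"
      by (rule coord_inner)
    also have "(\<Sum>p<N. \<Sum>q<N. \<Sum>c<beta ?t. hermitian_coords (s g) p q c * hermitian_coords (s g') p q c) = r\<^sup>2 * S"
      unfolding S_def sum_distrib_left
      by (intro sum.cong refl) (simp add: sherm[OF g(1)] sherm[OF g(2)] power2_eq_square)
    finally have lhs: "(\<Sum>j\<in>coord_set ?t N. s g j * s g' j / (coord_sd ?t j)\<^sup>2) = beta ?t / 2 * (r\<^sup>2 * S)" .
    have "embed_mult ?t * S = (\<Sum>i<n * ?D. \<Sum>j<n * ?D. Re (gram n \<rho> g $$ (i, j) * cnj (gram n \<rho> g' $$ (i, j))))"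
      unfolding S_def embed_inner[symmetric] dim
      by (intro sum.cong refl) (simp add: F[OF g(1)] F[OF g(2)] embed_mat_index dim)
    also have "\<dots> = Re (\<Sum>i<n * ?D. \<Sum>j<n * ?D. gram n \<rho> g $$ (i, j) * cnj (gram n \<rho> g' $$ (i, j)))"
      by simp
    also have "\<dots> = E" unfolding gram_inner[OF \<rho>'(3,2,4) g] E_def by simp
    finally have S: "S = E / embed_mult ?t" by (auto simp: embed_mult_def)
    have r2: "r\<^sup>2 = real ?d * (lam \<rho>)\<^sup>2 / n"
    proof -
      have "r\<^sup>2 = real N * (lam \<rho> / n)\<^sup>2" unfolding r_def power_mult_distrib by simp
      then show ?thesis using n by (simp add: N_def power2_eq_square field_simps)
    qed
    have "beta ?t / 2 * (r\<^sup>2 * S) = (lam \<rho>)\<^sup>2 / (2 * n) * (beta ?t * real ?d / embed_mult ?t) * E"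
      unfolding r2 S by (simp add: mult_ac)
    also have "\<dots> = (lam \<rho>)\<^sup>2 / (2 * n) * ((if ?t = Complex_Type then 2 else 1) * (real ?D * E))"
      unfolding rep_dim_scale[OF \<rho>] by simp
    finally show ?thesis unfolding lhs E_def .
  qed
  show ?thesis
    unfolding N_def[symmetric] by (intro exI[of _ s] ballI conjI allI 1 2)
qed

end

section \<open>The model as a mixture of shifted Gaussians\<close>

lemma space_mat_borel: "space (mat_borel N) = carrier_mat N N"
  by (simp add: mat_borel_def)

lemma measurable_mat_borelI:
  assumes "\<And>x. x \<in> space M \<Longrightarrow> f x \<in> carrier_mat N N"
    and "\<And>i j. i < N \<Longrightarrow> j < N \<Longrightarrow> (\<lambda>x. f x $$ (i, j)) \<in> borel_measurable M"
  shows "f \<in> M \<rightarrow>\<^sub>M mat_borel N"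
  unfolding mat_borel_def
proof (rule measurable_vimage_algebra2)
  have "(\<lambda>x. \<lambda>ij\<in>{..<N} \<times> {..<N}. f x $$ ij) \<in> M \<rightarrow>\<^sub>M (\<Pi>\<^sub>M ij\<in>{..<N} \<times> {..<N}. borel)"
  proof (rule measurable_restrict)
    fix ij assume "ij \<in> {..<N} \<times> {..<N}"
    then show "(\<lambda>x. f x $$ ij) \<in> borel_measurable M" using assms(2)[of "fst ij" "snd ij"] by (cases ij) simp
  qed
  moreover have "(\<lambda>(i, j). f x $$ (i, j)) = (\<lambda>ij. f x $$ ij)" for x by (simp add: fun_eq_iff)
  ultimately show "(\<lambda>x. \<lambda>(i, j)\<in>{..<N} \<times> {..<N}. f x $$ (i, j)) \<in> M \<rightarrow>\<^sub>M (\<Pi>\<^sub>M ij\<in>{..<N} \<times> {..<N}. borel)"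
    by simp
  show "f \<in> space M \<rightarrow> carrier_mat N N" using assms(1) by blast
qed

lemma measurable_mat_index:
  assumes "i < N" "j < N"
  shows "(\<lambda>A. A $$ (i, j)) \<in> borel_measurable (mat_borel N)"
proof -
  have "(\<lambda>A. \<lambda>(i, j)\<in>{..<N} \<times> {..<N}. A $$ (i, j)) \<in> mat_borel N \<rightarrow>\<^sub>M (\<Pi>\<^sub>M ij\<in>{..<N} \<times> {..<N}. (borel :: complex measure))"
    unfolding mat_borel_def by (rule measurable_vimage_algebra1) (auto simp: space_PiM)
  moreover have "(\<lambda>f. f (i, j)) \<in> (\<Pi>\<^sub>M ij\<in>{..<N} \<times> {..<N}. (borel :: complex measure)) \<rightarrow>\<^sub>M borel"
    using assms by (intro measurable_component_singleton) auto
  ultimately have "(\<lambda>A. (\<lambda>(i, j)\<in>{..<N} \<times> {..<N}. A $$ (i, j)) (i, j)) \<in> borel_measurable (mat_borel N)"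
    by (rule measurable_compose)
  then show ?thesis using assms by simp
qed

lemma borel_measurable_Complex:
  assumes "f \<in> borel_measurable M" "g \<in> borel_measurable M"
  shows "(\<lambda>x. Complex (f x) (g x)) \<in> borel_measurable M"
  using assms unfolding Complex_eq by measurable

lemma measurable_coord:
  "j \<in> coord_set t N \<Longrightarrow> (\<lambda>z. z j) \<in> borel_measurable (gaussian_coords t N)"
  unfolding gaussian_coords_eq using measurable_component_singleton[of j "coord_set t N" "\<lambda>j. gauss (coord_sd t j)"] by simp

lemma measurable_hermitian_coords:
  assumes "p < N" "q < N" "c < beta t"
  shows "(\<lambda>z. hermitian_coords z p q c) \<in> borel_measurable (gaussian_coords t N)"
proof -
  have "(p, q, c) \<in> coord_set t N" if "p < q" using assms that by (auto simp: coord_set_def)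
  moreover have "(q, p, c') \<in> coord_set t N" if "q < p" "c' \<le> c" for c' using assms that by (auto simp: coord_set_def)
  moreover have "(p, p, 0) \<in> coord_set t N" using assms by (auto simp: coord_set_def)
  ultimately show ?thesis
    unfolding hermitian_coords_def
    by (cases p q rule: linorder_cases; cases "c = 0") (auto intro!: measurable_coord borel_measurable_uminus)
qed

lemma measurable_embed_hermitian:
  "(\<lambda>z. embed_mat t N (hermitian_coords z)) \<in> gaussian_coords t N \<rightarrow>\<^sub>M mat_borel (embed_dim t N)"
proof (rule measurable_mat_borelI)
  show "embed_mat t N (hermitian_coords z) \<in> carrier_mat (embed_dim t N) (embed_dim t N)" for z
    by (rule embed_mat_carrier)
  fix i j assume ij: "i < embed_dim t N" "j < embed_dim t N"
  have "(\<lambda>z. embed_entry t (hermitian_coords z) i j) \<in> borel_measurable (gaussian_coords t N)"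
  proof (cases t)
    case Real_Type
    then show ?thesis using ij measurable_hermitian_coords[of i N j 0 t] unfolding embed_entry_def by simp
  next
    case Complex_Type
    then show ?thesis
      using ij measurable_hermitian_coords[of i N j 0 t] measurable_hermitian_coords[of i N j 1 t]
      unfolding embed_entry_def by (simp add: borel_measurable_Complex)
  next
    case Quaternionic_Type
    then have "i div 2 < N" "j div 2 < N" using ij by auto
    then have "(\<lambda>z. hermitian_coords z (i div 2) (j div 2) c) \<in> borel_measurable (gaussian_coords t N)" if "c < 4" for c
      using that Quaternionic_Type by (intro measurable_hermitian_coords) auto
    note m = this[unfolded Quaternionic_Type]
    show ?thesis
      using Quaternionic_Type
      by (cases "i mod 2 = 0"; cases "j mod 2 = 0")
        (auto simp: embed_entry_def intro!: borel_measurable_Complex borel_measurable_uminus m)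
  qed
  then show "(\<lambda>z. embed_mat t N (hermitian_coords z) $$ (i, j)) \<in> borel_measurable (gaussian_coords t N)"
    using ij by (simp add: embed_mat_index)
qed

lemma prob_space_gaussian_ensemble: "prob_space (gaussian_ensemble t N)"
  unfolding gaussian_ensemble_def
  by (intro prob_space.prob_space_distr prob_space_gaussian_coords measurable_embed_hermitian)

lemma sets_gaussian_ensemble: "sets (gaussian_ensemble t N) = sets (mat_borel (embed_dim t N))"
  by (simp add: gaussian_ensemble_def)

lemma PiM_uniform_count_measure:
  assumes I: "finite I" and A: "finite A" "A \<noteq> {}"
  shows "PiM I (\<lambda>_. uniform_count_measure A) = uniform_count_measure (I \<rightarrow>\<^sub>E A)"
proof (rule PiM_box_eqI[symmetric, OF I])
  show "prob_space (uniform_count_measure A)" by (intro prob_space_uniform_count_measure A)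
  have "sets (PiM I (\<lambda>_. uniform_count_measure A)) = sets (PiM I (\<lambda>_. count_space A))"
    by (intro sets_PiM_cong) (auto simp: sets_uniform_count_measure)
  also have "PiM I (\<lambda>_. count_space A) = count_space (I \<rightarrow>\<^sub>E A)"
    using I A by (intro count_space_PiM_finite) (auto intro: countable_finite)
  finally show "sets (uniform_count_measure (I \<rightarrow>\<^sub>E A)) = sets (PiM I (\<lambda>_. uniform_count_measure A))"
    by (simp add: sets_uniform_count_measure)
  fix B assume "\<And>i. i \<in> I \<Longrightarrow> B i \<in> sets (uniform_count_measure A)"
  then have B: "\<And>i. i \<in> I \<Longrightarrow> B i \<subseteq> A" by (auto simp: sets_uniform_count_measure)
  have "Pi\<^sub>E I B \<subseteq> (I \<rightarrow>\<^sub>E A)" using B by (auto simp: PiE_iff)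
  then have "emeasure (uniform_count_measure (I \<rightarrow>\<^sub>E A)) (Pi\<^sub>E I B) = ennreal (card (Pi\<^sub>E I B) / card (I \<rightarrow>\<^sub>E A))"
    using I A by (simp add: emeasure_uniform_count_measure finite_PiE)
  also have "card (Pi\<^sub>E I B) / real (card (I \<rightarrow>\<^sub>E A)) = (\<Prod>i\<in>I. card (B i) / card A)"
    using I by (simp add: card_PiE prod_dividef)
  also have "ennreal \<dots> = (\<Prod>i\<in>I. emeasure (uniform_count_measure A) (B i))"
    using A B by (simp add: prod_ennreal[symmetric] emeasure_uniform_count_measure)
  finally show "emeasure (uniform_count_measure (I \<rightarrow>\<^sub>E A)) (Pi\<^sub>E I B) = (\<Prod>i\<in>I. emeasure (uniform_count_measure A) (B i))" .
qed

section \<open>The second moment method\<close>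

text \<open>\<open>f\<close> is the likelihood ratio of the mixture with weights \<open>a\<close>.
  The probability of \<open>B\<close> under the mixture is the integral of \<open>f\<close> over
  \<open>B\<close>, and Cauchy-Schwarz separates the second moment of \<open>f\<close> from the null
  probability of \<open>B\<close>.\<close>

lemma second_moment_bound:
  assumes W: "finite W" and sd: "\<And>g. g \<in> W \<Longrightarrow> shift_density M (T g) (l g)" and B: "B \<in> sets M"
  shows "(\<Sum>g\<in>W. ennreal a * emeasure M (T g -` B \<inter> space M))\<^sup>2 \<le>
    (\<Sum>g\<in>W. \<Sum>g'\<in>W. ennreal a * ennreal a * (\<integral>\<^sup>+z. l g z * l g' z \<partial>M)) * emeasure M B"
proof -
  note B[measurable]
  have T[measurable]: "T g \<in> M \<rightarrow>\<^sub>M M" and l[measurable]: "l g \<in> borel_measurable M"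
    and eq: "distr M M (T g) = density M (l g)" if "g \<in> W" for g
    using sd[OF that] by (auto simp: shift_density_def)
  define f where "f z = (\<Sum>g\<in>W. ennreal a * l g z)" for z
  have f[measurable]: "f \<in> borel_measurable M" unfolding f_def by measurable
  have "(\<Sum>g\<in>W. ennreal a * emeasure M (T g -` B \<inter> space M)) = (\<Sum>g\<in>W. ennreal a * (\<integral>\<^sup>+z. l g z * indicator B z \<partial>M))"
  proof (intro sum.cong refl)
    fix g assume g: "g \<in> W"
    have "emeasure M (T g -` B \<inter> space M) = emeasure (distr M M (T g)) B"
      using T[OF g] B by (simp add: emeasure_distr)
    also have "\<dots> = (\<integral>\<^sup>+z. l g z * indicator B z \<partial>M)"
      unfolding eq[OF g] using l[OF g] B by (simp add: emeasure_density)
    finally show "ennreal a * emeasure M (T g -` B \<inter> space M) = ennreal a * (\<integral>\<^sup>+z. l g z * indicator B z \<partial>M)"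
      by simp
  qed
  also have "\<dots> = (\<Sum>g\<in>W. (\<integral>\<^sup>+z. ennreal a * (l g z * indicator B z) \<partial>M))"
    by (intro sum.cong refl nn_integral_cmult[symmetric]) measurable
  also have "\<dots> = (\<integral>\<^sup>+z. (\<Sum>g\<in>W. ennreal a * (l g z * indicator B z)) \<partial>M)"
    by (intro nn_integral_sum[symmetric]) measurable
  also have "\<dots> = (\<integral>\<^sup>+z. f z * indicator B z \<partial>M)"
    unfolding f_def sum_distrib_right by (intro nn_integral_cong sum.cong) (auto simp: mult.assoc)
  finally have "(\<Sum>g\<in>W. ennreal a * emeasure M (T g -` B \<inter> space M))\<^sup>2 = (\<integral>\<^sup>+z. f z * indicator B z \<partial>M)\<^sup>2" by simp
  also have "\<dots> \<le> (\<integral>\<^sup>+z. f z ^ 2 \<partial>M) * (\<integral>\<^sup>+z. indicator B z ^ 2 \<partial>M)"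
    by (intro Cauchy_Schwarz_nn_integral) measurable
  also have "(\<integral>\<^sup>+z. indicator B z ^ 2 \<partial>M) = (\<integral>\<^sup>+z. indicator B z \<partial>M)"
    by (intro nn_integral_cong) (auto simp: indicator_def)
  also have "\<dots> = emeasure M B" by simp
  also have "(\<integral>\<^sup>+z. f z ^ 2 \<partial>M) = (\<integral>\<^sup>+z. (\<Sum>g\<in>W. \<Sum>g'\<in>W. ennreal a * ennreal a * (l g z * l g' z)) \<partial>M)"
    unfolding f_def power2_eq_square sum_product by (intro nn_integral_cong sum.cong refl) (simp add: mult_ac)
  also have "\<dots> = (\<Sum>g\<in>W. \<Sum>g'\<in>W. \<integral>\<^sup>+z. ennreal a * ennreal a * (l g z * l g' z) \<partial>M)"
    by (subst nn_integral_sum, measurable, intro sum.cong refl, rule nn_integral_sum) measurable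
  also have "\<dots> = (\<Sum>g\<in>W. \<Sum>g'\<in>W. ennreal a * ennreal a * (\<integral>\<^sup>+z. l g z * l g' z \<partial>M))"
    by (intro sum.cong refl nn_integral_cmult) measurable
  finally show ?thesis .
qed

text \<open>The bound is asked for positive \<open>n\<close> only, since limits ignore the
  degenerate case \<open>n = 0\<close>, where the noise scale would divide by zero.\<close>

lemma contiguousI:
  assumes "\<And>n. prob_space (P n)" "\<And>n. prob_space (Q n)" "\<And>n. sets (P n) = sets (Q n)"
    and bound: "\<And>n A. n > 0 \<Longrightarrow> A \<in> sets (Q n) \<Longrightarrow> (measure (P n) A)\<^sup>2 \<le> C * measure (Q n) A"
  shows "contiguous P Q"
  unfolding contiguous_def
proof (intro conjI allI impI)
  fix A assume A: "\<forall>n. A n \<in> sets (Q n)" and lim: "(\<lambda>n. measure (Q n) (A n)) \<longlonglongrightarrow> 0"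
  have "(\<lambda>n. (measure (P n) (A n))\<^sup>2) \<longlonglongrightarrow> 0"
  proof (rule tendsto_sandwich)
    show "\<forall>\<^sub>F n in sequentially. 0 \<le> (measure (P n) (A n))\<^sup>2" by simp
    show "\<forall>\<^sub>F n in sequentially. (measure (P n) (A n))\<^sup>2 \<le> C * measure (Q n) (A n)"
      using eventually_gt_at_top[of 0] by eventually_elim (use A bound in auto)
    show "(\<lambda>n. C * measure (Q n) (A n)) \<longlonglongrightarrow> 0" using tendsto_mult_right_zero[OF lim] .
  qed simp
  then have "(\<lambda>n. sqrt ((measure (P n) (A n))\<^sup>2)) \<longlonglongrightarrow> sqrt 0" by (rule tendsto_real_sqrt)
  then show "(\<lambda>n. measure (P n) (A n)) \<longlonglongrightarrow> 0" by simp
qed (use assms in auto)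

text \<open>Translates the threshold on signal strengths into the condition on the constant
  \<open>c\<close> of \<open>multinomial_exp_moment\<close>, taken as \<lambda>^2 L.\<close>

lemma lambda_star_square: "L \<ge> 2 \<Longrightarrow> (lambda_star L)\<^sup>2 * L = 2 * kl_const L"
  by (auto simp: lambda_star_def kl_const_def)

context finite_group
begin

lemma measurable_observation:
  assumes \<rho>: "frequency G \<rho>"
  shows "observation G n lam \<rho> g \<in>
    gaussian_ensemble (rep_type G \<rho>) (n * rep_dim G \<rho>) \<rightarrow>\<^sub>M mat_borel (n * deg \<rho>)"
proof -
  define S where "S = stack G n \<rho> g * mat_adjoint (stack G n \<rho> g)"
  have S: "S \<in> carrier_mat (n * deg \<rho>) (n * deg \<rho>)"
    by (auto simp: S_def stack_def Let_def)
  have dim: "embed_dim (rep_type G \<rho>) (n * rep_dim G \<rho>) = n * deg \<rho>"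
    by (simp add: embed_dim_mult frequencyD[OF \<rho>])
  have "observation G n lam \<rho> g \<in> mat_borel (n * deg \<rho>) \<rightarrow>\<^sub>M mat_borel (n * deg \<rho>)"
  proof (rule measurable_mat_borelI)
    fix i j assume ij: "i < n * deg \<rho>" "j < n * deg \<rho>"
    have "(\<lambda>W. observation G n lam \<rho> g W $$ (i, j)) \<in> borel_measurable (mat_borel (n * deg \<rho>)) \<longleftrightarrow>
      (\<lambda>W. complex_of_real (lam \<rho> / real n) * S $$ (i, j) + complex_of_real (1 / sqrt (real (n * rep_dim G \<rho>))) * W $$ (i, j))
        \<in> borel_measurable (mat_borel (n * deg \<rho>))"
      using ij S by (intro measurable_cong) (auto simp: observation_def S_def[symmetric] space_mat_borel)
    then show "(\<lambda>W. observation G n lam \<rho> g W $$ (i, j)) \<in> borel_measurable (mat_borel (n * deg \<rho>))"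
      using measurable_mat_index[OF ij] by simp
  qed (use S in \<open>auto simp: observation_def S_def[symmetric] space_mat_borel\<close>)
  then show ?thesis by (simp add: measurable_cong_sets[OF sets_gaussian_ensemble refl] dim)
qed

section \<open>The law of the observations in real coordinates\<close>

definition words :: "nat \<Rightarrow> (nat \<Rightarrow> 'g) set" where
  "words n = ({..<n} \<rightarrow>\<^sub>E carrier G)"

lemma words_finite: "finite (words n)"
  using finite_carrier by (auto simp: words_def intro: finite_PiE)

lemma card_words: "card (words n) = card (carrier G) ^ n"
  by (simp add: words_def card_PiE)

lemma PiM_words: "(\<Pi>\<^sub>M u\<in>{..<n}. uniform_count_measure (carrier G)) = uniform_count_measure (words n)"
  unfolding words_def using finite_carrier one_closed by (intro PiM_uniform_count_measure) auto

abbreviation noise :: "('g \<Rightarrow> complex mat) set \<Rightarrow> nat \<Rightarrow> (('g \<Rightarrow> complex mat) \<Rightarrow> complex mat) measure" where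
  "noise \<Psi> n \<equiv> \<Pi>\<^sub>M \<rho>\<in>\<Psi>. gaussian_ensemble (rep_type G \<rho>) (n * rep_dim G \<rho>)"

abbreviation obs_space :: "('g \<Rightarrow> complex mat) set \<Rightarrow> nat \<Rightarrow> (('g \<Rightarrow> complex mat) \<Rightarrow> complex mat) measure" where
  "obs_space \<Psi> n \<equiv> \<Pi>\<^sub>M \<rho>\<in>\<Psi>. mat_borel (n * deg \<rho>)"

lemma prob_space_noise: "prob_space (noise \<Psi> n)"
  by (intro prob_space_PiM prob_space_gaussian_ensemble)

lemma measurable_observations:
  assumes \<Psi>: "\<forall>\<rho>\<in>\<Psi>. frequency G \<rho>"
  shows "(\<lambda>W. \<lambda>\<rho>\<in>\<Psi>. observation G n lam \<rho> g (W \<rho>)) \<in> noise \<Psi> n \<rightarrow>\<^sub>M obs_space \<Psi> n"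
proof (rule measurable_restrict)
  fix \<rho> assume \<rho>: "\<rho> \<in> \<Psi>"
  show "(\<lambda>W. observation G n lam \<rho> g (W \<rho>)) \<in> noise \<Psi> n \<rightarrow>\<^sub>M mat_borel (n * deg \<rho>)"
  proof -
    have "(\<lambda>W. W \<rho>) \<in> noise \<Psi> n \<rightarrow>\<^sub>M gaussian_ensemble (rep_type G \<rho>) (n * rep_dim G \<rho>)"
      by (rule measurable_component_singleton[OF \<rho>])
    from measurable_compose[OF this measurable_observation[OF bspec[OF \<Psi> \<rho>]]] show ?thesis .
  qed
qed

lemma measurable_model:
  assumes \<Psi>: "\<forall>\<rho>\<in>\<Psi>. frequency G \<rho>"
  shows "(\<lambda>(g, W). \<lambda>\<rho>\<in>\<Psi>. observation G n lam \<rho> g (W \<rho>)) \<in>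
    uniform_count_measure (words n) \<Otimes>\<^sub>M noise \<Psi> n \<rightarrow>\<^sub>M obs_space \<Psi> n"
proof -
  have "(\<lambda>(g, W). \<lambda>\<rho>\<in>\<Psi>. observation G n lam \<rho> g (W \<rho>)) \<in> count_space (words n) \<Otimes>\<^sub>M noise \<Psi> n \<rightarrow>\<^sub>M obs_space \<Psi> n"
    using words_finite measurable_observations[OF \<Psi>]
    by (intro measurable_pair_measure_countable1) (auto intro: countable_finite)
  moreover have "sets (count_space (words n) \<Otimes>\<^sub>M noise \<Psi> n) = sets (uniform_count_measure (words n) \<Otimes>\<^sub>M noise \<Psi> n)"
    by (intro sets_pair_measure_cong) (auto simp: sets_uniform_count_measure)
  ultimately show ?thesis by (simp cong: measurable_cong_sets)
qed

lemma GSynch_eq: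
  "GSynch n lam G \<Psi> = distr (uniform_count_measure (words n) \<Otimes>\<^sub>M noise \<Psi> n) (obs_space \<Psi> n)
     (\<lambda>(g, W). \<lambda>\<rho>\<in>\<Psi>. observation G n lam \<rho> g (W \<rho>))"
  unfolding GSynch_def PiM_words ..

lemma words_nonempty: "words n \<noteq> {}"
  using one_closed by (auto simp: words_def PiE_eq_empty_iff)

lemma prob_space_GSynch:
  assumes \<Psi>: "\<forall>\<rho>\<in>\<Psi>. frequency G \<rho>"
  shows "prob_space (GSynch n lam G \<Psi>)"
proof -
  interpret A: prob_space "uniform_count_measure (words n)"
    by (intro prob_space_uniform_count_measure words_finite words_nonempty)
  interpret B: prob_space "noise \<Psi> n" by (rule prob_space_noise)
  interpret AB: pair_prob_space "uniform_count_measure (words n)" "noise \<Psi> n" ..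
  show ?thesis unfolding GSynch_eq by (intro AB.prob_space_distr measurable_model \<Psi>)
qed

definition coords :: "('g \<Rightarrow> complex mat) set \<Rightarrow> nat \<Rightarrow> (('g \<Rightarrow> complex mat) \<Rightarrow> nat \<times> nat \<times> nat \<Rightarrow> real) measure" where
  "coords \<Psi> n = (\<Pi>\<^sub>M \<rho>\<in>\<Psi>. gaussian_coords (rep_type G \<rho>) (n * rep_dim G \<rho>))"

definition observe :: "('g \<Rightarrow> complex mat) set \<Rightarrow> nat \<Rightarrow> (('g \<Rightarrow> complex mat) \<Rightarrow> real) \<Rightarrow> (nat \<Rightarrow> 'g) \<Rightarrow>
    (('g \<Rightarrow> complex mat) \<Rightarrow> nat \<times> nat \<times> nat \<Rightarrow> real) \<Rightarrow> ('g \<Rightarrow> complex mat) \<Rightarrow> complex mat" where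
  "observe \<Psi> n lam g z = (\<lambda>\<rho>\<in>\<Psi>. observation G n lam \<rho> g
     (embed_mat (rep_type G \<rho>) (n * rep_dim G \<rho>) (hermitian_coords (z \<rho>))))"

lemma noise_eq:
  assumes "finite \<Psi>"
  shows "noise \<Psi> n = distr (coords \<Psi> n) (\<Pi>\<^sub>M \<rho>\<in>\<Psi>. mat_borel (embed_dim (rep_type G \<rho>) (n * rep_dim G \<rho>)))
    (\<lambda>z. \<lambda>\<rho>\<in>\<Psi>. embed_mat (rep_type G \<rho>) (n * rep_dim G \<rho>) (hermitian_coords (z \<rho>)))"
  unfolding coords_def gaussian_ensemble_def
  by (rule distr_PiM_componentwise[symmetric, OF assms prob_space_gaussian_coords measurable_embed_hermitian])

lemma measurable_embeds:
  "(\<lambda>z. \<lambda>\<rho>\<in>\<Psi>. embed_mat (rep_type G \<rho>) (n * rep_dim G \<rho>) (hermitian_coords (z \<rho>)))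
    \<in> coords \<Psi> n \<rightarrow>\<^sub>M (\<Pi>\<^sub>M \<rho>\<in>\<Psi>. mat_borel (embed_dim (rep_type G \<rho>) (n * rep_dim G \<rho>)))"
proof (rule measurable_restrict)
  fix \<rho> assume \<rho>: "\<rho> \<in> \<Psi>"
  have "(\<lambda>z. z \<rho>) \<in> coords \<Psi> n \<rightarrow>\<^sub>M gaussian_coords (rep_type G \<rho>) (n * rep_dim G \<rho>)"
    unfolding coords_def by (rule measurable_component_singleton[OF \<rho>])
  from measurable_compose[OF this measurable_embed_hermitian]
  show "(\<lambda>z. embed_mat (rep_type G \<rho>) (n * rep_dim G \<rho>) (hermitian_coords (z \<rho>)))
      \<in> coords \<Psi> n \<rightarrow>\<^sub>M mat_borel (embed_dim (rep_type G \<rho>) (n * rep_dim G \<rho>))" .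
qed

lemma measurable_observe:
  assumes "finite \<Psi>" "\<forall>\<rho>\<in>\<Psi>. frequency G \<rho>"
  shows "observe \<Psi> n lam g \<in> coords \<Psi> n \<rightarrow>\<^sub>M obs_space \<Psi> n"
proof -
  have "(\<lambda>W. \<lambda>\<rho>\<in>\<Psi>. observation G n lam \<rho> g (W \<rho>)) \<in>
      (\<Pi>\<^sub>M \<rho>\<in>\<Psi>. mat_borel (embed_dim (rep_type G \<rho>) (n * rep_dim G \<rho>))) \<rightarrow>\<^sub>M obs_space \<Psi> n"
    using measurable_observations[OF assms(2)] by (simp add: noise_eq[OF assms(1)])
  from measurable_compose[OF measurable_embeds this] show ?thesis
    by (rule measurable_cong[THEN iffD1, rotated]) (auto simp: observe_def)
qed

text \<open>Conditioning on the word presents the model as a uniform average over \<open>g\<close>;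
  the noise matrices are then replaced by their independent real coordinates, on which the shifts
  act.\<close>

lemma emeasure_GSynch:
  assumes \<Psi>: "finite \<Psi>" "\<forall>\<rho>\<in>\<Psi>. frequency G \<rho>" and A: "A \<in> sets (obs_space \<Psi> n)"
  shows "emeasure (GSynch n lam G \<Psi>) A =
    (\<Sum>g\<in>words n. ennreal (1 / card (words n)) * emeasure (coords \<Psi> n) (observe \<Psi> n lam g -` A \<inter> space (coords \<Psi> n)))"
proof -
  let ?F = "\<lambda>(g, W). \<lambda>\<rho>\<in>\<Psi>. observation G n lam \<rho> g (W \<rho>)"
  let ?U = "uniform_count_measure (words n)"
  interpret B: prob_space "noise \<Psi> n" by (rule prob_space_noise)
  note F = measurable_model[OF \<Psi>(2)] and obs = measurable_observations[OF \<Psi>(2)]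
  have "emeasure (GSynch n lam G \<Psi>) A = emeasure (?U \<Otimes>\<^sub>M noise \<Psi> n) (?F -` A \<inter> space (?U \<Otimes>\<^sub>M noise \<Psi> n))"
    unfolding GSynch_eq using F A by (rule emeasure_distr)
  also have "\<dots> = (\<integral>\<^sup>+g. emeasure (noise \<Psi> n) (Pair g -` (?F -` A \<inter> space (?U \<Otimes>\<^sub>M noise \<Psi> n))) \<partial>?U)"
    by (intro B.emeasure_pair_measure_alt measurable_sets[OF F A])
  also have "\<dots> = (\<Sum>g\<in>words n. ennreal (1 / card (words n)) * emeasure (noise \<Psi> n) (Pair g -` (?F -` A \<inter> space (?U \<Otimes>\<^sub>M noise \<Psi> n))))"
    unfolding uniform_count_measure_def by (rule nn_integral_point_measure_finite[OF words_finite])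
  also have "\<dots> = (\<Sum>g\<in>words n. ennreal (1 / card (words n)) * emeasure (coords \<Psi> n) (observe \<Psi> n lam g -` A \<inter> space (coords \<Psi> n)))"
  proof (intro sum.cong refl arg_cong2[where f = "(*)"])
    fix g assume g: "g \<in> words n"
    have "Pair g -` (?F -` A \<inter> space (?U \<Otimes>\<^sub>M noise \<Psi> n)) =
        (\<lambda>W. \<lambda>\<rho>\<in>\<Psi>. observation G n lam \<rho> g (W \<rho>)) -` A \<inter> space (noise \<Psi> n)"
      using g by (auto simp: space_pair_measure space_uniform_count_measure)
    then have "emeasure (noise \<Psi> n) (Pair g -` (?F -` A \<inter> space (?U \<Otimes>\<^sub>M noise \<Psi> n))) =
        emeasure (distr (noise \<Psi> n) (obs_space \<Psi> n) (\<lambda>W. \<lambda>\<rho>\<in>\<Psi>. observation G n lam \<rho> g (W \<rho>))) A"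
      using emeasure_distr[OF obs A] by simp
    also have "distr (noise \<Psi> n) (obs_space \<Psi> n) (\<lambda>W. \<lambda>\<rho>\<in>\<Psi>. observation G n lam \<rho> g (W \<rho>)) =
        distr (coords \<Psi> n) (obs_space \<Psi> n) (observe \<Psi> n lam g)"
      using obs unfolding noise_eq[OF \<Psi>(1)]
      by (subst distr_distr[OF _ measurable_embeds]) (auto simp: observe_def[abs_def] comp_def intro!: distr_cong)
    also have "emeasure \<dots> A = emeasure (coords \<Psi> n) (observe \<Psi> n lam g -` A \<inter> space (coords \<Psi> n))"
      by (rule emeasure_distr[OF measurable_observe[OF \<Psi>] A])
    finally show "emeasure (noise \<Psi> n) (Pair g -` (?F -` A \<inter> space (?U \<Otimes>\<^sub>M noise \<Psi> n))) =
      emeasure (coords \<Psi> n) (observe \<Psi> n lam g -` A \<inter> space (coords \<Psi> n))" .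
  qed
  finally show ?thesis .
qed

text \<open>For each fixed \<open>g\<close> the letterwise quotient of a uniform word by
  \<open>g\<close> is again uniform, so the double average over \<open>g\<close>, \<open>g'\<close>
  collapses to a single one.\<close>

lemma words_translate:
  assumes g: "g \<in> words n"
  shows "bij_betw (\<lambda>g'. \<lambda>u\<in>{..<n}. inv\<^bsub>G\<^esub> g u \<otimes>\<^bsub>G\<^esub> g' u) (words n) (words n)"
proof (rule bij_betwI[where g = "\<lambda>h. \<lambda>u\<in>{..<n}. g u \<otimes>\<^bsub>G\<^esub> h u"])
  have gu: "g u \<in> carrier G" if "u < n" for u using g that by (auto simp: words_def)
  show "(\<lambda>g'. \<lambda>u\<in>{..<n}. inv\<^bsub>G\<^esub> g u \<otimes>\<^bsub>G\<^esub> g' u) \<in> words n \<rightarrow> words n"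
    using gu by (auto simp: words_def PiE_iff)
  show "(\<lambda>h. \<lambda>u\<in>{..<n}. g u \<otimes>\<^bsub>G\<^esub> h u) \<in> words n \<rightarrow> words n"
    using gu by (auto simp: words_def PiE_iff)
  show "(\<lambda>u\<in>{..<n}. g u \<otimes>\<^bsub>G\<^esub> (\<lambda>u\<in>{..<n}. inv\<^bsub>G\<^esub> g u \<otimes>\<^bsub>G\<^esub> x u) u) = x" if "x \<in> words n" for x
    using that gu by (intro ext) (auto simp: words_def PiE_iff extensional_def m_assoc[symmetric])
  show "(\<lambda>u\<in>{..<n}. inv\<^bsub>G\<^esub> g u \<otimes>\<^bsub>G\<^esub> (\<lambda>u\<in>{..<n}. g u \<otimes>\<^bsub>G\<^esub> y u) u) = y" if "y \<in> words n" for y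
    using that gu by (intro ext) (auto simp: words_def PiE_iff extensional_def m_assoc[symmetric])
qed

lemma GSynch_second_moment:
  fixes v :: real
  assumes \<Psi>: "all_frequencies G \<Psi>" and L: "card (carrier G) \<ge> 2" and n: "n > 0"
    and lam: "\<And>\<rho>. \<rho> \<in> \<Psi> \<Longrightarrow> (lam \<rho>)\<^sup>2 \<le> v" and v: "v * card (carrier G) < 2 * kl_const (card (carrier G))" "v \<ge> 0"
    and A: "A \<in> sets (obs_space \<Psi> n)"
  defines "C \<equiv> (1 / sqrt (1 - v * card (carrier G) / (2 * kl_const (card (carrier G))))) ^ card (carrier G)"
  shows "(emeasure (GSynch n lam G \<Psi>) A)\<^sup>2 \<le> ennreal C * emeasure (GSynch n (\<lambda>_. 0) G \<Psi>) A"
proof -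
  let ?L = "card (carrier G)"
  let ?t = "rep_type G" and ?N = "\<lambda>\<rho>. n * rep_dim G \<rho>"
  let ?M = "coords \<Psi> n"
  define m where "m \<rho> = (if rep_type G \<rho> = Complex_Type then 2 else 1 :: real)" for \<rho>
  define dif where "dif g g' = (\<lambda>u. inv\<^bsub>G\<^esub> g u \<otimes>\<^bsub>G\<^esub> g' u)" for g g' :: "nat \<Rightarrow> 'g"
  have fin: "finite \<Psi>" and freq: "\<forall>\<rho>\<in>\<Psi>. frequency G \<rho>"
    using \<Psi> by (auto simp: all_frequencies_def)
  have wPi: "g \<in> {..<n} \<rightarrow> carrier G" if "g \<in> words n" for g using that by (auto simp: words_def)
  have "\<forall>\<rho>. \<exists>s. \<rho> \<in> \<Psi> \<longrightarrow> (\<forall>g\<in>{..<n} \<rightarrow> carrier G.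
     (\<forall>z. observation G n lam \<rho> g (embed_mat (?t \<rho>) (?N \<rho>) (hermitian_coords z)) =
        observation G n (\<lambda>_. 0) \<rho> g (embed_mat (?t \<rho>) (?N \<rho>) (hermitian_coords (coord_shift (?t \<rho>) (?N \<rho>) (s g) z)))) \<and>
     (\<forall>g'\<in>{..<n} \<rightarrow> carrier G.
        (\<Sum>j\<in>coord_set (?t \<rho>) (?N \<rho>). s g j * s g' j / (coord_sd (?t \<rho>) j)\<^sup>2) =
        (lam \<rho>)\<^sup>2 / (2 * n) * (m \<rho> * (real (deg \<rho>) * coeff_energy \<rho> n (dif g g')))))"
    using observation_as_shift[OF bspec[OF freq] n, of _ lam] unfolding m_def dif_def by blast
  from choice[OF this] obtain s where
    shift: "\<And>\<rho> g z. \<rho> \<in> \<Psi> \<Longrightarrow> g \<in> words n \<Longrightarrow> observation G n lam \<rho> g (embed_mat (?t \<rho>) (?N \<rho>) (hermitian_coords z)) =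
        observation G n (\<lambda>_. 0) \<rho> g (embed_mat (?t \<rho>) (?N \<rho>) (hermitian_coords (coord_shift (?t \<rho>) (?N \<rho>) (s \<rho> g) z)))"
    and inner: "\<And>\<rho> g g'. \<rho> \<in> \<Psi> \<Longrightarrow> g \<in> words n \<Longrightarrow> g' \<in> words n \<Longrightarrow>
        (\<Sum>j\<in>coord_set (?t \<rho>) (?N \<rho>). s \<rho> g j * s \<rho> g' j / (coord_sd (?t \<rho>) j)\<^sup>2) =
        (lam \<rho>)\<^sup>2 / (2 * n) * (m \<rho> * (real (deg \<rho>) * coeff_energy \<rho> n (dif g g')))"
    using wPi by blast
  define T where "T g z = (\<lambda>\<rho>\<in>\<Psi>. coord_shift (?t \<rho>) (?N \<rho>) (s \<rho> g) (z \<rho>))" for g and z :: "('g \<Rightarrow> complex mat) \<Rightarrow> nat \<times> nat \<times> nat \<Rightarrow> real"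
  define l where "l g z = (\<Prod>\<rho>\<in>\<Psi>. coord_ratio (?t \<rho>) (?N \<rho>) (s \<rho> g) (z \<rho>))" for g and z :: "('g \<Rightarrow> complex mat) \<Rightarrow> nat \<times> nat \<times> nat \<Rightarrow> real"
  have sd: "shift_density ?M (T g) (l g)" for g
    unfolding coords_def T_def[abs_def] l_def[abs_def]
    by (intro shift_density_PiM fin prob_space_gaussian_coords shift_density_coords)
  \<comment> \<open>With zero signal the observation does not depend on the word, so one reference
    word defines the null event \<open>B\<close> for all of them.\<close>
  obtain g0 where g0: "g0 \<in> words n" using words_nonempty by blast
  have obs0: "observe \<Psi> n (\<lambda>_. 0) g z = observe \<Psi> n (\<lambda>_. 0) g0 z" for g z
  proof -
    have "embed_mat (?t \<rho>) (?N \<rho>) (hermitian_coords (z \<rho>)) \<in> carrier_mat (n * deg \<rho>) (n * deg \<rho>)" if "\<rho> \<in> \<Psi>" for \<rho>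
      using embed_mat_carrier[of "?t \<rho>" "?N \<rho>"] frequencyD[OF bspec[OF freq that]] by (simp add: embed_dim_mult)
    then show ?thesis
      unfolding observe_def by (intro restrict_ext) (simp add: observation_zero)
  qed
  define B where "B = observe \<Psi> n (\<lambda>_. 0) g0 -` A \<inter> space ?M"
  have B: "B \<in> sets ?M" unfolding B_def by (rule measurable_sets[OF measurable_observe[OF fin freq] A])
  have TM: "T g \<in> ?M \<rightarrow>\<^sub>M ?M" for g using sd by (auto simp: shift_density_def)
  \<comment> \<open>The event seen with the planted word \<open>g\<close> is the null event
    \<open>B\<close> pulled back along the shift \<open>T g\<close>.\<close>
  have pre: "observe \<Psi> n lam g -` A \<inter> space ?M = T g -` B \<inter> space ?M" if g: "g \<in> words n" for g
  proof -
    have "observe \<Psi> n lam g z = observe \<Psi> n (\<lambda>_. 0) g0 (T g z)" for z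
      unfolding obs0[of g "T g z", symmetric] unfolding observe_def
      by (intro restrict_ext) (simp add: shift[OF _ g] T_def)
    then show ?thesis using measurable_space[OF TM] by (auto simp: B_def)
  qed
  define W where "W = words n"
  define a where "a = 1 / real (card W)"
  have cW: "card W > 0" using words_finite words_nonempty by (auto simp: W_def card_gt_0_iff)
  have a: "a \<ge> 0" "real (card W) * a = 1" using cW by (auto simp: a_def)
  have P: "emeasure (GSynch n lam G \<Psi>) A = (\<Sum>g\<in>W. ennreal a * emeasure ?M (T g -` B \<inter> space ?M))"
  proof -
    have "emeasure (GSynch n lam G \<Psi>) A =
        (\<Sum>g\<in>W. ennreal a * emeasure ?M (observe \<Psi> n lam g -` A \<inter> space ?M))"
      unfolding a_def W_def by (rule emeasure_GSynch[OF fin freq A])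
    also have "\<dots> = (\<Sum>g\<in>W. ennreal a * emeasure ?M (T g -` B \<inter> space ?M))"
    proof (rule sum.cong[OF refl])
      fix g assume "g \<in> W"
      then show "ennreal a * emeasure ?M (observe \<Psi> n lam g -` A \<inter> space ?M) = ennreal a * emeasure ?M (T g -` B \<inter> space ?M)"
        unfolding W_def by (simp only: pre)
    qed
    finally show ?thesis .
  qed
  have Q: "emeasure (GSynch n (\<lambda>_. 0) G \<Psi>) A = emeasure ?M B"
  proof -
    have "observe \<Psi> n (\<lambda>_. 0) g -` A \<inter> space ?M = B" for g
      unfolding B_def using obs0[of g] by auto
    then have "emeasure (GSynch n (\<lambda>_. 0) G \<Psi>) A = (\<Sum>g\<in>W. ennreal a * emeasure ?M B)"
      unfolding a_def W_def using emeasure_GSynch[OF fin freq A, of "\<lambda>_. 0"] by simp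
    also have "\<dots> = ennreal (real (card W) * a) * emeasure ?M B"
      using a(1) by (simp add: ennreal_mult mult.assoc ennreal_of_nat_eq_real_of_nat)
    finally show ?thesis unfolding a(2) by simp
  qed
  define E where "E h = exp (v * ?L / (2 * n) * (\<Sum>x\<in>carrier G. (real (card {u. u < n \<and> h u = x}) - n / ?L)\<^sup>2))" for h
  have ll: "(\<integral>\<^sup>+z. l g z * l g' z \<partial>?M) \<le> ennreal (E (dif g g'))" if g: "g \<in> W" "g' \<in> W" for g g'
  proof -
    have gw: "g \<in> words n" "g' \<in> words n" using g by (auto simp: W_def)
    have dPi: "dif g g' \<in> {..<n} \<rightarrow> carrier G" using wPi[OF gw(1)] wPi[OF gw(2)] by (auto simp: dif_def)
    interpret product_sigma_finite "\<lambda>\<rho>. gaussian_coords (?t \<rho>) (?N \<rho>)"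
      by (intro product_sigma_finite.intro prob_space_imp_sigma_finite prob_space_gaussian_coords)
    have r: "coord_ratio t N x \<in> borel_measurable (gaussian_coords t N)" for t N x
      using shift_density_coords by (auto simp: shift_density_def)
    have "(\<integral>\<^sup>+z. l g z * l g' z \<partial>?M) =
        (\<Prod>\<rho>\<in>\<Psi>. \<integral>\<^sup>+z. coord_ratio (?t \<rho>) (?N \<rho>) (s \<rho> g) z * coord_ratio (?t \<rho>) (?N \<rho>) (s \<rho> g') z \<partial>gaussian_coords (?t \<rho>) (?N \<rho>))"
      unfolding l_def coords_def prod.distrib[symmetric]
      by (intro product_nn_integral_prod fin borel_measurable_times_ennreal r)
    also have "\<dots> = (\<Prod>\<rho>\<in>\<Psi>. ennreal (exp ((lam \<rho>)\<^sup>2 / (2 * n) * (m \<rho> * (real (deg \<rho>) * coeff_energy \<rho> n (dif g g'))))))"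
      unfolding coord_ratio_product by (intro prod.cong refl) (simp add: inner gw)
    also have "\<dots> = ennreal (exp (\<Sum>\<rho>\<in>\<Psi>. (lam \<rho>)\<^sup>2 / (2 * n) * (m \<rho> * (real (deg \<rho>) * coeff_energy \<rho> n (dif g g')))))"
      using fin by (simp add: prod_ennreal exp_sum)
    also have "\<dots> \<le> ennreal (E (dif g g'))"
      unfolding E_def
    proof (intro ennreal_leI exp_le_cancel_iff[THEN iffD2])
      \<comment> \<open>Energies are nonnegative, so all strengths may be raised to the common bound
        \<open>v\<close> before the frequencies are summed.\<close>
      have "(\<Sum>\<rho>\<in>\<Psi>. (lam \<rho>)\<^sup>2 / (2 * n) * (m \<rho> * (real (deg \<rho>) * coeff_energy \<rho> n (dif g g')))) \<le>
          (\<Sum>\<rho>\<in>\<Psi>. v / (2 * n) * (m \<rho> * (real (deg \<rho>) * coeff_energy \<rho> n (dif g g'))))"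
        by (intro sum_mono mult_right_mono divide_right_mono lam) (auto simp: m_def coeff_energy_def sum_nonneg)
      also have "\<dots> = v / (2 * n) * (\<Sum>\<rho>\<in>\<Psi>. m \<rho> * (real (deg \<rho>) * coeff_energy \<rho> n (dif g g')))"
        by (simp add: sum_distrib_left)
      also have "\<dots> \<le> v / (2 * n) * (?L * (\<Sum>x\<in>carrier G. (real (card {u. u < n \<and> dif g g' u = x}) - n / ?L)\<^sup>2))"
        using frequencies_energy_le[OF \<Psi> dPi] v(2) unfolding m_def by (intro mult_left_mono) auto
      finally show "(\<Sum>\<rho>\<in>\<Psi>. (lam \<rho>)\<^sup>2 / (2 * n) * (m \<rho> * (real (deg \<rho>) * coeff_energy \<rho> n (dif g g')))) \<le>
        v * ?L / (2 * n) * (\<Sum>x\<in>carrier G. (real (card {u. u < n \<and> dif g g' u = x}) - n / ?L)\<^sup>2)" by simp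
    qed
    finally show ?thesis .
  qed
  \<comment> \<open>\<open>E\<close> sees only the letters at positions below \<open>n\<close>, so
    restricting \<open>dif g g'\<close> to an element of \<open>words n\<close> does not change
    it.\<close>
  have EW: "(\<Sum>g'\<in>W. E (dif g g')) = (\<Sum>h\<in>W. E h)" if g: "g \<in> W" for g
  proof -
    have "E (dif g g') = E (\<lambda>u\<in>{..<n}. inv\<^bsub>G\<^esub> g u \<otimes>\<^bsub>G\<^esub> g' u)" for g'
    proof -
      have "{u. u < n \<and> dif g g' u = x} = {u. u < n \<and> (\<lambda>u\<in>{..<n}. inv\<^bsub>G\<^esub> g u \<otimes>\<^bsub>G\<^esub> g' u) u = x}" for x
        by (auto simp: dif_def)
      then show ?thesis unfolding E_def by simp
    qed
    then show ?thesis
      using sum.reindex_bij_betw[OF words_translate, of g n E] g by (simp add: W_def)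
  qed
  have EC: "(\<Sum>h\<in>W. E h) \<le> card W * C"
    using multinomial_exp_moment[OF finite_carrier L n, of "v * ?L"] v
    unfolding E_def W_def card_words C_def words_def[symmetric] by simp
  have "(\<Sum>g\<in>W. \<Sum>g'\<in>W. ennreal a * ennreal a * (\<integral>\<^sup>+z. l g z * l g' z \<partial>?M)) \<le>
      (\<Sum>g\<in>W. \<Sum>g'\<in>W. ennreal (a * a * E (dif g g')))"
  proof (intro sum_mono)
    fix g g' assume "g \<in> W" "g' \<in> W"
    from mult_left_mono[OF ll[OF this], of "ennreal a * ennreal a"]
    show "ennreal a * ennreal a * (\<integral>\<^sup>+z. l g z * l g' z \<partial>?M) \<le> ennreal (a * a * E (dif g g'))"
      using a(1) by (simp add: ennreal_mult E_def)
  qed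
  also have "\<dots> = ennreal (\<Sum>g\<in>W. \<Sum>g'\<in>W. a * a * E (dif g g'))"
    using a(1) by (simp add: E_def sum_nonneg)
  also have "(\<Sum>g\<in>W. \<Sum>g'\<in>W. a * a * E (dif g g')) = card W * (a * a * (\<Sum>h\<in>W. E h))"
    by (simp add: sum_distrib_left[symmetric] EW)
  also have "ennreal (card W * (a * a * (\<Sum>h\<in>W. E h))) \<le> ennreal (card W * (a * a * (card W * C)))"
    using EC a(1) by (intro ennreal_leI mult_left_mono) auto
  also have "card W * (a * a * (card W * C)) = (card W * a) * (card W * a) * C" by (simp only: mult_ac)
  also have "\<dots> = C" unfolding a(2) by simp
  finally have SM: "(\<Sum>g\<in>W. \<Sum>g'\<in>W. ennreal a * ennreal a * (\<integral>\<^sup>+z. l g z * l g' z \<partial>?M)) \<le> ennreal C" .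
  have "(emeasure (GSynch n lam G \<Psi>) A)\<^sup>2 \<le>
      (\<Sum>g\<in>W. \<Sum>g'\<in>W. ennreal a * ennreal a * (\<integral>\<^sup>+z. l g z * l g' z \<partial>?M)) * emeasure ?M B"
    unfolding P by (rule second_moment_bound) (use words_finite sd B in \<open>auto simp: W_def\<close>)
  also have "\<dots> \<le> ennreal C * emeasure ?M B" by (rule mult_right_mono[OF SM]) simp
  finally show ?thesis unfolding Q .
qed

lemma GSynch_contiguous:
  assumes \<Psi>: "all_frequencies G \<Psi>" and L: "card (carrier G) \<ge> 2"
    and lam: "\<And>\<rho>. \<rho> \<in> \<Psi> \<Longrightarrow> lam \<rho> \<ge> 0" "\<And>\<rho>. \<rho> \<in> \<Psi> \<Longrightarrow> lam \<rho> < lambda_star (card (carrier G))"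
  shows "contiguous (\<lambda>n. GSynch n lam G \<Psi>) (\<lambda>n. GSynch n (\<lambda>_. 0) G \<Psi>)"
proof -
  let ?L = "card (carrier G)"
  have fin: "finite \<Psi>" and freq: "\<forall>\<rho>\<in>\<Psi>. frequency G \<rho>"
    using \<Psi> by (auto simp: all_frequencies_def)
  have K: "kl_const ?L > 0" using kl_const_pos[OF L] .
  have star: "lambda_star ?L > 0"
  proof -
    have "lambda_star ?L \<noteq> 0" using lambda_star_square[OF L] K by auto
    moreover have "lambda_star ?L \<ge> 0" using L by (auto simp: lambda_star_def)
    ultimately show ?thesis by simp
  qed
  \<comment> \<open>Finiteness of \<Psi> turns the pointwise strict inequalities into one uniform
    gap below the threshold; inserting 0 covers an empty \<Psi> and makes \<open>M\<close>
    nonnegative.\<close>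
  define M where "M = Max (insert 0 (lam ` \<Psi>))"
  have M: "M \<ge> 0" "M < lambda_star ?L" "\<And>\<rho>. \<rho> \<in> \<Psi> \<Longrightarrow> lam \<rho> \<le> M"
    using fin star lam by (auto simp: M_def)
  define v where "v = M\<^sup>2"
  have "v < (lambda_star ?L)\<^sup>2" unfolding v_def using M by (intro power_strict_mono) auto
  then have "v * ?L < (lambda_star ?L)\<^sup>2 * ?L" using L by (intro mult_strict_right_mono) auto
  then have v: "v * ?L < 2 * kl_const ?L" "v \<ge> 0" unfolding lambda_star_square[OF L] by (auto simp: v_def)
  have lv: "(lam \<rho>)\<^sup>2 \<le> v" if "\<rho> \<in> \<Psi>" for \<rho>
    unfolding v_def using M lam that by (intro power_mono) auto
  define C where "C = (1 / sqrt (1 - v * ?L / (2 * kl_const ?L))) ^ ?L"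
  have C: "C \<ge> 0" using v K by (simp add: C_def)
  show ?thesis
  proof (rule contiguousI[where C = C])
    show "prob_space (GSynch n lam G \<Psi>)" "prob_space (GSynch n (\<lambda>_. 0) G \<Psi>)" for n
      by (intro prob_space_GSynch freq)+
    show "sets (GSynch n lam G \<Psi>) = sets (GSynch n (\<lambda>_. 0) G \<Psi>)" for n
      by (simp add: GSynch_eq)
    fix n :: nat and A assume n: "n > 0" and "A \<in> sets (GSynch n (\<lambda>_. 0) G \<Psi>)"
    then have A: "A \<in> sets (obs_space \<Psi> n)" by (simp add: GSynch_eq)
    interpret P: prob_space "GSynch n lam G \<Psi>" by (rule prob_space_GSynch[OF freq])
    interpret Q: prob_space "GSynch n (\<lambda>_. 0) G \<Psi>" by (rule prob_space_GSynch[OF freq])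
    have "(emeasure (GSynch n lam G \<Psi>) A)\<^sup>2 \<le> ennreal C * emeasure (GSynch n (\<lambda>_. 0) G \<Psi>) A"
      unfolding C_def by (rule GSynch_second_moment[OF \<Psi> L n lv v A])
    then have "ennreal ((measure (GSynch n lam G \<Psi>) A)\<^sup>2) \<le> ennreal (C * measure (GSynch n (\<lambda>_. 0) G \<Psi>) A)"
      using C by (simp add: P.emeasure_eq_measure Q.emeasure_eq_measure ennreal_mult ennreal_power)
    then show "(measure (GSynch n lam G \<Psi>) A)\<^sup>2 \<le> C * measure (GSynch n (\<lambda>_. 0) G \<Psi>) A"
      using C by (subst (asm) ennreal_le_iff) auto
  qed
qed

end

theorem theorem6p16:
  fixes G :: "('g, 'b) monoid_scheme"
    and L :: nat
    and \<Psi>all :: "('g \<Rightarrow> complex mat) set"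
    and lam :: "('g \<Rightarrow> complex mat) \<Rightarrow> real"
  assumes "group G" and "finite (carrier G)" and "Coset.order G = L" and "L \<ge> 2"
    and "all_frequencies G \<Psi>all"
    and "\<forall>\<rho>\<in>\<Psi>all. lam \<rho> \<ge> 0"
    and "\<forall>\<rho>\<in>\<Psi>all. lam \<rho> < lambda_star L"
  shows "contiguous (\<lambda>n. GSynch n lam G \<Psi>all) (\<lambda>n. GSynch n (\<lambda>_. 0) G \<Psi>all)"
proof -
  interpret finite_group G
    using assms(1,2) by (intro finite_group.intro finite_group_axioms.intro)
  show ?thesis
    using assms by (intro GSynch_contiguous) (auto simp: Coset.order_def)
qed

end
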